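(* Let $F$ be an infinite field of characteristic not $2$ and let $n$ be odd. Let $V=M_n(F)\oplus M_n(F)$ with the action of $PO_n$ by simultaneous conjugation on both summands. Then the invariant field $F(V)^{PO_n}$ is rational (purely transcendental) over $F$.
   Context: $O_n=\{A\in GL_n(F): AA^T=I\}$ and $PO_n$ denotes the image of $O_n$ in $PGL_n(F)=GL_n(F)/F^*$. $PGL_n(F)$ acts on $M_n(F)$ by conjugation, hence diagonally on $V$, and on the field $F(V)$ of rational functions on $V$; $F(V)^{G}$ denotes the subfield of functions invariant under a subgroup $G$. *)

theory Defs
  imports "HOL-Library.Poly_Mapping" "HOL-Computational_Algebra.Fraction_Field"
begin

text \<open>Multivariate polynomials over 'a in variables indexed by nat:
  a polynomial maps each monomial (finitely supported exponent vector) to its coefficient.\<close>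
type_synonym 'a mpoly = "(nat \<Rightarrow>\<^sub>0 nat) \<Rightarrow>\<^sub>0 'a"

definition mconst :: "'a::comm_ring_1 \<Rightarrow> 'a mpoly" where
  "mconst c = Poly_Mapping.single 0 c"

definition mvar :: "nat \<Rightarrow> 'a::comm_ring_1 mpoly" where
  "mvar v = Poly_Mapping.single (Poly_Mapping.single v 1) 1"

definition vars :: "'a::zero mpoly \<Rightarrow> nat set" where
  "vars p = (\<Union>m\<in>Poly_Mapping.keys p. Poly_Mapping.keys m)"

definition heval :: "('a::zero \<Rightarrow> 'b::comm_ring_1) \<Rightarrow> (nat \<Rightarrow> 'b) \<Rightarrow> 'a mpoly \<Rightarrow> 'b" where
  "heval h x p = (\<Sum>m\<in>Poly_Mapping.keys p. h (Poly_Mapping.lookup p m) * (\<Prod>v\<in>Poly_Mapping.keys m. x v ^ Poly_Mapping.lookup m v))"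

definition msubst :: "(nat \<Rightarrow> 'a::comm_ring_1 mpoly) \<Rightarrow> 'a mpoly \<Rightarrow> 'a mpoly" where
  "msubst \<sigma> p = heval mconst \<sigma> p"

text \<open>Coordinates of V = M_n(F) (+) M_n(F): variable s*n*n + i*n + j is entry (i,j) of the s-th matrix.\<close>
definition coord :: "nat \<Rightarrow> nat \<Rightarrow> nat \<Rightarrow> nat \<Rightarrow> nat" where
  "coord n s i j = s * n * n + i * n + j"

definition orthogonal_mat :: "nat \<Rightarrow> (nat \<Rightarrow> nat \<Rightarrow> 'a::field) \<Rightarrow> bool" where
  "orthogonal_mat n A \<longleftrightarrow>
     (\<forall>i<n. \<forall>j<n. (\<Sum>k<n. A i k * A j k) = (if i = j then 1 else 0))"

text \<open>Pull-back of coordinate functions along (X,Y) |-> (A X A^T, A Y A^T).\<close>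
definition conj_subst :: "nat \<Rightarrow> (nat \<Rightarrow> nat \<Rightarrow> 'a::field) \<Rightarrow> nat \<Rightarrow> 'a mpoly" where
  "conj_subst n A v =
     (if v < 2 * n * n then
        (let s = v div (n * n); i = (v mod (n * n)) div n; j = v mod n in
          \<Sum>k<n. \<Sum>l<n. mconst (A i k * A j l) * mvar (coord n s k l))
      else mvar v)"

definition ratfun_field :: "nat \<Rightarrow> 'a::field mpoly fract set" where
  "ratfun_field n = {Fract p q | p q. vars p \<subseteq> {..<2*n*n} \<and> vars q \<subseteq> {..<2*n*n} \<and> q \<noteq> 0}"

text \<open>Invariant subfield F(V)^{PO_n}.  Scalars act trivially by conjugation, so
  invariance under PO_n is invariance under O_n.\<close>
definition inv_field :: "nat \<Rightarrow> 'a::field mpoly fract set" where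
  "inv_field n = {f \<in> ratfun_field n. \<forall>A. orthogonal_mat n A \<longrightarrow>
      (\<forall>p q. q \<noteq> 0 \<longrightarrow> f = Fract p q \<longrightarrow>
          Fract (msubst (conj_subst n A) p) (msubst (conj_subst n A) q) = f)}"

definition purely_transcendental :: "('a::field \<Rightarrow> 'k::field) \<Rightarrow> 'k set \<Rightarrow> bool" where
  "purely_transcendental c L \<longleftrightarrow>
     (\<exists>(m::nat) (t::nat \<Rightarrow> 'k).
        (\<forall>i<m. t i \<in> L) \<and>
        (\<forall>P::'a mpoly. vars P \<subseteq> {..<m} \<longrightarrow> heval c t P = 0 \<longrightarrow> P = 0) \<and>
        L = {heval c t P / heval c t Q | P Q. vars P \<subseteq> {..<m} \<and> vars Q \<subseteq> {..<m}
                                          \<and> heval c t Q \<noteq> 0})"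

definition const_fract :: "'a::field \<Rightarrow> 'a mpoly fract" where
  "const_fract a = Fract (mconst a) 1"

end

theory Submission
  imports Defs "Jordan_Normal_Form.Determinant"
begin

hide_const (open) Rat.Fract Matrix.orthogonal_mat

text \<open>
  Write a pair as \<open>(X, Y)\<close>. The skew-symmetric matrix \<open>K = X - X\<^sup>T\<close> has odd size, so its kernel
  is generically a line, spanned by \<open>w\<close> say, and orthogonalising \<open>w, Y w, Y\<^sup>2 w, \<dots>\<close> without
  normalisation yields a frame \<open>u\<^sub>0, \<dots>, u\<^bsub>n-1\<^esub>\<close> that is equivariant up to a common scalar. Hence
  the quotients of \<open>u\<^sub>i \<bullet> X u\<^sub>j\<close> and \<open>u\<^sub>i \<bullet> Y u\<^sub>j\<close> by \<open>w \<bullet> w\<close> are invariant.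

  On the slice where \<open>w = e\<^sub>0\<close> and \<open>Y\<close> is upper Hessenberg, the frame is \<open>u\<^sub>i = z\<^sub>i e\<^sub>i\<close>, with \<open>z\<^sub>i\<close> the
  product of the first \<open>i\<close> subdiagonal entries of \<open>Y\<close>. In the coordinates \<open>z\<^sub>i\<close> and
  \<open>z\<^sub>i M\<^sub>i\<^sub>j z\<^sub>j\<close> (\<open>M = X, Y\<close>) of the slice, the diagonal sign matrices act only by \<open>z\<^sub>i \<mapsto> \<plusminus> z\<^sub>i\<close>, and
  the invariants above restrict to the \<open>z\<^sub>i\<^sup>2\<close> and the remaining coordinates: they generate the rational
  functions on the slice that are invariant under sign changes and are algebraically independent.

  The conjugates of the slice under the \<open>F\<close>-rational orthogonal group are Zariski dense, so an
  invariant is determined by its restriction to the slice. Density is checked at one point: curves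
  through it built from Cayley transforms have every tangent direction, and a polynomial vanishing
  on all of them has no Taylor term of lowest degree there.
\<close>

text \<open>For n > 1, restriction to the slice kills nonzero polynomials, so it is only a partial
  map on fractions, and much of the work is control of denominators. Those of the frame are handled
  on the slice itself: the norms restrict to the squares of the \<open>z_i\<close>, and the minor of
  \<open>K\<close> behind Cramer's rule is nonzero already at the base point. An invariant may be
  given with a denominator that vanishes on the slice; an orthogonal substitution then yields
  another representative of the same fraction whose denominator survives.

  The coordinates \<open>z_i M_ij z_j\<close> are chosen because a sign matrix fixing
  \<open>e_0\<close> multiplies \<open>M_ij\<close> by the same signs as \<open>z_i z_j\<close>.
  Square roots are avoided throughout, since \<open>F\<close> need not contain them; the Cayley
  transform supplies orthogonal matrices whose entries are rational in a parameter over any such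
  field.\<close>

subsection \<open>Evaluation of polynomials\<close>

definition monval :: "(nat \<Rightarrow> 'b::comm_ring_1) \<Rightarrow> (nat \<Rightarrow>\<^sub>0 nat) \<Rightarrow> 'b" where
  "monval x m = (\<Prod>v\<in>Poly_Mapping.keys m. x v ^ Poly_Mapping.lookup m v)"

lemma monval_superset:
  assumes "finite S" "Poly_Mapping.keys m \<subseteq> S"
  shows "monval x m = (\<Prod>v\<in>S. x v ^ Poly_Mapping.lookup m v)"
  unfolding monval_def
  by (rule prod.mono_neutral_left) (use assms in \<open>auto simp: in_keys_iff\<close>)

lemma monval_zero [simp]: "monval x 0 = 1"
  by (simp add: monval_def)

lemma monval_add: "monval x (m + m') = monval x m * monval x m'"
proof -
  let ?S = "Poly_Mapping.keys m \<union> Poly_Mapping.keys m'"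
  have "Poly_Mapping.keys (m + m') \<subseteq> ?S" by (rule keys_add)
  then show ?thesis
    using monval_superset[of ?S "m + m'" x] monval_superset[of ?S m x] monval_superset[of ?S m' x]
    by (simp add: lookup_add power_add prod.distrib)
qed

lemma monval_single [simp]: "monval x (Poly_Mapping.single v k) = x v ^ k"
  by (cases "k = 0") (auto simp: monval_def)

lemma heval_monval:
  "heval h x p = (\<Sum>m\<in>Poly_Mapping.keys p. h (Poly_Mapping.lookup p m) * monval x m)"
  by (simp add: heval_def monval_def)

lemma mpoly_induct [case_names zero monom_add]:
  fixes p :: "'a::comm_monoid_add mpoly"
  assumes zero: "P 0"
    and add: "\<And>c m q. c \<noteq> 0 \<Longrightarrow> m \<notin> Poly_Mapping.keys q \<Longrightarrow> P q \<Longrightarrow> P (Poly_Mapping.single m c + q)"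
  shows "P p"
proof (induction p rule: update_induct)
  case (update f a b)
  have "Poly_Mapping.update a b f = Poly_Mapping.single a b + f"
    using update(1)
    by (intro poly_mapping_eqI) (auto simp: lookup_update lookup_add lookup_single in_keys_iff when_def)
  then show ?case using add[OF update(2,1,3)] by simp
qed (rule zero)

lemma heval_cong:
  "(\<And>v. v \<in> vars p \<Longrightarrow> x v = y v) \<Longrightarrow> heval h x p = heval h y p"
  unfolding heval_def
  by (intro sum.cong refl arg_cong2[of _ _ _ _ "(*)"] prod.cong arg_cong2[of _ _ _ _ "(^)"])
    (auto simp: vars_def)

context comm_ring_hom
begin

lemma heval_superset:
  assumes "finite S" "Poly_Mapping.keys p \<subseteq> S"
  shows "heval hom x p = (\<Sum>m\<in>S. hom (Poly_Mapping.lookup p m) * monval x m)"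
  unfolding heval_monval
  by (rule sum.mono_neutral_left) (use assms in \<open>auto simp: in_keys_iff\<close>)

lemma heval_zero [simp]: "heval hom x 0 = 0"
  by (simp add: heval_def)

lemma heval_single [simp]: "heval hom x (Poly_Mapping.single m c) = hom c * monval x m"
  by (cases "c = 0") (auto simp: heval_monval)

lemma heval_add: "heval hom x (p + q) = heval hom x p + heval hom x q"
proof -
  let ?S = "Poly_Mapping.keys p \<union> Poly_Mapping.keys q"
  have "Poly_Mapping.keys (p + q) \<subseteq> ?S" by (rule keys_add)
  then show ?thesis
    using heval_superset[of ?S "p + q" x] heval_superset[of ?S p x] heval_superset[of ?S q x]
    by (simp add: lookup_add hom_distribs algebra_simps sum.distrib)
qed

lemma heval_mult: "heval hom x (p * q) = heval hom x p * heval hom x q"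
proof (induction p rule: mpoly_induct)
  case (monom_add c m p)
  have "heval hom x (Poly_Mapping.single m c * q) = hom c * monval x m * heval hom x q"
    by (induction q rule: mpoly_induct)
      (auto simp: distrib_left heval_add mult_single hom_mult monval_add algebra_simps)
  with monom_add show ?case by (simp add: distrib_right heval_add)
qed simp

lemma heval_const [simp]: "heval hom x (mconst c) = hom c"
  by (simp add: mconst_def)

lemma heval_var [simp]: "heval hom x (mvar v) = x v"
  by (simp add: mvar_def)

lemma heval_one [simp]: "heval hom x 1 = 1"
  by (simp flip: single_one)

lemma comm_ring_hom_heval: "comm_ring_hom (heval hom x)"
  by unfold_locales (auto simp: heval_add heval_mult)

end

lemma comm_ring_hom_mconst: "comm_ring_hom mconst"
  by unfold_locales (auto simp: mconst_def single_add mult_single)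

lemma comm_ring_hom_id: "comm_ring_hom (\<lambda>x. x)"
  by unfold_locales auto

lemma comm_ring_hom_msubst: "comm_ring_hom (msubst s)"
  unfolding msubst_def[abs_def] by (rule comm_ring_hom.comm_ring_hom_heval[OF comm_ring_hom_mconst])

lemma msubst_var [simp]: "msubst s (mvar v) = s v"
  by (simp add: msubst_def comm_ring_hom.heval_var[OF comm_ring_hom_mconst])

lemma msubst_const [simp]: "msubst s (mconst c) = mconst c"
  by (simp add: msubst_def comm_ring_hom.heval_const[OF comm_ring_hom_mconst])

text \<open>A polynomial ring is free on its variables over its constants. Homomorphisms out of it
  can therefore be identified by their values on constants and variables, which is how
  \<open>heval_msubst\<close> and \<open>heval_Fract\<close> are obtained.\<close>

lemma hom_eq_heval:
  assumes "comm_ring_hom \<theta>"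
  shows "\<theta> p = heval (\<lambda>c. \<theta> (mconst c)) (\<lambda>v. \<theta> (mvar v)) p"
proof -
  interpret t: comm_ring_hom \<theta> by fact
  interpret c: comm_ring_hom mconst by (rule comm_ring_hom_mconst)
  interpret h: comm_ring_hom "\<lambda>c. \<theta> (mconst c)"
    by unfold_locales (auto simp: hom_distribs)
  have m: "\<theta> (Poly_Mapping.single m 1) = monval (\<lambda>v. \<theta> (mvar v)) m" for m
  proof (induction m rule: update_induct)
    case const then show ?case by simp
  next
    case (update f a b)
    have *: "Poly_Mapping.update a b f = Poly_Mapping.single a b + f"
      using update(1)
      by (intro poly_mapping_eqI) (auto simp: lookup_update lookup_add lookup_single in_keys_iff when_def)
    have "mvar a ^ b = (Poly_Mapping.single (Poly_Mapping.single a b) 1 :: 'a mpoly)"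
      by (induction b) (auto simp: mvar_def mult_single simp flip: single_add)
    then have "\<theta> (Poly_Mapping.single (Poly_Mapping.single a b) 1) = \<theta> (mvar a) ^ b"
      by (metis t.hom_power)
    moreover have "Poly_Mapping.single (Poly_Mapping.single a b + f) (1::'a)
       = Poly_Mapping.single (Poly_Mapping.single a b) 1 * Poly_Mapping.single f 1"
      by (simp add: mult_single)
    ultimately show ?case using update(3) by (simp add: * t.hom_mult monval_add)
  qed
  show ?thesis
  proof (induction p rule: mpoly_induct)
    case (monom_add c m p)
    have "Poly_Mapping.single m c = mconst c * Poly_Mapping.single m 1"
      by (simp add: mconst_def mult_single)
    then have "\<theta> (Poly_Mapping.single m c) = \<theta> (mconst c) * monval (\<lambda>v. \<theta> (mvar v)) m"
      by (simp add: t.hom_mult m)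
    with monom_add show ?case by (simp add: t.hom_add h.heval_add)
  qed simp
qed

lemma heval_msubst:
  assumes "comm_ring_hom h"
  shows "heval h x (msubst s p) = heval h (\<lambda>v. heval h x (s v)) p"
proof -
  interpret comm_ring_hom h by fact
  interpret H: comm_ring_hom "heval h x" by (rule comm_ring_hom_heval)
  interpret S: comm_ring_hom "msubst s" by (rule comm_ring_hom_msubst)
  have "comm_ring_hom (\<lambda>p. heval h x (msubst s p))"
    by unfold_locales (auto simp: hom_distribs)
  from hom_eq_heval[OF this] show ?thesis by simp
qed

lemma msubst_mvar [simp]: "msubst mvar p = p"
  using hom_eq_heval[OF comm_ring_hom_id, of p] by (simp add: msubst_def)

lemma msubst_msubst: "msubst s (msubst s' p) = msubst (\<lambda>v. msubst s (s' v)) p"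
  using heval_msubst[OF comm_ring_hom_mconst] by (simp add: msubst_def)

subsection \<open>Extending ring homomorphisms to fractions\<close>

text \<open>A homomorphism that is not injective extends only to the fractions whose denominator it does
  not kill, so the extension is a relation.\<close>

definition specializes :: "('r::idom \<Rightarrow> 'k::field) \<Rightarrow> 'r fract \<Rightarrow> 'k \<Rightarrow> bool" where
  "specializes \<theta> f h \<longleftrightarrow> (\<exists>p q. \<theta> q \<noteq> 0 \<and> f = Fract p q \<and> h = \<theta> p / \<theta> q)"

locale specialization = comm_ring_hom \<theta> for \<theta> :: "'r::idom \<Rightarrow> 'k::field"
begin

lemma specializes_Fract: "\<theta> q \<noteq> 0 \<Longrightarrow> specializes \<theta> (Fract p q) (\<theta> p / \<theta> q)"
  by (auto simp: specializes_def)

lemma specializes_Fract_1: "specializes \<theta> (Fract p 1) (\<theta> p)"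
  using specializes_Fract[of 1 p] by simp

text \<open>Cross-multiplying with a representative whose denominator survives gives the relation
  for every representative, including those whose denominator is killed by \<theta>; hence the
  division-free form.\<close>

lemma specializes_eq:
  assumes "specializes \<theta> (Fract p q) h" "q \<noteq> 0"
  shows "\<theta> p = h * \<theta> q"
proof -
  obtain p' q' where *: "\<theta> q' \<noteq> 0" "Fract p q = Fract p' q'" "h = \<theta> p' / \<theta> q'"
    using assms(1) by (auto simp: specializes_def)
  then have "q' \<noteq> 0" by auto
  with * assms(2) have "p * q' = p' * q" by (simp add: eq_fract)
  then have "\<theta> p * \<theta> q' = \<theta> p' * \<theta> q" by (metis hom_mult)
  also have "\<dots> = h * \<theta> q * \<theta> q'" using * by simp
  finally show ?thesis using *(1) by simp
qed

lemma specializes_unique: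
  assumes "specializes \<theta> f h" "specializes \<theta> f h'"
  shows "h = h'"
proof -
  obtain p q where *: "\<theta> q \<noteq> 0" "f = Fract p q" "h = \<theta> p / \<theta> q"
    using assms(1) by (auto simp: specializes_def)
  then have "q \<noteq> 0" by auto
  then have "\<theta> p = h' * \<theta> q" using specializes_eq[of p q h'] assms(2) * by auto
  with * show ?thesis by simp
qed

lemma specializes_0 [simp]: "specializes \<theta> 0 0"
  using specializes_Fract_1[of 0] by (simp add: Zero_fract_def)

lemma specializes_1 [simp]: "specializes \<theta> 1 1"
  using specializes_Fract_1[of 1] by (simp add: One_fract_def)

text \<open>The test behind the generic nonvanishing results: zero specialises only to zero.\<close>

lemma specializes_nonzero: "specializes \<theta> f h \<Longrightarrow> h \<noteq> 0 \<Longrightarrow> f \<noteq> 0"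
  using specializes_unique specializes_0 by blast

lemma specializes_add:
  assumes "specializes \<theta> f h" "specializes \<theta> f' h'"
  shows "specializes \<theta> (f + f') (h + h')"
proof -
  obtain p q where 1: "\<theta> q \<noteq> 0" "f = Fract p q" "h = \<theta> p / \<theta> q"
    using assms(1) by (auto simp: specializes_def)
  obtain p' q' where 2: "\<theta> q' \<noteq> 0" "f' = Fract p' q'" "h' = \<theta> p' / \<theta> q'"
    using assms(2) by (auto simp: specializes_def)
  have "q \<noteq> 0" "q' \<noteq> 0" using 1 2 by auto
  then show ?thesis
    using specializes_Fract[of "q * q'" "p * q' + p' * q"] 1 2
    by (simp add: hom_distribs add_frac_eq)
qed

lemma specializes_mult:
  assumes "specializes \<theta> f h" "specializes \<theta> f' h'"
  shows "specializes \<theta> (f * f') (h * h')"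
proof -
  obtain p q where 1: "\<theta> q \<noteq> 0" "f = Fract p q" "h = \<theta> p / \<theta> q"
    using assms(1) by (auto simp: specializes_def)
  obtain p' q' where 2: "\<theta> q' \<noteq> 0" "f' = Fract p' q'" "h' = \<theta> p' / \<theta> q'"
    using assms(2) by (auto simp: specializes_def)
  show ?thesis
    using specializes_Fract[of "q * q'" "p * p'"] 1 2
    by (simp add: hom_distribs)
qed

lemma specializes_uminus: "specializes \<theta> f h \<Longrightarrow> specializes \<theta> (- f) (- h)"
  using specializes_mult[OF specializes_Fract_1[of "-1"], of f h]
  by (simp add: hom_distribs flip: minus_fract One_fract_def)

lemma specializes_diff:
  "specializes \<theta> f h \<Longrightarrow> specializes \<theta> f' h' \<Longrightarrow> specializes \<theta> (f - f') (h - h')"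
  using specializes_add[OF _ specializes_uminus, of f h f' h'] by simp

lemma specializes_divide:
  assumes "specializes \<theta> f h" "specializes \<theta> f' h'" "h' \<noteq> 0"
  shows "specializes \<theta> (f / f') (h / h')"
proof -
  obtain p q where 2: "\<theta> q \<noteq> 0" "f' = Fract p q" "h' = \<theta> p / \<theta> q"
    using assms(2) by (auto simp: specializes_def)
  with \<open>h' \<noteq> 0\<close> have "\<theta> p \<noteq> 0" by auto
  from specializes_mult[OF assms(1) specializes_Fract[OF this, of q]] 2
  show ?thesis by (simp add: divide_inverse mult.commute)
qed

lemma specializes_sum:
  "(\<And>i. i \<in> I \<Longrightarrow> specializes \<theta> (f i) (h i)) \<Longrightarrow> specializes \<theta> (sum f I) (sum h I)"
  by (induction I rule: infinite_finite_induct) (auto intro: specializes_add)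

lemma specializes_power: "specializes \<theta> f h \<Longrightarrow> specializes \<theta> (f ^ k) (h ^ k)"
  by (induction k) (auto intro: specializes_mult)

lemma specializes_prod:
  "(\<And>i. i \<in> I \<Longrightarrow> specializes \<theta> (f i) (h i)) \<Longrightarrow> specializes \<theta> (prod f I) (prod h I)"
  by (induction I rule: infinite_finite_induct) (auto intro: specializes_mult)

lemma specializes_heval:
  assumes "\<And>a. specializes \<theta> (c a) (c' a)"
    and "\<And>v. v \<in> vars p \<Longrightarrow> specializes \<theta> (x v) (x' v)"
  shows "specializes \<theta> (heval c x p) (heval c' x' p)"
  unfolding heval_def
  by (intro specializes_sum specializes_mult specializes_prod specializes_power assms)
    (auto simp: vars_def)

lemma specializes_inj_zero:
  assumes "\<And>p. \<theta> p = 0 \<Longrightarrow> p = 0" "specializes \<theta> f 0"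
  shows "f = 0"
  using assms(2) unfolding specializes_def
  by (metis assms(1) divide_eq_0_iff eq_fract(3) eq_fract(2) fract_collapse(1))

end

subsection \<open>Fields of rational functions\<close>

definition is_subfield :: "'k::field set \<Rightarrow> bool" where
  "is_subfield S \<longleftrightarrow> 1 \<in> S \<and> (\<forall>x\<in>S. \<forall>y\<in>S. x - y \<in> S \<and> x * y \<in> S) \<and> (\<forall>x\<in>S. inverse x \<in> S)"

context
  fixes S :: "'k::field set"
  assumes S: "is_subfield S"
begin

lemma is_subfield_1: "1 \<in> S"
  and is_subfield_diff: "x \<in> S \<Longrightarrow> y \<in> S \<Longrightarrow> x - y \<in> S"
  and is_subfield_mult: "x \<in> S \<Longrightarrow> y \<in> S \<Longrightarrow> x * y \<in> S"
  and is_subfield_inverse: "x \<in> S \<Longrightarrow> inverse x \<in> S"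
  using S by (auto simp: is_subfield_def)

lemma is_subfield_0: "0 \<in> S"
  using is_subfield_diff[OF is_subfield_1 is_subfield_1] by simp

lemma is_subfield_uminus: "x \<in> S \<Longrightarrow> - x \<in> S"
  using is_subfield_diff[OF is_subfield_0] by auto

lemma is_subfield_add: "x \<in> S \<Longrightarrow> y \<in> S \<Longrightarrow> x + y \<in> S"
  using is_subfield_diff[OF _ is_subfield_uminus] by fastforce

lemma is_subfield_divide: "x \<in> S \<Longrightarrow> y \<in> S \<Longrightarrow> x / y \<in> S"
  by (simp add: divide_inverse is_subfield_mult is_subfield_inverse)

lemma is_subfield_sum: "(\<And>i. i \<in> I \<Longrightarrow> f i \<in> S) \<Longrightarrow> sum f I \<in> S"
  by (induction I rule: infinite_finite_induct) (auto intro: is_subfield_add is_subfield_0)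

lemma is_subfield_power: "x \<in> S \<Longrightarrow> x ^ k \<in> S"
  by (induction k) (auto intro: is_subfield_mult is_subfield_1)

lemma is_subfield_prod: "(\<And>i. i \<in> I \<Longrightarrow> f i \<in> S) \<Longrightarrow> prod f I \<in> S"
  by (induction I rule: infinite_finite_induct) (auto intro: is_subfield_mult is_subfield_1)

lemma is_subfield_heval:
  "(\<And>a. c a \<in> S) \<Longrightarrow> (\<And>v. v \<in> vars p \<Longrightarrow> x v \<in> S) \<Longrightarrow> heval c x p \<in> S"
  unfolding heval_def
  by (intro is_subfield_sum is_subfield_mult is_subfield_prod is_subfield_power)
    (auto simp: vars_def)

end

lemma is_subfield_Int: "(\<And>i. i \<in> I \<Longrightarrow> is_subfield (S i)) \<Longrightarrow> is_subfield (\<Inter>i\<in>I. S i)"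
  by (auto simp: is_subfield_def)

lemma vars_zero [simp]: "vars 0 = {}"
  by (simp add: vars_def)

lemma vars_add: "vars (p + q) \<subseteq> vars p \<union> vars q"
  unfolding vars_def using keys_add[of p q] by blast

lemma vars_uminus [simp]: "vars (- p :: 'a::ab_group_add mpoly) = vars p"
  by (simp add: vars_def)

lemma vars_diff: "vars (p - q :: 'a::ab_group_add mpoly) \<subseteq> vars p \<union> vars q"
  using vars_add[of p "- q"] by simp

lemma vars_mult: "vars (p * q) \<subseteq> vars p \<union> vars q"
proof
  fix v assume "v \<in> vars (p * q)"
  then obtain m where m: "m \<in> Poly_Mapping.keys (p * q)" "v \<in> Poly_Mapping.keys m"
    by (auto simp: vars_def)
  then obtain a b where "m = a + b" "a \<in> Poly_Mapping.keys p" "b \<in> Poly_Mapping.keys q"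
    using keys_mult[of p q] by auto
  with m show "v \<in> vars p \<union> vars q"
    using keys_add[of a b] by (auto simp: vars_def)
qed

lemma vars_mconst [simp]: "vars (mconst c) = {}"
  by (auto simp: vars_def mconst_def)

lemma vars_one [simp]: "vars 1 = {}"
  by (auto simp: vars_def)

lemma vars_mvar [simp]: "vars (mvar v :: 'a::{comm_ring_1} mpoly) = {v}"
  by (auto simp: vars_def mvar_def)

definition ratfun_over :: "nat set \<Rightarrow> 'a::field mpoly fract set" where
  "ratfun_over W = {Fract p q | p q. vars p \<subseteq> W \<and> vars q \<subseteq> W \<and> q \<noteq> 0}"

lemma ratfun_field_eq: "ratfun_field n = ratfun_over {..<2*n*n}"
  by (simp add: ratfun_field_def ratfun_over_def)

lemma ratfun_overI: "vars p \<subseteq> W \<Longrightarrow> vars q \<subseteq> W \<Longrightarrow> q \<noteq> 0 \<Longrightarrow> Fract p q \<in> ratfun_over W"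
  by (auto simp: ratfun_over_def)

lemma ratfun_over_const: "const_fract c \<in> ratfun_over W"
  unfolding const_fract_def by (rule ratfun_overI) auto

lemma ratfun_over_var: "v \<in> W \<Longrightarrow> Fract (mvar v) 1 \<in> ratfun_over W"
  by (rule ratfun_overI) auto

lemma is_subfield_ratfun_over: "is_subfield (ratfun_over W :: 'a::field mpoly fract set)"
  unfolding is_subfield_def
proof (intro conjI ballI)
  show "(1 :: 'a mpoly fract) \<in> ratfun_over W" unfolding One_fract_def by (rule ratfun_overI) auto
  fix x :: "'a mpoly fract" assume "x \<in> ratfun_over W"
  then obtain p q where x: "x = Fract p q" "vars p \<subseteq> W" "vars q \<subseteq> W" "q \<noteq> 0"
    by (auto simp: ratfun_over_def)
  show "inverse x \<in> ratfun_over W"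
  proof (cases "p = 0")
    case True
    then have "inverse x = Fract 0 1" using x by (simp add: eq_fract)
    then show ?thesis by (auto intro!: ratfun_overI)
  qed (use x in \<open>auto intro!: ratfun_overI\<close>)
  fix y :: "'a mpoly fract" assume "y \<in> ratfun_over W"
  then obtain p' q' where y: "y = Fract p' q'" "vars p' \<subseteq> W" "vars q' \<subseteq> W" "q' \<noteq> 0"
    by (auto simp: ratfun_over_def)
  have *: "vars (a * b) \<subseteq> W" if "vars a \<subseteq> W" "vars b \<subseteq> W" for a b :: "'a mpoly"
    using vars_mult[of a b] that by auto
  have **: "vars (a - b) \<subseteq> W" if "vars a \<subseteq> W" "vars b \<subseteq> W" for a b :: "'a mpoly"
    using vars_diff[of a b] that by auto
  show "x - y \<in> ratfun_over W" "x * y \<in> ratfun_over W"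
    unfolding x(1) y(1) using x(2-4) y(2-4) by (simp_all add: ratfun_overI * **)
qed

lemma comm_ring_hom_const_fract: "comm_ring_hom const_fract"
proof -
  interpret comm_ring_hom mconst by (rule comm_ring_hom_mconst)
  show ?thesis
    by unfold_locales (auto simp: const_fract_def hom_distribs Zero_fract_def One_fract_def)
qed

lemma heval_Fract: "heval const_fract (\<lambda>v. Fract (mvar v) 1) p = Fract p 1"
proof -
  have "comm_ring_hom (\<lambda>p :: 'a mpoly. Fract p 1)"
    by unfold_locales (auto simp: Zero_fract_def One_fract_def)
  from hom_eq_heval[OF this, of p] show ?thesis
    by (simp add: const_fract_def[abs_def])
qed

subsection \<open>Polynomials over infinite fields\<close>

text \<open>Reduction modulo \<open>N\<close> settles the lowest digit, and dividing it off leaves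
  shorter expansions for the induction.\<close>

lemma digits_unique:
  fixes a b :: "nat \<Rightarrow> nat"
  assumes "\<And>v. v < L \<Longrightarrow> a v < N" "\<And>v. v < L \<Longrightarrow> b v < N"
    and "(\<Sum>v<L. a v * N ^ v) = (\<Sum>v<L. b v * N ^ v)" "v < L"
  shows "a v = b v"
  using assms
proof (induction L arbitrary: a b v)
  case (Suc L)
  have shift: "(\<Sum>v<Suc L. c v * N ^ v) = c 0 + N * (\<Sum>v<L. c (Suc v) * N ^ v)" for c :: "nat \<Rightarrow> nat"
    by (subst sum.lessThan_Suc_shift) (simp add: sum_distrib_left algebra_simps)
  have eq: "a 0 + N * (\<Sum>v<L. a (Suc v) * N ^ v) = b 0 + N * (\<Sum>v<L. b (Suc v) * N ^ v)"
    using Suc.prems(3) by (simp only: shift)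
  have ab: "a 0 < N" "b 0 < N" using Suc.prems(1,2)[of 0] by auto
  have "a 0 = b 0" using arg_cong[OF eq, of "\<lambda>x. x mod N"] ab by simp
  moreover have "(\<Sum>v<L. a (Suc v) * N ^ v) = (\<Sum>v<L. b (Suc v) * N ^ v)"
    using eq \<open>a 0 = b 0\<close> ab by simp
  then have "a (Suc v) = b (Suc v)" if "v < L" for v
    using Suc.IH[of "\<lambda>v. a (Suc v)" "\<lambda>v. b (Suc v)" v] Suc.prems(1,2) that by simp
  ultimately show ?case using Suc.prems(4) by (cases v) auto
qed simp

text \<open>Kronecker substitution \<open>x\<^sub>v = t ^ (N ^ v)\<close> sends distinct monomials to distinct powers of \<open>t\<close>.\<close>

lemma exists_nonzero_value:
  fixes c :: "(nat \<Rightarrow>\<^sub>0 nat) \<Rightarrow> 'a::field"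
  assumes inf: "infinite (UNIV :: 'a set)"
    and M: "finite M" "m0 \<in> M" "c m0 \<noteq> 0"
  shows "\<exists>x. (\<Sum>m\<in>M. c m * monval x m) \<noteq> 0"
proof -
  define K where "K = (\<Union>m\<in>M. Poly_Mapping.keys m)"
  have "finite K" using M by (simp add: K_def)
  then obtain L where L: "\<And>v. v \<in> K \<Longrightarrow> v < L"
    using finite_nat_set_iff_bounded by auto
  define R where "R = (\<Union>m\<in>M. Poly_Mapping.lookup m ` {..<L})"
  have "finite R" using M by (simp add: R_def)
  then obtain N where N: "\<And>k. k \<in> R \<Longrightarrow> k < N"
    using finite_nat_set_iff_bounded by auto
  define e where "e m = (\<Sum>v<L. Poly_Mapping.lookup m v * N ^ v)" for m :: "nat \<Rightarrow>\<^sub>0 nat"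
  have outside: "Poly_Mapping.lookup m v = 0" if "m \<in> M" "\<not> v < L" for m v
    using L[of v] that unfolding K_def UN_iff in_keys_iff by blast
  have inj: "m = m'" if "m \<in> M" "m' \<in> M" "e m = e m'" for m m'
  proof (rule poly_mapping_eqI)
    fix v
    show "Poly_Mapping.lookup m v = Poly_Mapping.lookup m' v"
    proof (cases "v < L")
      case True
      show ?thesis
        by (rule digits_unique[of L _ N]) (use N that True in \<open>auto simp: R_def e_def\<close>)
    qed (use outside that in auto)
  qed
  \<comment> \<open>\<open>H\<close> is the sum after the substitution, as a polynomial in
    \<open>t\<close>. By \<open>inj\<close> only \<open>m0\<close> contributes to its coefficient at
    \<open>e m0\<close>, and an infinite field contains a non-root.\<close>
  define H where "H = (\<Sum>m\<in>M. Polynomial.monom (c m) (e m))"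
  have "Polynomial.coeff H (e m0) = (\<Sum>m\<in>M. if m = m0 then c m else 0)"
    unfolding H_def coeff_sum by (intro sum.cong refl) (use inj M in \<open>auto simp: coeff_monom\<close>)
  then have "H \<noteq> 0" using M by (auto simp: sum.delta)
  then have "finite {t. poly H t = 0}" by (rule poly_roots_finite)
  then obtain t where t: "poly H t \<noteq> 0"
    using inf by (metis (mono_tags, lifting) UNIV_I ex_new_if_finite mem_Collect_eq)
  have "monval (\<lambda>v. t ^ (N ^ v)) m = t ^ e m" if "m \<in> M" for m
  proof -
    have "monval (\<lambda>v. t ^ (N ^ v)) m = (\<Prod>v<L. (t ^ (N ^ v)) ^ Poly_Mapping.lookup m v)"
      by (rule monval_superset) (use L that in \<open>auto simp: K_def\<close>)
    then show ?thesis by (simp add: e_def power_sum mult.commute flip: power_mult)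
  qed
  then have "(\<Sum>m\<in>M. c m * monval (\<lambda>v. t ^ (N ^ v)) m) = poly H t"
    by (simp add: H_def poly_sum poly_monom)
  with t show ?thesis by metis
qed

definition total_deg :: "(nat \<Rightarrow>\<^sub>0 nat) \<Rightarrow> nat" where
  "total_deg m = (\<Sum>v\<in>Poly_Mapping.keys m. Poly_Mapping.lookup m v)"

lemma monval_scale: "monval (\<lambda>v. a * x v) m = a ^ total_deg m * monval x m"
  by (simp add: monval_def total_deg_def power_sum power_mult_distrib prod.distrib)

lemma poly_monval: "poly (monval x m) t = monval (\<lambda>v. poly (x v) t) m"
  by (simp add: monval_def poly_prod)

text \<open>The curves through \<open>s\<close> realise every tangent direction \<open>z\<close>; the form of lowest degree in
  the Taylor expansion of \<open>u\<close> at \<open>s\<close> therefore vanishes at every \<open>z\<close>.\<close>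

lemma zero_if_zero_on_curves:
  fixes u :: "'a::field mpoly" and s :: "nat \<Rightarrow> 'a"
  assumes inf: "infinite (UNIV :: 'a set)"
    and curves: "\<And>z. \<exists>D W B. poly D 0 = 1 \<and> (\<forall>v. poly (W v) 0 = z v) \<and> finite B \<and>
      (\<forall>t. t \<notin> B \<longrightarrow> poly D t \<noteq> 0 \<longrightarrow>
        heval (\<lambda>c. c) (\<lambda>v. s v + t * poly (W v) t / poly D t) u = 0)"
  shows "u = 0"
proof (rule ccontr)
  assume "u \<noteq> 0"
  \<comment> \<open>\<open>u'\<close> is \<open>u\<close> expanded about \<open>s\<close>;
    translating back recovers \<open>u\<close>, so it is nonzero.\<close>
  define u' where "u' = msubst (\<lambda>v. mconst (s v) + mvar v) u"
  interpret S: comm_ring_hom "msubst (\<lambda>v. mvar v - mconst (s v))" by (rule comm_ring_hom_msubst)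
  have "msubst (\<lambda>v. mvar v - mconst (s v)) u' = u"
    by (simp add: u'_def msubst_msubst S.hom_add)
  then have "u' \<noteq> 0" using \<open>u \<noteq> 0\<close> by auto
  have ev: "heval (\<lambda>c. c) y u' = heval (\<lambda>c. c) (\<lambda>v. s v + y v) u" for y
    by (simp add: u'_def heval_msubst[OF comm_ring_hom_id]
        comm_ring_hom.heval_add[OF comm_ring_hom_id] comm_ring_hom.heval_const[OF comm_ring_hom_id]
        comm_ring_hom.heval_var[OF comm_ring_hom_id])
  let ?K = "Poly_Mapping.keys u'" and ?c = "Poly_Mapping.lookup u'"
  have K: "finite ?K" "?K \<noteq> {}" using \<open>u' \<noteq> 0\<close> by auto
  define d where "d = Min (total_deg ` ?K)"
  define e where "e = Max (total_deg ` ?K)"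
  have de: "d \<le> total_deg m" "total_deg m \<le> e" if "m \<in> ?K" for m
    using K that by (auto simp: d_def e_def)
  have "d \<in> total_deg ` ?K" unfolding d_def using K by (intro Min_in) auto
  then obtain m0 where m0: "d = total_deg m0" "m0 \<in> ?K" by (rule imageE)
  define M where "M = {m \<in> ?K. total_deg m = d}"
  have M: "finite M" unfolding M_def by (rule finite_subset[OF _ K(1)]) blast
  have m0M: "m0 \<in> M" unfolding M_def using m0 by simp
  obtain z where z: "(\<Sum>m\<in>M. ?c m * monval z m) \<noteq> 0"
    using exists_nonzero_value[of M m0 ?c, OF inf M m0M iffD1[OF in_keys_iff m0(2)]] by (elim exE)
  obtain D W B where DWB: "poly D 0 = 1 \<and> (\<forall>v. poly (W v) 0 = z v) \<and> finite B \<and>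
      (\<forall>t. t \<notin> B \<longrightarrow> poly D t \<noteq> 0 \<longrightarrow>
        heval (\<lambda>c. c) (\<lambda>v. s v + t * poly (W v) t / poly D t) u = 0)"
    using curves[of z] by (elim exE)
  then have D: "poly D 0 = 1" and W: "\<And>v. poly (W v) 0 = z v" and B: "finite B" by auto
  have zero: "heval (\<lambda>c. c) (\<lambda>v. t * poly (W v) t / poly D t) u' = 0"
    if "t \<notin> B" "poly D t \<noteq> 0" for t
    unfolding ev using DWB that by simp
  \<comment> \<open>\<open>H\<close> is \<open>D^e / t^d\<close> times the value of
    \<open>u'\<close> on the curve. As \<open>d\<close> and \<open>e\<close> are the extreme
    degrees, it is a polynomial in \<open>t\<close>, and at \<open>t = 0\<close> only the form of
    degree \<open>d\<close>, evaluated at \<open>z\<close>, is left.\<close>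
  define H where "H = (\<Sum>m\<in>?K. [:?c m:] * monval W m * [:0, 1:] ^ (total_deg m - d) * D ^ (e - total_deg m))"
  have "poly H 0 = (\<Sum>m\<in>?K. if total_deg m = d then ?c m * monval z m else 0)"
    unfolding H_def poly_sum
    by (intro sum.cong refl) (auto simp: D W poly_monval power_0_left dest: de(1))
  also have "\<dots> = (\<Sum>m\<in>M. ?c m * monval z m)"
    unfolding M_def by (rule sum.inter_filter[symmetric]) simp
  finally have "H \<noteq> 0" using z by auto
  have root: "poly H t = 0" if t: "t \<notin> B" "poly D t \<noteq> 0" "t \<noteq> 0" for t
  proof -
    let ?D = "poly D t"
    have "t ^ d * poly H t = (\<Sum>m\<in>?K. ?D ^ e * (?c m * ((t / ?D) ^ total_deg m * monval (\<lambda>v. poly (W v) t) m)))"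
      unfolding H_def poly_sum sum_distrib_left
    proof (intro sum.cong refl)
      fix m assume "m \<in> ?K"
      then obtain i j where i: "total_deg m = d + i" and j: "e = total_deg m + j"
        using de by (metis le_Suc_ex)
      show "t ^ d * poly ([:?c m:] * monval W m * [:0, 1:] ^ (total_deg m - d) * D ^ (e - total_deg m)) t
          = ?D ^ e * (?c m * ((t / ?D) ^ total_deg m * monval (\<lambda>v. poly (W v) t) m))"
        using \<open>?D \<noteq> 0\<close> unfolding j by (simp add: i poly_monval power_add power_divide)
    qed
    also have "\<dots> = ?D ^ e * heval (\<lambda>c. c) (\<lambda>v. t / ?D * poly (W v) t) u'"
      by (simp only: heval_monval monval_scale sum_distrib_left)
    also have "\<dots> = 0" using zero[OF t(1,2)] by simp
    finally show ?thesis using t by simp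
  qed
  have "finite {t. poly D t = 0}" using D by (intro poly_roots_finite) auto
  moreover have "finite {t. poly H t = 0}" using \<open>H \<noteq> 0\<close> by (rule poly_roots_finite)
  moreover have "UNIV \<subseteq> B \<union> {t. poly D t = 0} \<union> {0} \<union> {t. poly H t = 0}" using root by auto
  ultimately have "finite (UNIV :: 'a set)" using B finite_subset by blast
  with inf show False by simp
qed

subsection \<open>Gram-Schmidt orthogonalisation of a Krylov sequence\<close>

definition dotp :: "nat \<Rightarrow> (nat \<Rightarrow> 'k::comm_ring_1) \<Rightarrow> (nat \<Rightarrow> 'k) \<Rightarrow> 'k" where
  "dotp n x y = (\<Sum>k<n. x k * y k)"

definition mapply :: "nat \<Rightarrow> (nat \<Rightarrow> nat \<Rightarrow> 'k::comm_ring_1) \<Rightarrow> (nat \<Rightarrow> 'k) \<Rightarrow> nat \<Rightarrow> 'k" where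
  "mapply n M x i = (\<Sum>k<n. M i k * x k)"

text \<open>Only ratios of dot products occur, so the sequence stays in any field containing the
  data. A zero norm makes its term zero by convention; nonzero norms are assumed where the quotients
  must specialise.\<close>

fun gram_schmidt_seq :: "nat \<Rightarrow> (nat \<Rightarrow> nat \<Rightarrow> 'k::field) \<Rightarrow> (nat \<Rightarrow> 'k) \<Rightarrow> nat \<Rightarrow> nat \<Rightarrow> 'k" where
  "gram_schmidt_seq n Y w 0 = w"
| "gram_schmidt_seq n Y w (Suc k) =
    (\<lambda>i. mapply n Y (gram_schmidt_seq n Y w k) i -
      (\<Sum>j\<le>k. dotp n (gram_schmidt_seq n Y w j) (mapply n Y (gram_schmidt_seq n Y w k)) /
        dotp n (gram_schmidt_seq n Y w j) (gram_schmidt_seq n Y w j) * gram_schmidt_seq n Y w j i))"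

definition frame_entry ::
  "nat \<Rightarrow> (nat \<Rightarrow> nat \<Rightarrow> 'k::field) \<Rightarrow> (nat \<Rightarrow> 'k) \<Rightarrow> (nat \<Rightarrow> nat \<Rightarrow> 'k) \<Rightarrow> nat \<Rightarrow> nat \<Rightarrow> 'k" where
  "frame_entry n Y w M i j =
    dotp n (gram_schmidt_seq n Y w i) (mapply n M (gram_schmidt_seq n Y w j)) / dotp n w w"

text \<open>The entries of \<open>A M A^T\<close>. Matrices as functions on indices allow one
  formula over \<open>F\<close>, over polynomials and over fractions.\<close>

definition conj_mat :: "nat \<Rightarrow> (nat \<Rightarrow> nat \<Rightarrow> 'k::comm_ring_1) \<Rightarrow> (nat \<Rightarrow> nat \<Rightarrow> 'k) \<Rightarrow> nat \<Rightarrow> nat \<Rightarrow> 'k" where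
  "conj_mat n A M i j = (\<Sum>k<n. \<Sum>l<n. A i k * A j l * M k l)"

lemma dotp_cong: "(\<And>i. i < n \<Longrightarrow> x i = x' i) \<Longrightarrow> (\<And>i. i < n \<Longrightarrow> y i = y' i) \<Longrightarrow> dotp n x y = dotp n x' y'"
  by (simp add: dotp_def)

lemma mapply_cong: "(\<And>i. i < n \<Longrightarrow> x i = x' i) \<Longrightarrow> mapply n M x = mapply n M x'"
  by (simp add: mapply_def fun_eq_iff)

lemma dotp_scale: "dotp n (\<lambda>i. c * x i) (\<lambda>i. c * y i) = c\<^sup>2 * dotp n x y"
  by (simp add: dotp_def sum_distrib_left power2_eq_square algebra_simps)

lemma mapply_scale: "mapply n M (\<lambda>i. c * x i) i = c * mapply n M x i"
  by (simp add: mapply_def sum_distrib_left algebra_simps)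

lemma mapply_diff: "mapply n M (\<lambda>i. x i - y i) i = mapply n M x i - mapply n M y i"
  by (simp add: mapply_def sum_subtractf algebra_simps)

lemma mapply_sum: "mapply n M (\<lambda>i. \<Sum>j\<in>J. x j i) i = (\<Sum>j\<in>J. mapply n M (x j) i)"
  unfolding mapply_def by (subst sum.swap) (simp add: sum_distrib_left)

section \<open>Equivariance of the frame under orthogonal matrices\<close>

context
  fixes n :: nat and A :: "nat \<Rightarrow> nat \<Rightarrow> 'k::field"
  assumes orth: "\<And>k l. k < n \<Longrightarrow> l < n \<Longrightarrow> (\<Sum>i<n. A i k * A i l) = (if k = l then 1 else 0)"
begin

lemma dotp_orthogonal: "dotp n (mapply n A x) (mapply n A y) = dotp n x y"
proof -
  have "dotp n (mapply n A x) (mapply n A y) = (\<Sum>i<n. \<Sum>k<n. \<Sum>l<n. A i k * x k * (A i l * y l))"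
    by (simp add: dotp_def mapply_def sum_product)
  also have "\<dots> = (\<Sum>k<n. \<Sum>i<n. \<Sum>l<n. A i k * x k * (A i l * y l))" by (rule sum.swap)
  also have "\<dots> = (\<Sum>k<n. \<Sum>l<n. \<Sum>i<n. A i k * x k * (A i l * y l))"
    by (intro sum.cong refl sum.swap)
  also have "\<dots> = (\<Sum>k<n. \<Sum>l<n. x k * y l * (\<Sum>i<n. A i k * A i l))"
    by (simp add: sum_distrib_left algebra_simps)
  also have "\<dots> = (\<Sum>k<n. \<Sum>l<n. if k = l then x k * y l else 0)"
    by (intro sum.cong refl) (simp add: orth)
  also have "\<dots> = dotp n x y" by (simp add: dotp_def)
  finally show ?thesis .
qed

text \<open>\<open>A^T A = I\<close> cancels in the middle of \<open>A M A^T A x\<close>.\<close>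

lemma mapply_conj_mat: "mapply n (conj_mat n A M) (mapply n A x) i = mapply n A (mapply n M x) i"
proof -
  have "mapply n (conj_mat n A M) (mapply n A x) i =
      (\<Sum>j<n. \<Sum>m<n. \<Sum>k<n. \<Sum>l<n. A i k * A j l * M k l * (A j m * x m))"
    by (simp add: mapply_def conj_mat_def sum_distrib_left sum_distrib_right)
  also have "\<dots> = (\<Sum>m<n. \<Sum>j<n. \<Sum>k<n. \<Sum>l<n. A i k * A j l * M k l * (A j m * x m))"
    by (rule sum.swap)
  also have "\<dots> = (\<Sum>m<n. \<Sum>k<n. \<Sum>j<n. \<Sum>l<n. A i k * A j l * M k l * (A j m * x m))"
    by (intro sum.cong refl sum.swap)
  also have "\<dots> = (\<Sum>m<n. \<Sum>k<n. \<Sum>l<n. \<Sum>j<n. A i k * A j l * M k l * (A j m * x m))"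
    by (intro sum.cong refl sum.swap)
  also have "\<dots> = (\<Sum>m<n. \<Sum>k<n. \<Sum>l<n. A i k * M k l * x m * (\<Sum>j<n. A j l * A j m))"
    by (simp add: sum_distrib_left algebra_simps)
  also have "\<dots> = (\<Sum>m<n. \<Sum>k<n. \<Sum>l<n. if l = m then A i k * M k l * x m else 0)"
    by (intro sum.cong refl) (simp add: orth)
  also have "\<dots> = (\<Sum>m<n. \<Sum>k<n. A i k * M k m * x m)" by simp
  also have "\<dots> = (\<Sum>k<n. \<Sum>m<n. A i k * M k m * x m)" by (rule sum.swap)
  also have "\<dots> = mapply n A (mapply n M x) i"
    by (simp add: mapply_def sum_distrib_left algebra_simps)
  finally show ?thesis .
qed

context
  fixes Y Y' :: "nat \<Rightarrow> nat \<Rightarrow> 'k" and w w' :: "nat \<Rightarrow> 'k" and c :: 'k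
  assumes c: "c \<noteq> 0"
    and Y': "\<And>i j. i < n \<Longrightarrow> j < n \<Longrightarrow> Y' i j = conj_mat n A Y i j"
    and w': "\<And>i. i < n \<Longrightarrow> w' i = c * mapply n A w i"
begin

text \<open>Each projection coefficient is a quotient of two dot products that both acquire
  \<open>c^2\<close>, so \<open>c\<close> cancels there and survives once, as an overall factor. The
  scalar is needed because the kernel vector, normalised by its first entry, is equivariant only up
  to a factor.\<close>

lemma gram_schmidt_seq_conj:
  "i < n \<Longrightarrow> gram_schmidt_seq n Y' w' k i = c * mapply n A (gram_schmidt_seq n Y w k) i"
proof (induction k arbitrary: i rule: less_induct)
  case (less k)
  show ?case
  proof (cases k)
    case 0
    then show ?thesis using less.prems w' by simp
  next
    case (Suc k')
    let ?g = "gram_schmidt_seq n Y w" and ?g' = "gram_schmidt_seq n Y' w'"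
    have IH: "?g' j i = c * mapply n A (?g j) i" if "j \<le> k'" "i < n" for j i
      using less.IH[of j i] that Suc by simp
    have Yg: "mapply n Y' (?g' k') i = c * mapply n A (mapply n Y (?g k')) i" if "i < n" for i
    proof -
      have "mapply n Y' (?g' k') i = mapply n (conj_mat n A Y) (\<lambda>i. c * mapply n A (?g k') i) i"
        unfolding mapply_def[of n Y'] mapply_def[of n "conj_mat n A Y"]
        using that by (intro sum.cong refl) (simp add: IH Y')
      then show ?thesis by (simp add: mapply_scale mapply_conj_mat)
    qed
    have a: "dotp n (?g' j) (mapply n Y' (?g' k')) = c\<^sup>2 * dotp n (?g j) (mapply n Y (?g k'))"
      if "j \<le> k'" for j
      unfolding dotp_orthogonal[of "?g j" "mapply n Y (?g k')", symmetric] dotp_scale[symmetric]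
      by (rule dotp_cong) (use that in \<open>auto simp: IH Yg\<close>)
    have b: "dotp n (?g' j) (?g' j) = c\<^sup>2 * dotp n (?g j) (?g j)" if "j \<le> k'" for j
      unfolding dotp_orthogonal[of "?g j" "?g j", symmetric] dotp_scale[symmetric]
      by (rule dotp_cong) (use that in \<open>auto simp: IH\<close>)
    show ?thesis
      using less.prems c
      by (simp add: Suc Yg a b IH mapply_diff mapply_sum mapply_scale right_diff_distrib
          sum_distrib_left mult.left_commute del: times_divide_eq_left times_divide_eq_right)
  qed
qed

lemma frame_entry_conj:
  assumes M': "\<And>i j. i < n \<Longrightarrow> j < n \<Longrightarrow> M' i j = conj_mat n A M i j"
  shows "frame_entry n Y' w' M' i j = frame_entry n Y w M i j"
proof -
  let ?g = "gram_schmidt_seq n Y w" and ?g' = "gram_schmidt_seq n Y' w'"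
  have Mg: "mapply n M' (?g' j) i = c * mapply n A (mapply n M (?g j)) i" if "i < n" for i
  proof -
    have "mapply n M' (?g' j) i = mapply n (conj_mat n A M) (\<lambda>i. c * mapply n A (?g j) i) i"
      unfolding mapply_def[of n M'] mapply_def[of n "conj_mat n A M"]
      using that by (intro sum.cong refl) (simp add: gram_schmidt_seq_conj M')
    then show ?thesis by (simp add: mapply_scale mapply_conj_mat)
  qed
  have "dotp n (?g' i) (mapply n M' (?g' j)) = c\<^sup>2 * dotp n (?g i) (mapply n M (?g j))"
    unfolding dotp_orthogonal[of "?g i" "mapply n M (?g j)", symmetric] dotp_scale[symmetric]
    by (rule dotp_cong) (auto simp: gram_schmidt_seq_conj Mg)
  moreover have "dotp n w' w' = c\<^sup>2 * dotp n w w"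
    unfolding dotp_orthogonal[of w w, symmetric] dotp_scale[symmetric]
    by (rule dotp_cong) (auto simp: w')
  ultimately show ?thesis using c by (simp add: frame_entry_def)
qed

end

end

section \<open>Specialisation of the frame\<close>

context specialization
begin

lemma specializes_dotp:
  "(\<And>i. i < n \<Longrightarrow> specializes \<theta> (x i) (x' i)) \<Longrightarrow> (\<And>i. i < n \<Longrightarrow> specializes \<theta> (y i) (y' i)) \<Longrightarrow>
    specializes \<theta> (dotp n x y) (dotp n x' y')"
  unfolding dotp_def by (intro specializes_sum specializes_mult) auto

lemma specializes_mapply:
  "(\<And>j. j < n \<Longrightarrow> specializes \<theta> (M i j) (M' i j)) \<Longrightarrow> (\<And>i. i < n \<Longrightarrow> specializes \<theta> (x i) (x' i)) \<Longrightarrow>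
    specializes \<theta> (mapply n M x i) (mapply n M' x' i)"
  unfolding mapply_def by (intro specializes_sum specializes_mult) auto

context
  fixes n :: nat and Y :: "nat \<Rightarrow> nat \<Rightarrow> 'r fract" and Y' :: "nat \<Rightarrow> nat \<Rightarrow> 'k" and w w'
  assumes Y: "\<And>i j. i < n \<Longrightarrow> j < n \<Longrightarrow> specializes \<theta> (Y i j) (Y' i j)"
    and w: "\<And>i. i < n \<Longrightarrow> specializes \<theta> (w i) (w' i)"
begin

text \<open>Nonzero norms are demanded only of the specialised sequence, where they can be computed;
  the generic ones are then nonzero by themselves.\<close>

lemma specializes_gram_schmidt_seq:
  assumes "\<And>j. j < k \<Longrightarrow> dotp n (gram_schmidt_seq n Y' w' j) (gram_schmidt_seq n Y' w' j) \<noteq> 0"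
  shows "i < n \<Longrightarrow> specializes \<theta> (gram_schmidt_seq n Y w k i) (gram_schmidt_seq n Y' w' k i)"
  using assms
proof (induction k arbitrary: i rule: less_induct)
  case (less k)
  show ?case
  proof (cases k)
    case 0
    then show ?thesis using less.prems w by simp
  next
    case (Suc k')
    have IH: "specializes \<theta> (gram_schmidt_seq n Y w j i) (gram_schmidt_seq n Y' w' j i)"
      if "j \<le> k'" "i < n" for j i
      using less.IH[of j i] less.prems(2) that Suc by simp
    show ?thesis unfolding Suc gram_schmidt_seq.simps
      by (intro specializes_diff specializes_sum specializes_mult specializes_divide
          specializes_mapply specializes_dotp less.prems IH Y) (auto simp: Suc less.prems)
  qed
qed

lemma specializes_frame_entry:
  assumes "\<And>j. j < n \<Longrightarrow> dotp n (gram_schmidt_seq n Y' w' j) (gram_schmidt_seq n Y' w' j) \<noteq> 0"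
    and M: "\<And>i j. i < n \<Longrightarrow> j < n \<Longrightarrow> specializes \<theta> (M i j) (M' i j)"
    and "i < n" "j < n"
  shows "specializes \<theta> (frame_entry n Y w M i j) (frame_entry n Y' w' M' i j)"
  unfolding frame_entry_def
  by (intro specializes_divide specializes_dotp specializes_mapply specializes_gram_schmidt_seq M w)
    \<comment> \<open>The instance \<open>j = 0\<close> is the denominator
      \<open>dotp n w' w'\<close> of the frame entry.\<close>
    (use assms in auto, use assms(1)[of 0] in simp)

end

end

section \<open>The frame of a Hessenberg matrix\<close>

lemma sum_eq_single:
  assumes "finite I" "a \<in> I" "\<And>i. i \<in> I \<Longrightarrow> i \<noteq> a \<Longrightarrow> f i = 0"
  shows "sum f I = f a"
  using sum.mono_neutral_right[of I "{a}" f] assms by auto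

text \<open>A Hessenberg \<open>Y\<close> maps \<open>e_k\<close> into the span of
  \<open>e_0, ..., e_(k+1)\<close>. Orthogonalising against multiples of
  \<open>e_0, ..., e_k\<close> removes all but the last component, whose coefficient obeys the
  recursion of \<open>z\<close>.\<close>

lemma gram_schmidt_seq_Hessenberg:
  fixes z :: "nat \<Rightarrow> 'k::field"
  assumes z: "\<And>i. i < n \<Longrightarrow> z i \<noteq> 0" "z 0 = 1"
    and Y: "\<And>i j. i < n \<Longrightarrow> j < n \<Longrightarrow> j + 2 \<le> i \<Longrightarrow> Y i j = 0"
      "\<And>j. Suc j < n \<Longrightarrow> Y (Suc j) j * z j = z (Suc j)"
    and w: "\<And>i. i < n \<Longrightarrow> w i = (if i = 0 then 1 else 0)"
  shows "k < n \<Longrightarrow> i < n \<Longrightarrow> gram_schmidt_seq n Y w k i = (if i = k then z k else 0)"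
proof (induction k arbitrary: i rule: less_induct)
  case (less k)
  show ?case
  proof (cases k)
    case 0
    then show ?thesis using less.prems w z by simp
  next
    case (Suc k')
    let ?g = "gram_schmidt_seq n Y w"
    have g: "?g j i = (if i = j then z j else 0)" if "j \<le> k'" "i < n" for j i
      using less.IH[of j i] that Suc less.prems by simp
    have k': "k' < n" using Suc less.prems by simp
    have Yg: "mapply n Y (?g k') i = Y i k' * z k'" for i
    proof -
      have "mapply n Y (?g k') i = (\<Sum>k<n. if k = k' then Y i k' * z k' else 0)"
        unfolding mapply_def by (intro sum.cong refl) (simp add: g)
      then show ?thesis using k' by simp
    qed
    have d: "dotp n (?g j) x = z j * x j" if "j \<le> k'" for j x
    proof -
      have "dotp n (?g j) x = (\<Sum>k<n. if k = j then z j * x j else 0)"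
        unfolding dotp_def using that by (intro sum.cong refl) (simp add: g)
      then show ?thesis using k' that by simp
    qed
    have "(\<Sum>j\<le>k'. dotp n (?g j) (mapply n Y (?g k')) / dotp n (?g j) (?g j) * ?g j i) =
        (\<Sum>j\<le>k'. if j = i then Y i k' * z k' else 0)"
    proof (intro sum.cong refl)
      fix j assume "j \<in> {..k'}"
      then have j: "j \<le> k'" "j < n" using k' by auto
      show "dotp n (?g j) (mapply n Y (?g k')) / dotp n (?g j) (?g j) * ?g j i =
          (if j = i then Y i k' * z k' else 0)"
        using j z(1)[of j] less.prems by (cases "j = i") (simp_all add: d g Yg)
    qed
    then have *: "?g k i = Y i k' * z k' - (if i \<le> k' then Y i k' * z k' else 0)"
      by (simp add: Suc Yg)
    \<comment> \<open>Components up to \<open>k'\<close> are projected away, the next one is the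
      subdiagonal entry, and those below vanish by the Hessenberg shape.\<close>
    consider "i \<le> k'" | "i = Suc k'" | "k' + 2 \<le> i" by linarith
    then show ?thesis
    proof cases
      case 3
      have "?g k i = 0" unfolding * using Y(1)[of i k'] k' less.prems 3 by simp
      moreover have "i \<noteq> k" using 3 Suc by simp
      ultimately show ?thesis by simp
    qed (use * Suc Y(2) less.prems in auto)
  qed
qed

lemma frame_entry_Hessenberg:
  fixes z :: "nat \<Rightarrow> 'k::field"
  assumes "\<And>i. i < n \<Longrightarrow> z i \<noteq> 0" "z 0 = 1"
    and "\<And>i j. i < n \<Longrightarrow> j < n \<Longrightarrow> j + 2 \<le> i \<Longrightarrow> Y i j = 0"
    and "\<And>j. Suc j < n \<Longrightarrow> Y (Suc j) j * z j = z (Suc j)"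
    and w: "\<And>i. i < n \<Longrightarrow> w i = (if i = 0 then 1 else 0)"
    and ij: "i < n" "j < n"
  shows "frame_entry n Y w M i j = z i * M i j * z j"
proof -
  have g: "gram_schmidt_seq n Y w k i = (if i = k then z k else 0)" if "k < n" "i < n" for k i
    using that by (intro gram_schmidt_seq_Hessenberg assms)
  have "mapply n M (gram_schmidt_seq n Y w j) i = M i j * z j"
  proof -
    have "mapply n M (gram_schmidt_seq n Y w j) i = (\<Sum>k<n. if k = j then M i j * z j else 0)"
      unfolding mapply_def by (intro sum.cong refl) (simp add: g ij)
    then show ?thesis using ij by simp
  qed
  moreover have "dotp n (gram_schmidt_seq n Y w i) x = z i * x i" for x
  proof -
    have "dotp n (gram_schmidt_seq n Y w i) x = (\<Sum>k<n. if k = i then z i * x i else 0)"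
      unfolding dotp_def by (intro sum.cong refl) (simp add: g ij)
    then show ?thesis using ij by simp
  qed
  moreover have "dotp n w w = (\<Sum>k<n. if k = 0 then 1 else 0)"
    unfolding dotp_def by (intro sum.cong refl) (simp add: w)
  ultimately show ?thesis using ij by (simp add: frame_entry_def mult.assoc)
qed

subsection \<open>Coordinates and orthogonal matrices\<close>

lemma coord_decode:
  assumes "s < 2" "i < n" "j < n"
  shows "coord n s i j < 2 * n * n" "coord n s i j div (n * n) = s"
    "coord n s i j mod (n * n) div n = i" "coord n s i j mod n = j"
proof -
  have ij: "i * n + j < n * n"
  proof -
    have "i * n + j < i * n + n" using assms by simp
    also have "\<dots> = Suc i * n" by simp
    also have "\<dots> \<le> n * n" using assms by (intro mult_right_mono) auto
    finally show ?thesis .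
  qed
  have c: "coord n s i j = s * (n * n) + (i * n + j)" by (simp add: coord_def)
  have n: "n \<noteq> 0" using assms by auto
  have "s * (n * n) \<le> 1 * (n * n)" using assms by (intro mult_right_mono) auto
  then have "s * (n * n) + (i * n + j) < 1 * (n * n) + n * n" using ij by (rule add_le_less_mono)
  then show "coord n s i j < 2 * n * n" unfolding c by (simp add: algebra_simps)
  show "coord n s i j div (n * n) = s" unfolding c using ij n by simp
  show "coord n s i j mod (n * n) div n = i" unfolding c using ij assms by simp
  have "coord n s i j = j + n * (s * n + i)" by (simp add: coord_def algebra_simps)
  then show "coord n s i j mod n = j" using assms by simp
qed

lemma coord_cases:
  assumes "v < 2 * n * n"
  obtains s i j where "v = coord n s i j" "s < 2" "i < n" "j < n"
proof -
  have n: "n > 0" using assms by (cases n) auto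
  have "v = v div (n * n) * (n * n) + v mod (n * n)" by (rule div_mult_mod_eq[symmetric])
  also have "v mod (n * n) = v mod (n * n) div n * n + v mod (n * n) mod n" by (rule div_mult_mod_eq[symmetric])
  also have "v mod (n * n) mod n = v mod n" by (simp add: mod_mod_cancel)
  finally have "v = coord n (v div (n * n)) (v mod (n * n) div n) (v mod n)"
    by (simp add: coord_def)
  moreover have "v div (n * n) < 2"
    using assms n by (simp add: less_mult_imp_div_less mult.assoc)
  moreover have "v mod (n * n) div n < n"
    using n by (intro less_mult_imp_div_less) simp
  moreover have "v mod n < n" using n by simp
  ultimately show ?thesis using that by blast
qed

lemma coord_eq_iff:
  assumes "s < 2" "i < n" "j < n" "s' < 2" "i' < n" "j' < n"
  shows "coord n s i j = coord n s' i' j' \<longleftrightarrow> s = s' \<and> i = i' \<and> j = j'"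
  using coord_decode[OF assms(1-3)] coord_decode[OF assms(4-6)] by metis

lemma conj_subst_coord:
  assumes "s < 2" "i < n" "j < n"
  shows "conj_subst n A (coord n s i j) =
    (\<Sum>k<n. \<Sum>l<n. mconst (A i k * A j l) * mvar (coord n s k l))"
  using coord_decode[OF assms] by (simp add: conj_subst_def Let_def)

lemma heval_conj_subst:
  assumes "comm_ring_hom h" "s < 2" "i < n" "j < n"
  shows "heval h x (conj_subst n A (coord n s i j)) =
    conj_mat n (\<lambda>i k. h (A i k)) (\<lambda>k l. x (coord n s k l)) i j"
proof -
  interpret comm_ring_hom h by fact
  interpret H: comm_ring_hom "heval h x" by (rule comm_ring_hom_heval)
  show ?thesis
    by (simp add: conj_subst_coord[OF assms(2-4)] conj_mat_def hom_distribs)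
qed

lemma heval_conj_subst_outside:
  assumes "comm_ring_hom h" "\<not> v < 2 * n * n"
  shows "heval h x (conj_subst n A v) = x v"
  using assms by (simp add: conj_subst_def comm_ring_hom.heval_var)

text \<open>A one-sided inverse of a square matrix is two-sided. This passes from the orthonormal
  rows of the definition to the orthonormal columns used for the frame.\<close>

lemma orthogonal_mat_transpose:
  assumes "orthogonal_mat n A"
  shows "orthogonal_mat n (\<lambda>i j. A j i)"
proof -
  let ?A = "mat n n (\<lambda>(i, j). A i j)"
  have "?A * transpose_mat ?A = 1\<^sub>m n"
    using assms by (intro eq_matI) (auto simp: scalar_prod_def Defs.orthogonal_mat_def atLeast0LessThan)
  then have *: "transpose_mat ?A * ?A = 1\<^sub>m n"
    by (rule mat_mult_left_right_inverse[rotated 2]) auto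
  have "(\<Sum>k<n. A k i * A k j) = (if i = j then 1 else 0)" if "i < n" "j < n" for i j
    using arg_cong[OF *, of "\<lambda>M. M $$ (i, j)"] that by (auto simp: scalar_prod_def atLeast0LessThan)
  then show ?thesis by (simp add: Defs.orthogonal_mat_def)
qed

text \<open>The Cayley transform \<open>(1 + t \<kappa>)\<^sup>-\<^sup>1 (1 - t \<kappa>)\<close>, written with the denominator \<open>D = det (1 + t \<kappa>)\<close>.\<close>

lemma Cayley_curve:
  fixes \<kappa> :: "nat \<Rightarrow> nat \<Rightarrow> 'a::field"
  assumes skew: "\<And>i j. \<kappa> j i = - \<kappa> i j"
  shows "\<exists>(D :: 'a poly) P. poly D 0 = 1 \<and>
    (\<forall>i<n. \<forall>j<n. poly (P i j) 0 = - 2 * \<kappa> i j) \<and>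
    (\<forall>t. poly D t \<noteq> 0 \<longrightarrow>
      orthogonal_mat n (\<lambda>i j. (if i = j then 1 else 0) + t / poly D t * poly (P i j) t))"
proof -
  \<comment> \<open>\<open>B\<close> and \<open>B'\<close> are \<open>1 + t \<kappa>\<close> and
    \<open>1 - t \<kappa>\<close> with \<open>t\<close> the polynomial variable; skewness makes them
    transposes of each other.\<close>
  define B where "B = mat n n (\<lambda>(i, j). [:if i = j then 1 else 0, \<kappa> i j:])"
  define B' where "B' = mat n n (\<lambda>(i, j). [:if i = j then 1 else 0, - \<kappa> i j:])"
  define D where "D = det B"
  \<comment> \<open>\<open>D\<close> times the Cayley transform; the adjugate keeps the entries
    polynomial.\<close>
  define N where "N = adj_mat B * B'"
  have car: "B \<in> carrier_mat n n" "B' \<in> carrier_mat n n" "adj_mat B \<in> carrier_mat n n"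
    by (auto simp: B_def B'_def intro: adj_mat)
  have e: "[:if j = i then 1 else 0, \<kappa> j i:] = [:if i = j then 1 else 0, - \<kappa> i j:]"
    "[:if j = i then 1 else 0, - \<kappa> j i:] = [:if i = j then 1 else 0, \<kappa> i j:]" for i j
    unfolding skew[of i j] by (cases "i = j"; simp)+
  have "transpose_mat B $$ (i, j) = B' $$ (i, j)" "transpose_mat B' $$ (i, j) = B $$ (i, j)"
    if "i < n" "j < n" for i j
    using that e[of j i] by (simp_all add: B_def B'_def del: pCons_eq_iff)
  then have BT: "transpose_mat B = B'" "transpose_mat B' = B"
    using car(1,2) by (auto intro!: eq_matI)
  have adj: "B * adj_mat B = D \<cdot>\<^sub>m 1\<^sub>m n" "adj_mat B * B = D \<cdot>\<^sub>m 1\<^sub>m n"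
    using adj_mat[OF car(1)] by (auto simp: D_def)
  have comm: "B * B' = B' * B"
  proof (rule eq_matI)
    fix i j assume "i < dim_row (B' * B)" "j < dim_col (B' * B)"
    then have ij: "i < n" "j < n" using car by auto
    have "[:if i = k then 1 else 0, \<kappa> i k:] * [:if k = j then 1 else 0, - \<kappa> k j:] =
        (if i = k then [:0, - \<kappa> i j:] else 0) + (if k = j then [:0, \<kappa> i j:] else 0) +
        (if i = k \<and> k = j then 1 else 0) + [:0, 0, - (\<kappa> i k * \<kappa> k j):]" for k
      by (auto simp: one_pCons)
    moreover have "[:if i = k then 1 else 0, - \<kappa> i k:] * [:if k = j then 1 else 0, \<kappa> k j:] =
        (if i = k then [:0, \<kappa> i j:] else 0) + (if k = j then [:0, - \<kappa> i j:] else 0) +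
        (if i = k \<and> k = j then 1 else 0) + [:0, 0, - (\<kappa> i k * \<kappa> k j):]" for k
      by (auto simp: one_pCons)
    ultimately show "(B * B') $$ (i, j) = (B' * B) $$ (i, j)"
      using ij car by (simp add: B_def B'_def scalar_prod_def sum.distrib)
  qed (use car in auto)
  have BN: "B * N = D \<cdot>\<^sub>m B'"
  proof -
    have "B * N = (B * adj_mat B) * B'" unfolding N_def using car by (simp add: assoc_mult_mat)
    then show ?thesis using car by (simp add: adj mult_smult_assoc_mat[of _ n n _ n])
  qed
  have NN: "N * transpose_mat N = (D * D) \<cdot>\<^sub>m 1\<^sub>m n"
  proof -
    let ?T = "transpose_mat (adj_mat B)"
    have T: "?T \<in> carrier_mat n n" using car by simp
    have BT': "B' * ?T = D \<cdot>\<^sub>m 1\<^sub>m n"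
    proof -
      have "B' * ?T = transpose_mat (adj_mat B * B)"
        using car by (simp add: transpose_mult BT)
      also have "\<dots> = D \<cdot>\<^sub>m 1\<^sub>m n" unfolding adj by (intro eq_matI) auto
      finally show ?thesis .
    qed
    have "transpose_mat N = B * ?T"
      unfolding N_def using car by (simp add: transpose_mult BT)
    then have "N * transpose_mat N = adj_mat B * (B' * B) * ?T"
      unfolding N_def using car T by (simp add: assoc_mult_mat[of _ n n _ n _ n])
    \<comment> \<open>Commuting the inner factors lets each adjugate meet its own matrix, and both
      products are the scalar \<open>D\<close>.\<close>
    also have "\<dots> = (adj_mat B * B) * (B' * ?T)"
      unfolding comm[symmetric] using car T by (simp add: assoc_mult_mat[of _ n n _ n _ n])
    also have "\<dots> = (D * D) \<cdot>\<^sub>m 1\<^sub>m n" unfolding adj BT' by (intro eq_matI) auto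
    finally show ?thesis .
  qed
  \<comment> \<open>Read \<open>B N = D B'\<close> as
    \<open>N = D - t (\<kappa> D + \<kappa> N)\<close>: the bracket, negated, is \<open>P\<close>.
    At \<open>t = 0\<close> both \<open>D\<close> and \<open>N\<close> are the identity, so
    \<open>P\<close> starts at \<open>-2 \<kappa>\<close>, the origin of the factor 2 in
    \<open>transversal\<close>.\<close>
  define P where "P i j = - (smult (\<kappa> i j) D + (\<Sum>k<n. smult (\<kappa> i k) (N $$ (k, j))))" for i j
  have N: "N $$ (i, j) = (if i = j then D else 0) + [:0, 1:] * P i j" if ij: "i < n" "j < n" for i j
  proof -
    have car_N: "N \<in> carrier_mat n n" using car by (simp add: N_def)
    have "(B * N) $$ (i, j) = (\<Sum>k<n. [:if i = k then 1 else 0, \<kappa> i k:] * N $$ (k, j))"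
      using ij car_N by (simp add: B_def scalar_prod_def atLeast0LessThan)
    also have "\<dots> = (\<Sum>k<n. (if k = i then N $$ (i, j) else 0) + [:0, 1:] * smult (\<kappa> i k) (N $$ (k, j)))"
      by (intro sum.cong refl) auto
    also have "\<dots> = N $$ (i, j) + [:0, 1:] * (\<Sum>k<n. smult (\<kappa> i k) (N $$ (k, j)))"
      using ij by (simp add: sum.distrib sum_distrib_left)
    also have "(B * N) $$ (i, j) = (if i = j then D else 0) - [:0, 1:] * smult (\<kappa> i j) D"
      unfolding BN using ij by (auto simp: B'_def)
    finally show ?thesis
      by (simp add: P_def algebra_simps)
  qed
  have D0: "poly D 0 = 1"
  proof -
    interpret e: comm_ring_hom "\<lambda>p::'a poly. poly p 0" by unfold_locales auto
    have "map_mat (\<lambda>p. poly p 0) B = 1\<^sub>m n"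
      by (rule eq_matI) (auto simp: B_def)
    then show ?thesis unfolding D_def by (metis e.hom_det det_one)
  qed
  show ?thesis
  proof (intro exI conjI allI impI)
    show "poly D 0 = 1" by (rule D0)
    fix i j assume ij: "i < n" "j < n"
    have "poly (N $$ (k, j)) 0 = (if k = j then 1 else 0)" if "k < n" for k
      using N[of k j] that ij D0 by simp
    then have "(\<Sum>k<n. \<kappa> i k * poly (N $$ (k, j)) 0) = (\<Sum>k<n. if k = j then \<kappa> i j else 0)"
      by (intro sum.cong refl) auto
    then show "poly (P i j) 0 = - 2 * \<kappa> i j"
      using ij D0 by (simp add: P_def poly_sum)
  next
    fix t assume t: "poly D t \<noteq> 0"
    let ?A = "\<lambda>i j. (if i = j then 1 else 0) + t / poly D t * poly (P i j) t"
    have A: "?A i j = poly (N $$ (i, j)) t / poly D t" if "i < n" "j < n" for i j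
      using N[OF that] t by (simp add: field_simps)
    have car_N: "N \<in> carrier_mat n n" using car by (simp add: N_def)
    have "(\<Sum>k<n. ?A i k * ?A j k) = (if i = j then 1 else 0)" if ij: "i < n" "j < n" for i j
    proof -
      have "(\<Sum>k<n. N $$ (i, k) * N $$ (j, k)) = (if i = j then D * D else 0)"
        using arg_cong[OF NN, of "\<lambda>M. M $$ (i, j)"] ij car_N
        by (auto simp: scalar_prod_def atLeast0LessThan)
      then have "(\<Sum>k<n. poly (N $$ (i, k)) t * poly (N $$ (j, k)) t) =
          (if i = j then poly D t * poly D t else 0)"
        by (metis (no_types, lifting) poly_sum poly_mult poly_0 sum.cong)
      moreover have "(\<Sum>k<n. ?A i k * ?A j k) =
          (\<Sum>k<n. poly (N $$ (i, k)) t * poly (N $$ (j, k)) t) / (poly D t * poly D t)"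
        unfolding sum_divide_distrib by (intro sum.cong refl) (simp only: A ij lessThan_iff times_divide_times_eq)
      ultimately show ?thesis using t by simp
    qed
    then show "orthogonal_mat n ?A" by (simp add: Defs.orthogonal_mat_def)
  qed
qed

text \<open>The linear part \<open>P M + M P^T\<close> carries the tangent direction. Separating it
  from the quadratic part lets one factor \<open>t\<close> be divided out in
  \<open>slice_dense\<close>.\<close>

lemma conj_mat_one_plus:
  fixes P :: "nat \<Rightarrow> nat \<Rightarrow> 'k::comm_ring_1"
  assumes ij: "i < n" "j < n"
  shows "conj_mat n (\<lambda>i k. (if i = k then 1 else 0) + a * P i k) M i j =
    M i j + a * (\<Sum>k<n. P i k * M k j) + a * (\<Sum>l<n. P j l * M i l) + a * a * conj_mat n P M i j"
proof -
  have "conj_mat n (\<lambda>i k. (if i = k then 1 else 0) + a * P i k) M i j =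
    (\<Sum>k<n. \<Sum>l<n. (if k = i then (if l = j then M i j else 0) else 0) +
       (if l = j then a * (P i k * M k j) else 0) + (if k = i then a * (P j l * M i l) else 0) +
       a * a * (P i k * P j l * M k l))"
    unfolding conj_mat_def by (intro sum.cong refl) (simp add: algebra_simps)
  also have "\<dots> = (\<Sum>k<n. (if k = i then M i j else 0) + a * (P i k * M k j) +
       (if k = i then a * (\<Sum>l<n. P j l * M i l) else 0) + a * a * (\<Sum>l<n. P i k * P j l * M k l))"
    using ij by (intro sum.cong refl) (simp add: sum.distrib sum_distrib_left)
  also have "\<dots> = M i j + a * (\<Sum>k<n. P i k * M k j) + a * (\<Sum>l<n. P j l * M i l) + a * a * conj_mat n P M i j"
    using ij by (simp add: sum.distrib sum_distrib_left conj_mat_def)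
  finally show ?thesis .
qed

subsection \<open>The slice\<close>

text \<open>The slice is parametrised by the \<open>z\<^sub>i\<close>, which are stored in the subdiagonal positions of the
  second matrix, and by the rescaled entries \<open>z\<^sub>i M\<^sub>i\<^sub>j z\<^sub>j\<close>, which \<open>slice_num\<close> computes.\<close>

definition zcoord :: "nat \<Rightarrow> (nat \<Rightarrow> 'k::field) \<Rightarrow> nat \<Rightarrow> 'k" where
  "zcoord n x i = (if i = 0 then 1 else x (coord n 1 i (i - 1)))"

text \<open>The first row of \<open>X\<close> repeats its first column, since \<open>e_0\<close>
  spans the kernel of \<open>X - X^T\<close>. On the subdiagonal of \<open>Y\<close> the entry is
  \<open>z_i / z_(i-1)\<close>, which rescales to \<open>z_i^2\<close>. Below it the Hessenberg form
  gives zero.\<close>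

definition slice_num :: "nat \<Rightarrow> (nat \<Rightarrow> 'k::field) \<Rightarrow> nat \<Rightarrow> nat \<Rightarrow> nat \<Rightarrow> 'k" where
  "slice_num n x s i j =
    (if s = 0 \<and> i = 0 then x (coord n 0 j 0)
     else if s = 1 \<and> i = Suc j then (x (coord n 1 i j))\<^sup>2
     else if s = 1 \<and> Suc j < i then 0
     else x (coord n s i j))"

text \<open>Variables from \<open>2 * n * n\<close> on are not coordinates of \<open>V\<close>. They
  pass through unchanged, so that density can be proved for polynomials in arbitrary
  variables.\<close>

definition slice_pt :: "nat \<Rightarrow> (nat \<Rightarrow> 'k::field) \<Rightarrow> nat \<Rightarrow> 'k" where
  "slice_pt n x v =
    (if v < 2 * n * n then
       (let s = v div (n * n); i = v mod (n * n) div n; j = v mod n in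
         slice_num n x s i j / (zcoord n x i * zcoord n x j))
     else x v)"

lemma slice_pt_coord:
  assumes "s < 2" "i < n" "j < n"
  shows "slice_pt n x (coord n s i j) = slice_num n x s i j / (zcoord n x i * zcoord n x j)"
  using coord_decode[OF assms] by (simp add: slice_pt_def Let_def)

definition on_slice :: "nat \<Rightarrow> (nat \<Rightarrow> 'k::field) \<Rightarrow> bool" where
  "on_slice n y \<longleftrightarrow> (\<forall>j<n. y (coord n 0 0 j) = y (coord n 0 j 0)) \<and>
     (\<forall>i<n. \<forall>j<n. Suc j < i \<longrightarrow> y (coord n 1 i j) = 0)"

text \<open>The parameters are recovered from the point: \<open>z_i\<close> is a product of
  subdiagonal entries, hence nonzero, and the rescaled entries follow.\<close>

lemma slice_pt_surj:
  fixes y :: "nat \<Rightarrow> 'k::field"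
  assumes y: "on_slice n y" and sub: "\<And>j. Suc j < n \<Longrightarrow> y (coord n 1 (Suc j) j) \<noteq> 0"
  shows "\<exists>x. (\<forall>i<n. zcoord n x i \<noteq> 0) \<and> slice_pt n x = y"
proof (intro exI conjI allI impI)
  define z where "z i = (\<Prod>j<i. y (coord n 1 (Suc j) j))" for i
  define x where "x v =
    (if v < 2 * n * n then
       (let s = v div (n * n); i = v mod (n * n) div n; j = v mod n in
         if s = 1 \<and> i = Suc j then z i else y v * z i * z j)
     else y v)" for v
  have xc: "x (coord n s i j) = (if s = 1 \<and> i = Suc j then z i else y (coord n s i j) * z i * z j)"
    if "s < 2" "i < n" "j < n" for s i j
    using coord_decode[OF that] by (simp add: x_def Let_def)
  have z: "z i \<noteq> 0" if "i < n" for i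
    using that sub by (auto simp: z_def)
  have zc: "zcoord n x i = z i" if "i < n" for i
    using that by (cases i) (auto simp: zcoord_def xc z_def)
  show "zcoord n x i \<noteq> 0" if "i < n" for i
    using z zc that by simp
  show "slice_pt n x = y"
  proof
    fix v
    show "slice_pt n x v = y v"
    proof (cases "v < 2 * n * n")
      case True
      then obtain s i j where v: "v = coord n s i j" and ij: "s < 2" "i < n" "j < n"
        by (rule coord_cases)
      have "slice_num n x s i j = y v * (z i * z j)"
        using ij y unfolding v on_slice_def
        by (auto simp: slice_num_def xc z_def power2_eq_square less_2_cases_iff)
      then show ?thesis using ij z by (simp add: v slice_pt_coord zc)
    qed (simp add: slice_pt_def x_def)
  qed
qed

lemma (in specialization) specializes_slice_pt:
  assumes "\<And>v. specializes \<theta> (f v) (g v)" "\<And>i. i < n \<Longrightarrow> zcoord n g i \<noteq> 0"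
  shows "specializes \<theta> (slice_pt n f v) (slice_pt n g v)"
proof (cases "v < 2 * n * n")
  case True
  then obtain s i j where v: "v = coord n s i j" and ij: "s < 2" "i < n" "j < n"
    by (rule coord_cases)
  have z: "specializes \<theta> (zcoord n f i) (zcoord n g i)" for i
    by (simp add: zcoord_def assms)
  have "specializes \<theta> (slice_num n f s i j) (slice_num n g s i j)"
    by (simp add: slice_num_def assms specializes_power)
  then show ?thesis
    unfolding v slice_pt_coord[OF ij] using assms(2) ij
    by (intro specializes_divide specializes_mult z) auto
qed (simp add: slice_pt_def assms)

text \<open>Restriction of polynomial functions to the slice, as evaluation at its generic
  point.\<close>

definition slice_hom :: "nat \<Rightarrow> 'a::field mpoly \<Rightarrow> 'a mpoly fract" where
  "slice_hom n = heval const_fract (slice_pt n (\<lambda>v. Fract (mvar v) 1))"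

text \<open>Links the generic point of the slice to its points over \<open>F\<close>, where the
  denominators \<open>z_i z_j\<close> must stay nonzero.\<close>

lemma slice_hom_eval:
  fixes x :: "nat \<Rightarrow> 'a::field"
  assumes "\<And>i. i < n \<Longrightarrow> zcoord n x i \<noteq> 0"
  shows "specializes (heval (\<lambda>c. c) x) (slice_hom n p) (heval (\<lambda>c. c) (slice_pt n x) p)"
proof -
  interpret specialization "heval (\<lambda>c. c) x"
    unfolding specialization_def by (rule comm_ring_hom.comm_ring_hom_heval[OF comm_ring_hom_id])
  have "specializes (heval (\<lambda>c. c) x) (const_fract a) a" for a
    using specializes_Fract_1[of "mconst a"]
    by (simp add: const_fract_def comm_ring_hom.heval_const[OF comm_ring_hom_id])
  moreover have "specializes (heval (\<lambda>c. c) x) (Fract (mvar v) 1) (x v)" for v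
    using specializes_Fract_1[of "mvar v"] by (simp add: comm_ring_hom.heval_var[OF comm_ring_hom_id])
  ultimately show ?thesis
    unfolding slice_hom_def by (intro specializes_heval specializes_slice_pt assms)
qed

subsection \<open>Orthogonal conjugates of the slice are dense\<close>

text \<open>The part of \<kappa> below the diagonal, column by column. With the shift matrix the
  bracket at \<open>(i, j)\<close> is \<open>\<kappa> i (j + 1) - \<kappa> (i - 1) j\<close>;
  prescribing it gives this recursion, started from a free column \<open>g\<close>.\<close>

fun lower_solution :: "(nat \<Rightarrow> 'k::field) \<Rightarrow> (nat \<Rightarrow> nat \<Rightarrow> 'k) \<Rightarrow> nat \<Rightarrow> nat \<Rightarrow> 'k" where
  "lower_solution g Z 0 i = g i"
| "lower_solution g Z (Suc j) i = lower_solution g Z j (i - 1) + Z i j"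

text \<open>The \<open>X\<close> part of the base point. Its skew part pairs 1 with 2, 3 with 4, and
  so on; for odd size only index 0 is left over, so the kernel is spanned by
  \<open>e_0\<close>.\<close>

definition base_pairs :: "nat \<Rightarrow> nat \<Rightarrow> 'k::field" where
  "base_pairs i j = (if odd i \<and> j = Suc i then 1 else 0)"

text \<open>The \<open>Y\<close> part of the base point. It sends \<open>e_j\<close> to
  \<open>e_(j+1)\<close>, so all \<open>z_i\<close> are 1.\<close>

definition base_shift :: "nat \<Rightarrow> nat \<Rightarrow> 'k::field" where
  "base_shift i j = (if i = Suc j then 1 else 0)"

text \<open>\<open>\<kappa> M + M \<kappa>^T\<close>, for skew \<kappa> the commutator: a tangent
  vector to the orbit of \<open>M\<close>.\<close>

definition skew_bracket :: "nat \<Rightarrow> (nat \<Rightarrow> nat \<Rightarrow> 'k::field) \<Rightarrow> (nat \<Rightarrow> nat \<Rightarrow> 'k) \<Rightarrow> nat \<Rightarrow> nat \<Rightarrow> 'k" where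
  "skew_bracket n \<kappa> M i j = (\<Sum>k<n. \<kappa> i k * M k j) + (\<Sum>l<n. \<kappa> j l * M i l)"

text \<open>The tangent space of the slice at the base point and that of the orbit span everything.
  The equations for \<open>\<kappa>\<close> are triangular: those of the first matrix fix its first row,
  because the base point pairs the indices \<open>1, \<dots>, n - 1\<close>, and those of the second matrix then
  determine each column from the previous one.\<close>

lemma transversal:
  fixes ZX ZY :: "nat \<Rightarrow> nat \<Rightarrow> 'k::field"
  assumes two: "(2::'k) \<noteq> 0" and n: "odd n"
  obtains \<kappa> where "\<And>i j. \<kappa> j i = - \<kappa> i j"
    "\<And>j. j < n \<Longrightarrow> ZX 0 j + 2 * skew_bracket n \<kappa> base_pairs 0 j = ZX j 0 + 2 * skew_bracket n \<kappa> base_pairs j 0"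
    "\<And>i j. i < n \<Longrightarrow> j < n \<Longrightarrow> Suc j < i \<Longrightarrow> ZY i j + 2 * skew_bracket n \<kappa> base_shift i j = 0"
proof
  define h where "h j = (ZX j 0 - ZX 0 j) / 2" for j
  \<comment> \<open>The equation of the first matrix at odd \<open>j\<close> involves only
    \<open>\<kappa> 0 (j + 1)\<close>, at even \<open>j > 0\<close> only
    \<open>\<kappa> 0 (j - 1)\<close>. The signs solve \<open>\<kappa> 0 k = - g k\<close> for
    these.\<close>
  define g where "g k = (if odd k then - h (Suc k) else h (k - 1))" for k
  define \<kappa> where "\<kappa> i j = (if j < i then lower_solution g (\<lambda>i j. - ZY i j / 2) j i
    else if i < j then - lower_solution g (\<lambda>i j. - ZY i j / 2) i j else 0)" for i j
  show skew: "\<kappa> j i = - \<kappa> i j" for i j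
    by (auto simp: \<kappa>_def)
  have row0: "\<kappa> 0 k = - g k" if "k > 0" for k
    using that by (simp add: \<kappa>_def)
  show "ZX 0 j + 2 * skew_bracket n \<kappa> base_pairs 0 j = ZX j 0 + 2 * skew_bracket n \<kappa> base_pairs j 0"
    if j: "j < n" for j
  proof -
    have 1: "skew_bracket n \<kappa> base_pairs 0 j = (\<Sum>k<n. \<kappa> 0 k * base_pairs k j)"
      by (simp add: skew_bracket_def base_pairs_def)
    have 2: "skew_bracket n \<kappa> base_pairs j 0 = (\<Sum>l<n. \<kappa> 0 l * base_pairs j l)"
      by (simp add: skew_bracket_def base_pairs_def)
    consider "j = 0" | "odd j" | "even j" "j > 0" by auto
    then have "skew_bracket n \<kappa> base_pairs 0 j - skew_bracket n \<kappa> base_pairs j 0 = h j"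
    proof cases
      case 1
      then show ?thesis by (simp add: h_def)
    next
      case odd: 2
      \<comment> \<open>Here oddness of \<open>n\<close> enters: every odd index has its partner
        inside the matrix.\<close>
      then have "Suc j < n" using n j by (metis Suc_lessI even_Suc)
      moreover have "(\<Sum>l<n. \<kappa> 0 l * base_pairs j l) = (\<Sum>l<n. if l = Suc j then \<kappa> 0 (Suc j) else 0)"
        using odd by (intro sum.cong refl) (simp add: base_pairs_def)
      moreover have "(\<Sum>k<n. \<kappa> 0 k * base_pairs k j) = 0"
        using odd by (intro sum.neutral) (auto simp: base_pairs_def)
      ultimately show ?thesis unfolding 1 2 using odd by (simp add: row0 g_def)
    next
      case even: 3
      then have "(\<Sum>k<n. \<kappa> 0 k * base_pairs k j) = (\<Sum>k<n. if k = j - 1 then \<kappa> 0 (j - 1) else 0)"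
        by (intro sum.cong refl) (auto simp: base_pairs_def)
      moreover have "(\<Sum>l<n. \<kappa> 0 l * base_pairs j l) = 0"
        using even by (intro sum.neutral) (auto simp: base_pairs_def)
      moreover have "odd (j - 1)" "j - 1 < n" "j - 1 > 0" using even j by presburger+
      ultimately show ?thesis unfolding 1 2 using even by (simp add: row0 g_def)
    qed
    then have "2 * skew_bracket n \<kappa> base_pairs 0 j - 2 * skew_bracket n \<kappa> base_pairs j 0 = ZX j 0 - ZX 0 j"
      unfolding right_diff_distrib[symmetric] using two by (simp only: h_def) simp
    then show ?thesis by (simp add: algebra_simps)
  qed
  show "ZY i j + 2 * skew_bracket n \<kappa> base_shift i j = 0"
    if ij: "i < n" "j < n" "Suc j < i" for i j
  proof -
    have "(\<Sum>k<n. \<kappa> i k * base_shift k j) = (\<Sum>k<n. if k = Suc j then \<kappa> i (Suc j) else 0)"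
      by (intro sum.cong refl) (simp add: base_shift_def)
    moreover have "(\<Sum>l<n. \<kappa> j l * base_shift i l) = (\<Sum>l<n. if l = i - 1 then \<kappa> j (i - 1) else 0)"
      using ij by (intro sum.cong refl) (auto simp: base_shift_def)
    ultimately have "skew_bracket n \<kappa> base_shift i j = \<kappa> i (Suc j) + \<kappa> j (i - 1)"
      using ij by (simp add: skew_bracket_def)
    also have "\<dots> = - ZY i j / 2" using ij by (simp add: \<kappa>_def)
    finally show ?thesis using two by simp
  qed
qed

definition base_pt :: "nat \<Rightarrow> nat \<Rightarrow> 'a::field" where
  "base_pt n v = (if v < 2 * n * n then
     (if v div (n * n) = 0 then base_pairs else base_shift) (v mod (n * n) div n) (v mod n) else 0)"

lemma base_pt_coord:
  assumes "i < n" "j < n"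
  shows "base_pt n (coord n 0 i j) = base_pairs i j" "base_pt n (coord n 1 i j) = base_shift i j"
  using coord_decode[of 0, OF _ assms] coord_decode[of 1, OF _ assms] by (simp_all add: base_pt_def)

text \<open>The curves move along a line in the slice and are conjugated by a Cayley curve. By
  \<open>transversal\<close> their initial velocity can be any \<open>z\<close>, so
  \<open>zero_if_zero_on_curves\<close> applies.\<close>

lemma slice_dense:
  fixes u :: "'a::field mpoly"
  assumes inf: "infinite (UNIV :: 'a set)" and two: "(2::'a) \<noteq> 0" and n: "odd n"
    and zero: "\<And>A. orthogonal_mat n A \<Longrightarrow> slice_hom n (msubst (conj_subst n A) u) = 0"
  shows "u = 0"
proof (rule zero_if_zero_on_curves[OF inf, where s = "base_pt n"])
  fix z :: "nat \<Rightarrow> 'a"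
  define Z where "Z s i j = z (coord n s i j)" for s i j
  obtain \<kappa> where skew: "\<And>i j. \<kappa> j i = - \<kappa> i j"
    and \<kappa>X: "\<And>j. j < n \<Longrightarrow> Z 0 0 j + 2 * skew_bracket n \<kappa> base_pairs 0 j = Z 0 j 0 + 2 * skew_bracket n \<kappa> base_pairs j 0"
    and \<kappa>Y: "\<And>i j. i < n \<Longrightarrow> j < n \<Longrightarrow> Suc j < i \<Longrightarrow> Z 1 i j + 2 * skew_bracket n \<kappa> base_shift i j = 0"
    by (rule transversal[OF two n, of "Z 0" "Z 1"]; rule that; blast)
  define b where "b s = (if s = (0::nat) then base_pairs else base_shift :: nat \<Rightarrow> nat \<Rightarrow> 'a)" for s
  \<comment> \<open>The velocity along the slice. Conjugation contributes \<open>-2\<close> times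
    the bracket, which brings the total back to \<open>z\<close>.\<close>
  define \<sigma> where "\<sigma> s i j = Z s i j + 2 * skew_bracket n \<kappa> (b s) i j" for s i j
  obtain D :: "'a poly" and P where "poly D 0 = 1 \<and>
    (\<forall>i<n. \<forall>j<n. poly (P i j) 0 = - 2 * \<kappa> i j) \<and>
    (\<forall>t. poly D t \<noteq> 0 \<longrightarrow>
      orthogonal_mat n (\<lambda>i j. (if i = j then 1 else 0) + t / poly D t * poly (P i j) t))"
    using Cayley_curve[of \<kappa> n, OF skew] by (elim exE)
  then have D: "poly D 0 = 1"
    and P: "\<And>i j. i < n \<Longrightarrow> j < n \<Longrightarrow> poly (P i j) 0 = - 2 * \<kappa> i j"
    and orth: "\<And>t. poly D t \<noteq> 0 \<Longrightarrow>
      orthogonal_mat n (\<lambda>i j. (if i = j then 1 else 0) + t / poly D t * poly (P i j) t)"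
    by blast+
  define m where "m s i j = [:b s i j, \<sigma> s i j:]" for s i j
  \<comment> \<open>\<open>t W / D^2\<close> is the displacement of the conjugated curve from the
    base point: \<open>conj_mat_one_plus\<close> with \<open>a = t / D\<close>, one factor
    \<open>t\<close> taken out. Variables outside \<open>V\<close> simply move with velocity
    \<open>z\<close>.\<close>
  define W where "W v =
    (if v < 2 * n * n then
       (let s = v div (n * n); i = v mod (n * n) div n; j = v mod n in
         D * D * [:\<sigma> s i j:] + D * (\<Sum>k<n. P i k * m s k j) + D * (\<Sum>l<n. P j l * m s i l) +
         [:0, 1:] * conj_mat n P (m s) i j)
     else D * D * [:z v:])" for v
  have Wc: "W (coord n s i j) = D * D * [:\<sigma> s i j:] + D * (\<Sum>k<n. P i k * m s k j) +
      D * (\<Sum>l<n. P j l * m s i l) + [:0, 1:] * conj_mat n P (m s) i j"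
    if "s < 2" "i < n" "j < n" for s i j
    using coord_decode[OF that] by (simp add: W_def Let_def)
  \<comment> \<open>Outside this finite set no subdiagonal entry of the line in the slice vanishes,
    so \<open>slice_pt_surj\<close> yields parameters.\<close>
  define B where "B = (\<Union>j<n. {t. 1 + t * \<sigma> 1 (Suc j) j = 0})"
  have "finite {t. 1 + t * c = 0}" for c :: 'a
    using poly_roots_finite[of "[:1, c:]"] by simp
  then have finB: "finite B" by (simp add: B_def)
  have W0: "poly (W v) 0 = z v" for v
  proof (cases "v < 2 * n * n")
    case True
    then obtain s i j where v: "v = coord n s i j" and ij: "s < 2" "i < n" "j < n"
      by (rule coord_cases)
    have "(\<Sum>k<n. poly (P i k) 0 * b s k j) = (\<Sum>k<n. - 2 * (\<kappa> i k * b s k j))"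
      "(\<Sum>k<n. poly (P j k) 0 * b s i k) = (\<Sum>k<n. - 2 * (\<kappa> j k * b s i k))"
      using ij by (auto intro!: sum.cong simp: P)
    then show ?thesis
      unfolding v Wc[OF ij]
      by (simp add: D poly_sum m_def \<sigma>_def skew_bracket_def Z_def sum_distrib_left sum_negf algebra_simps)
  qed (simp add: W_def D)
  have "heval (\<lambda>c. c) (\<lambda>v. base_pt n v + t * poly (W v) t / poly (D * D) t) u = 0"
    if t: "t \<notin> B" "poly (D * D) t \<noteq> 0" for t
  proof -
    let ?d = "poly D t"
    have d: "?d \<noteq> 0" using t by simp
    define A where "A i j = (if i = j then 1 else 0) + t / ?d * poly (P i j) t" for i j
    define y where "y v =
      (if v < 2 * n * n then
         poly (m (v div (n * n)) (v mod (n * n) div n) (v mod n)) t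
       else z v * t)" for v
    have yc: "y (coord n s i j) = b s i j + t * \<sigma> s i j" if "s < 2" "i < n" "j < n" for s i j
      using coord_decode[OF that] by (simp add: y_def m_def)
    have "on_slice n y"
      unfolding on_slice_def
      using \<kappa>X \<kappa>Y by (auto simp: yc \<sigma>_def b_def base_pairs_def base_shift_def)
    moreover have "y (coord n 1 (Suc j) j) \<noteq> 0" if "Suc j < n" for j
      using that t by (auto simp: yc b_def base_shift_def B_def)
    ultimately have "\<exists>x. (\<forall>i<n. zcoord n x i \<noteq> 0) \<and> slice_pt n x = y"
      by (rule slice_pt_surj)
    then obtain x where x: "\<And>i. i < n \<Longrightarrow> zcoord n x i \<noteq> 0" "slice_pt n x = y"
      by blast
    have "orthogonal_mat n A" unfolding A_def[abs_def] by (rule orth[OF d])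
    interpret specialization "heval (\<lambda>c. c) x"
      unfolding specialization_def by (rule comm_ring_hom.comm_ring_hom_heval[OF comm_ring_hom_id])
    have "specializes (heval (\<lambda>c. c) x) (slice_hom n (msubst (conj_subst n A) u))
        (heval (\<lambda>c. c) y (msubst (conj_subst n A) u))"
      using slice_hom_eval[OF x(1)] unfolding x(2) .
    then have "heval (\<lambda>c. c) y (msubst (conj_subst n A) u) = 0"
      unfolding zero[OF \<open>orthogonal_mat n A\<close>] by (rule specializes_unique) (rule specializes_0)
    moreover have "heval (\<lambda>c. c) y (conj_subst n A v) = base_pt n v + t * poly (W v) t / poly (D * D) t" for v
    proof (cases "v < 2 * n * n")
      case True
      then obtain s i j where v: "v = coord n s i j" and ij: "s < 2" "i < n" "j < n"
        by (rule coord_cases)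
      let ?M = "\<lambda>k l. b s k l + t * \<sigma> s k l"
      define S1 where "S1 = (\<Sum>k<n. poly (P i k) t * ?M k j)"
      define S2 where "S2 = (\<Sum>l<n. poly (P j l) t * ?M i l)"
      define S3 where "S3 = conj_mat n (\<lambda>i k. poly (P i k) t) ?M i j"
      have "heval (\<lambda>c. c) y (conj_subst n A v) = conj_mat n A (\<lambda>k l. y (coord n s k l)) i j"
        unfolding v by (rule heval_conj_subst[OF comm_ring_hom_id ij])
      also have "\<dots> = conj_mat n A ?M i j"
        unfolding conj_mat_def by (intro sum.cong refl) (simp add: yc ij)
      also have "\<dots> = ?M i j + t / ?d * S1 + t / ?d * S2 + t / ?d * (t / ?d) * S3"
        unfolding A_def[abs_def] S1_def S2_def S3_def by (rule conj_mat_one_plus[OF ij(2,3)])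
      also have "\<dots> = b s i j + t * (?d * ?d * \<sigma> s i j + ?d * S1 + ?d * S2 + t * S3) / (?d * ?d)"
        using d by (simp add: field_simps)
      also have "?d * ?d * \<sigma> s i j + ?d * S1 + ?d * S2 + t * S3 = poly (W v) t"
        unfolding v Wc[OF ij] by (simp add: poly_sum m_def conj_mat_def S1_def S2_def S3_def algebra_simps)
      also have "b s i j = base_pt n v"
        using ij unfolding v by (auto simp: b_def base_pt_coord base_pt_coord(2)[unfolded One_nat_def] less_2_cases_iff)
      finally show ?thesis by simp
    next
      case False
      then show ?thesis
        using d by (simp add: heval_conj_subst_outside[OF comm_ring_hom_id] y_def W_def base_pt_def)
    qed
    ultimately show ?thesis by (simp add: heval_msubst[OF comm_ring_hom_id])
  qed
  moreover have "poly (D * D) 0 = 1" using D by simp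
  ultimately show "\<exists>D W B. poly D 0 = 1 \<and> (\<forall>v. poly (W v) 0 = z v) \<and> finite B \<and>
      (\<forall>t. t \<notin> B \<longrightarrow> poly D t \<noteq> 0 \<longrightarrow>
        heval (\<lambda>c. c) (\<lambda>v. base_pt n v + t * poly (W v) t / poly D t) u = 0)"
    using W0 finB by blast
qed

subsection \<open>The kernel of the generic skew-symmetric matrix\<close>

lemma const_fract_eq_0_iff [simp]: "const_fract c = 0 \<longleftrightarrow> c = 0"
proof -
  have "const_fract c = 0 \<longleftrightarrow> mconst c = 0"
    by (simp add: const_fract_def Zero_fract_def eq_fract)
  also have "\<dots> \<longleftrightarrow> c = 0"
    by (metis lookup_single_eq lookup_zero mconst_def single_zero)
  finally show ?thesis .
qed

lemma two_neq_0_fract: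
  assumes "(2::'a::field) \<noteq> 0"
  shows "(2 :: 'a mpoly fract) \<noteq> 0"
proof -
  interpret comm_ring_hom "const_fract :: 'a \<Rightarrow> 'a mpoly fract" by (rule comm_ring_hom_const_fract)
  have "const_fract (1 + 1 :: 'a) = (1 + 1 :: 'a mpoly fract)"
    by (simp only: hom_add hom_one)
  then show ?thesis using assms const_fract_eq_0_iff[of "2::'a"] by (simp only: one_add_one) simp
qed

lemma skew_form_zero:
  fixes K :: "nat \<Rightarrow> nat \<Rightarrow> 'k::field"
  assumes "(2::'k) \<noteq> 0" "\<And>i j. K j i = - K i j"
  shows "(\<Sum>i<n. \<Sum>j<n. x i * K i j * x j) = 0"
proof -
  have "(\<Sum>i<n. \<Sum>j<n. x i * K i j * x j) = (\<Sum>j<n. \<Sum>i<n. x i * K i j * x j)"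
    by (rule sum.swap)
  also have "\<dots> = (\<Sum>j<n. \<Sum>i<n. - (x j * K j i * x i))"
  proof (intro sum.cong refl)
    fix i j
    show "x i * K i j * x j = - (x j * K j i * x i)" unfolding assms(2)[of j i] by simp
  qed
  also have "\<dots> = - (\<Sum>i<n. \<Sum>j<n. x i * K i j * x j)"
    by (simp add: sum_negf)
  finally have "2 * (\<Sum>i<n. \<Sum>j<n. x i * K i j * x j) = 0"
    unfolding mult_2 by (simp only: eq_neg_iff_add_eq_0)
  with assms(1) show ?thesis unfolding mult_eq_0_iff by blast
qed

text \<open>\<open>B\<close> inverts the block of \<open>K\<close> without row and column 0, so the
  later rows determine a kernel vector from its first entry. Row 0 then holds for free:
  \<open>w^T K w = 0\<close> reduces to it because \<open>w 0 = 1\<close> and the other rows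
  vanish.\<close>

lemma
  fixes K B :: "nat \<Rightarrow> nat \<Rightarrow> 'k::field"
  assumes two: "(2::'k) \<noteq> 0" and skew: "\<And>i j. K j i = - K i j"
    and right: "\<And>i j. i < m \<Longrightarrow> j < m \<Longrightarrow> (\<Sum>k<m. K (Suc i) (Suc k) * B k j) = (if i = j then 1 else 0)"
    and left: "\<And>i j. i < m \<Longrightarrow> j < m \<Longrightarrow> (\<Sum>k<m. B i k * K (Suc k) (Suc j)) = (if i = j then 1 else 0)"
    and w: "w 0 = 1" "\<And>i. i < m \<Longrightarrow> w (Suc i) = - (\<Sum>k<m. B i k * K (Suc k) 0)"
  shows skew_kernel_mapply: "i < Suc m \<Longrightarrow> mapply (Suc m) K w i = 0"
    and skew_kernel_unique: "(\<And>i. i < Suc m \<Longrightarrow> mapply (Suc m) K x i = 0) \<Longrightarrow> j < Suc m \<Longrightarrow> x j = x 0 * w j"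
proof -
  have M: "mapply (Suc m) K x i = K i 0 * x 0 + (\<Sum>k<m. K i (Suc k) * x (Suc k))" for x i
    unfolding mapply_def by (subst sum.lessThan_Suc_shift) simp
  have Suc: "mapply (Suc m) K w (Suc a) = 0" if "a < m" for a
  proof -
    have "(\<Sum>k<m. K (Suc a) (Suc k) * w (Suc k)) =
        - (\<Sum>k<m. \<Sum>l<m. K (Suc a) (Suc k) * B k l * K (Suc l) 0)"
      by (simp add: w sum_negf sum_distrib_left mult.assoc)
    also have "(\<Sum>k<m. \<Sum>l<m. K (Suc a) (Suc k) * B k l * K (Suc l) 0) =
        (\<Sum>l<m. (\<Sum>k<m. K (Suc a) (Suc k) * B k l) * K (Suc l) 0)"
      unfolding sum_distrib_right by (rule sum.swap)
    also have "\<dots> = (\<Sum>l<m. if l = a then K (Suc a) 0 else 0)"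
      by (intro sum.cong refl) (simp add: right that)
    also have "\<dots> = K (Suc a) 0" using that by simp
    finally show ?thesis by (simp add: M w)
  qed
  have "0 = (\<Sum>i<Suc m. w i * mapply (Suc m) K w i)"
    using skew_form_zero[where n = "Suc m" and x = w and K = K, OF two skew] by (simp add: mapply_def sum_distrib_left mult.assoc del: sum.lessThan_Suc)
  also have "\<dots> = mapply (Suc m) K w 0"
    by (subst sum.lessThan_Suc_shift) (simp add: w Suc)
  finally show "mapply (Suc m) K w i = 0" if "i < Suc m"
    using that Suc by (cases i) auto
  show "x j = x 0 * w j" if x: "\<And>i. i < Suc m \<Longrightarrow> mapply (Suc m) K x i = 0" and "j < Suc m"
  proof (cases j)
    case (Suc a)
    then have a: "a < m" using \<open>j < Suc m\<close> by simp
    have eq: "(\<Sum>k<m. K (Suc i) (Suc k) * x (Suc k)) = - (K (Suc i) 0 * x 0)" if "i < m" for i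
      using x[of "Suc i"] that by (simp add: M add_eq_0_iff)
    have "x j = (\<Sum>k<m. if k = a then x (Suc a) else 0)" using a Suc by simp
    also have "\<dots> = (\<Sum>k<m. (\<Sum>i<m. B a i * K (Suc i) (Suc k)) * x (Suc k))"
      by (intro sum.cong refl) (simp add: left a)
    also have "\<dots> = (\<Sum>i<m. B a i * (\<Sum>k<m. K (Suc i) (Suc k) * x (Suc k)))"
      unfolding sum_distrib_right sum_distrib_left mult.assoc by (rule sum.swap)
    also have "\<dots> = (\<Sum>i<m. B a i * - (K (Suc i) 0 * x 0))"
      by (intro sum.cong refl) (simp only: eq lessThan_iff)
    also have "\<dots> = x 0 * w j"
      by (simp add: w Suc a sum_negf sum_distrib_left algebra_simps)
    finally show ?thesis .
  qed (simp add: w)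
qed

definition skew_poly :: "nat \<Rightarrow> nat \<Rightarrow> nat \<Rightarrow> 'a::field mpoly" where
  "skew_poly n i j = mvar (coord n 0 i j) - mvar (coord n 0 j i)"

definition minor_mat :: "nat \<Rightarrow> 'a::field mpoly mat" where
  "minor_mat n = mat (n - 1) (n - 1) (\<lambda>(i, j). skew_poly n (Suc i) (Suc j))"

text \<open>Cramer's rule for the kernel vector with first entry \<open>1\<close>.\<close>

definition kernel_vec :: "nat \<Rightarrow> nat \<Rightarrow> 'a::field mpoly fract" where
  "kernel_vec n i = (if i = 0 then 1 else
     Fract (- (\<Sum>k<n - 1. adj_mat (minor_mat n) $$ (i - 1, k) * skew_poly n (Suc k) 0)) (det (minor_mat n)))"

definition gen_mat :: "nat \<Rightarrow> nat \<Rightarrow> nat \<Rightarrow> nat \<Rightarrow> 'a::field mpoly fract" where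
  "gen_mat n s i j = Fract (mvar (coord n s i j)) 1"

definition gen_skew :: "nat \<Rightarrow> nat \<Rightarrow> nat \<Rightarrow> 'a::field mpoly fract" where
  "gen_skew n i j = gen_mat n 0 i j - gen_mat n 0 j i"

lemma Fract_skew_poly: "Fract (skew_poly n i j) 1 = gen_skew n i j"
  by (simp add: skew_poly_def gen_skew_def gen_mat_def)

lemma comm_ring_hom_slice_hom: "comm_ring_hom (slice_hom n)"
  unfolding slice_hom_def by (rule comm_ring_hom.comm_ring_hom_heval[OF comm_ring_hom_const_fract])

lemma slice_hom_var: "slice_hom n (mvar v) = slice_pt n (\<lambda>v. Fract (mvar v) 1) v"
  by (simp add: slice_hom_def comm_ring_hom.heval_var[OF comm_ring_hom_const_fract])

text \<open>\<open>J\<close> is a sum of blocks with rows \<open>(0, 1)\<close> and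
  \<open>(-1, 0)\<close>, so its square is minus the identity.\<close>

lemma det_base_pairs:
  assumes "even m"
  defines "J \<equiv> mat m m (\<lambda>(i, j). base_pairs (Suc i) (Suc j) - base_pairs (Suc j) (Suc i) :: 'a::field)"
  shows "det J \<noteq> 0"
proof -
  have J: "J \<in> carrier_mat m m" by (simp add: J_def)
  have "J * (- J) = 1\<^sub>m m"
  proof (rule eq_matI)
    fix i j assume "i < dim_row (1\<^sub>m m :: 'a mat)" "j < dim_col (1\<^sub>m m :: 'a mat)"
    then have ij: "i < m" "j < m" by auto
    \<comment> \<open>The partner of \<open>i\<close>, the only column where row \<open>i\<close> of
      \<open>J\<close> is nonzero.\<close>
    define p where "p = (if even i then Suc i else i - 1)"
    have p: "p < m" using ij assms(1) unfolding p_def by (metis Suc_lessI even_Suc less_imp_diff_less)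
    have "(J * (- J)) $$ (i, j) = (\<Sum>k<m. (base_pairs (Suc i) (Suc k) - base_pairs (Suc k) (Suc i)) *
        (base_pairs (Suc j) (Suc k) - base_pairs (Suc k) (Suc j)))"
      using ij by (simp add: J_def scalar_prod_def atLeast0LessThan algebra_simps flip: sum_negf)
    also have "\<dots> = (base_pairs (Suc i) (Suc p) - base_pairs (Suc p) (Suc i)) *
        (base_pairs (Suc j) (Suc p) - base_pairs (Suc p) (Suc j))"
      by (rule sum_eq_single) (use p in \<open>auto simp: base_pairs_def p_def elim!: oddE\<close>)
    also have "\<dots> = (if i = j then 1 else 0)"
      by (auto simp: base_pairs_def p_def elim!: oddE evenE, presburger+)
    finally show "(J * (- J)) $$ (i, j) = 1\<^sub>m m $$ (i, j)" using ij by simp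
  qed (auto simp: J_def)
  then have "det J * det (- J) = 1"
    by (metis det_mult det_one J uminus_carrier_mat)
  then show ?thesis by auto
qed

context
  fixes n :: nat
  assumes odd_n: "odd n"
begin

text \<open>One point of the slice suffices, and at the base point the minor is the pairing of
  \<open>det_base_pairs\<close>.\<close>

lemma slice_hom_det_minor: "slice_hom n (det (minor_mat n :: 'a::field mpoly mat)) \<noteq> 0"
proof -
  have "\<exists>x. (\<forall>i<n. zcoord n x i \<noteq> 0) \<and> slice_pt n x = (base_pt n :: nat \<Rightarrow> 'a)"
  proof (rule slice_pt_surj)
    show "on_slice n (base_pt n :: nat \<Rightarrow> 'a)"
      by (auto simp: on_slice_def base_pt_coord base_pt_coord(2)[unfolded One_nat_def] base_pairs_def base_shift_def)
  qed (simp add: base_pt_coord base_pt_coord(2)[unfolded One_nat_def] base_shift_def)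
  then obtain x :: "nat \<Rightarrow> 'a" where x: "\<And>i. i < n \<Longrightarrow> zcoord n x i \<noteq> 0" "slice_pt n x = base_pt n"
    by blast
  interpret b: comm_ring_hom "heval (\<lambda>c. c) (base_pt n :: nat \<Rightarrow> 'a)"
    by (rule comm_ring_hom.comm_ring_hom_heval[OF comm_ring_hom_id])
  interpret specialization "heval (\<lambda>c. c) x"
    unfolding specialization_def by (rule comm_ring_hom.comm_ring_hom_heval[OF comm_ring_hom_id])
  have "heval (\<lambda>c. c) (base_pt n) (det (minor_mat n)) = det (map_mat (heval (\<lambda>c. c) (base_pt n :: nat \<Rightarrow> 'a)) (minor_mat n))"
    by simp
  also have "map_mat (heval (\<lambda>c. c) (base_pt n :: nat \<Rightarrow> 'a)) (minor_mat n) =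
      mat (n - 1) (n - 1) (\<lambda>(i, j). base_pairs (Suc i) (Suc j) - base_pairs (Suc j) (Suc i))"
    by (rule eq_matI)
      (auto simp: minor_mat_def skew_poly_def b.hom_minus base_pt_coord
        comm_ring_hom.heval_var[OF comm_ring_hom_id])
  also have "det \<dots> \<noteq> 0" using odd_n by (intro det_base_pairs) auto
  finally have "heval (\<lambda>c. c) (slice_pt n x) (det (minor_mat n)) \<noteq> 0" unfolding x(2) .
  with slice_hom_eval[OF x(1)] show ?thesis by (rule specializes_nonzero)
qed

lemma det_minor_nonzero: "det (minor_mat n :: 'a::field mpoly mat) \<noteq> 0"
proof -
  interpret comm_ring_hom "slice_hom n :: 'a mpoly \<Rightarrow> _" by (rule comm_ring_hom_slice_hom)
  show ?thesis using slice_hom_det_minor by (metis hom_zero)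
qed

text \<open>On the slice column 0 of the skew matrix vanishes, and with it every numerator in
  Cramer's rule, while the denominator survives.\<close>

lemma specializes_kernel_vec:
  assumes "i < n"
  shows "specializes (slice_hom n) (kernel_vec n i :: 'a::field mpoly fract) (if i = 0 then 1 else 0)"
proof -
  interpret specialization "slice_hom n :: 'a mpoly \<Rightarrow> _"
    unfolding specialization_def by (rule comm_ring_hom_slice_hom)
  have "slice_hom n (skew_poly n (Suc k) 0 :: 'a mpoly) = 0" if "k < n - 1" for k
    using that
    by (simp add: skew_poly_def hom_minus slice_hom_var slice_pt_coord slice_num_def mult.commute)
  then have num: "slice_hom n (- (\<Sum>k<n - 1. adj_mat (minor_mat n) $$ (i - 1, k) * skew_poly n (Suc k) 0) :: 'a mpoly) = 0"
    by (simp add: hom_uminus hom_sum hom_mult)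
  show ?thesis
  proof (cases "i = 0")
    case False
    then show ?thesis
      using specializes_Fract[OF slice_hom_det_minor, of "- (\<Sum>k<n - 1. adj_mat (minor_mat n) $$ (i - 1, k) * skew_poly n (Suc k) 0)"]
      by (simp only: kernel_vec_def num div_0 if_False)
  qed (simp add: kernel_vec_def)
qed

text \<open>The uniqueness half is what makes the image of the kernel vector under conjugation a
  multiple of the expected one.\<close>

lemma
  assumes two: "(2::'a::field) \<noteq> 0"
  shows kernel_vec_mapply: "i < n \<Longrightarrow> mapply n (gen_skew n) (kernel_vec n :: nat \<Rightarrow> 'a mpoly fract) i = 0"
    and kernel_vec_unique: "\<And>x :: nat \<Rightarrow> 'a mpoly fract. (\<And>i. i < n \<Longrightarrow> mapply n (gen_skew n) x i = 0) \<Longrightarrow>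
      j < n \<Longrightarrow> x j = x 0 * kernel_vec n j"
proof -
  obtain m where m: "n = Suc m" using odd_n by (cases n) auto
  let ?M = "minor_mat n :: 'a mpoly mat"
  have car: "?M \<in> carrier_mat m m" by (simp add: minor_mat_def m)
  have adj: "adj_mat ?M \<in> carrier_mat m m" "?M * adj_mat ?M = det ?M \<cdot>\<^sub>m 1\<^sub>m m" "adj_mat ?M * ?M = det ?M \<cdot>\<^sub>m 1\<^sub>m m"
    using adj_mat[OF car] by auto
  define B where "B i j = Fract (adj_mat ?M $$ (i, j)) 1 / Fract (det ?M) 1" for i j
  have d: "Fract (det ?M) 1 \<noteq> 0"
    using det_minor_nonzero[where 'a = 'a] by (simp add: Zero_fract_def eq_fract)
  interpret F: comm_ring_hom "\<lambda>p :: 'a mpoly. Fract p 1"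
    by unfold_locales (auto simp: Zero_fract_def One_fract_def)
  have right: "(\<Sum>k<m. gen_skew n (Suc i) (Suc k) * B k j) = (if i = j then 1 else 0)" if "i < m" "j < m" for i j
  proof -
    have "(\<Sum>k<m. skew_poly n (Suc i) (Suc k) * adj_mat ?M $$ (k, j)) = (if i = j then det ?M else 0)"
      using arg_cong[OF adj(2), of "\<lambda>M. M $$ (i, j)"] that car adj(1)
      by (auto simp: scalar_prod_def atLeast0LessThan minor_mat_def m)
    from arg_cong[OF this, of "\<lambda>p. Fract p 1"]
    have "(\<Sum>k<m. gen_skew n (Suc i) (Suc k) * Fract (adj_mat ?M $$ (k, j)) 1) = (if i = j then Fract (det ?M) 1 else 0)"
      unfolding F.hom_sum F.hom_mult Fract_skew_poly by (simp add: F.hom_zero)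
    then show ?thesis using d by (simp add: B_def del: divide_fract flip: sum_divide_distrib)
  qed
  have left: "(\<Sum>k<m. B i k * gen_skew n (Suc k) (Suc j)) = (if i = j then 1 else 0)" if "i < m" "j < m" for i j
  proof -
    have "(\<Sum>k<m. adj_mat ?M $$ (i, k) * skew_poly n (Suc k) (Suc j)) = (if i = j then det ?M else 0)"
      using arg_cong[OF adj(3), of "\<lambda>M. M $$ (i, j)"] that car adj(1)
      by (auto simp: scalar_prod_def atLeast0LessThan minor_mat_def m)
    from arg_cong[OF this, of "\<lambda>p. Fract p 1"]
    have "(\<Sum>k<m. Fract (adj_mat ?M $$ (i, k)) 1 * gen_skew n (Suc k) (Suc j)) = (if i = j then Fract (det ?M) 1 else 0)"
      unfolding F.hom_sum F.hom_mult Fract_skew_poly by (simp add: F.hom_zero)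
    then show ?thesis using d by (simp add: B_def del: divide_fract flip: sum_divide_distrib)
  qed
  have w: "kernel_vec n (Suc i) = - (\<Sum>k<m. B i k * gen_skew n (Suc k) 0)" if "i < m" for i
  proof -
    have "kernel_vec n (Suc i) = - Fract (\<Sum>k<m. adj_mat ?M $$ (i, k) * skew_poly n (Suc k) 0) 1 / Fract (det ?M) 1"
      by (simp add: kernel_vec_def m)
    also have "Fract (\<Sum>k<m. adj_mat ?M $$ (i, k) * skew_poly n (Suc k) 0) 1 =
        (\<Sum>k<m. Fract (adj_mat ?M $$ (i, k)) 1 * gen_skew n (Suc k) 0)"
      unfolding F.hom_sum F.hom_mult Fract_skew_poly ..
    finally show ?thesis by (simp add: B_def sum_divide_distrib del: divide_fract)
  qed
  have skew: "gen_skew n j i = - (gen_skew n i j :: 'a mpoly fract)" for i j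
    by (simp add: gen_skew_def)
  have w0: "kernel_vec n 0 = (1 :: 'a mpoly fract)" by (simp add: kernel_vec_def)
  note * = two_neq_0_fract[OF two] skew right left w0 w
  show "mapply n (gen_skew n) (kernel_vec n) i = (0 :: 'a mpoly fract)" if "i < n"
    using skew_kernel_mapply[of "gen_skew n" m B "kernel_vec n", OF *] that by (simp only: m)
  show "x j = x 0 * kernel_vec n j"
    if "\<And>i. i < n \<Longrightarrow> mapply n (gen_skew n) x i = 0" "j < n" for x :: "nat \<Rightarrow> 'a mpoly fract"
    using skew_kernel_unique[of "gen_skew n" m B "kernel_vec n" x j, OF *] that by (simp only: m)
qed

end

subsection \<open>Orthogonal conjugation on rational functions\<close>

text \<open>Multiplications acting on the row index and on the column index commute.\<close>

lemma mapply_swap: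
  "mapply n A (\<lambda>l. mapply n B (\<lambda>a. f a l) k) j = mapply n B (\<lambda>a. mapply n A (f a) j) k"
  unfolding mapply_def sum_distrib_left
  by (subst sum.swap) (simp add: mult.left_commute)

lemma conj_mat_mapply: "conj_mat n A M i j = mapply n A (\<lambda>k. mapply n A (M k) j) i"
  by (simp add: conj_mat_def mapply_def sum_distrib_left mult.assoc)

lemma mapply_transpose_inverse:
  fixes A :: "nat \<Rightarrow> nat \<Rightarrow> 'k::comm_ring_1"
  assumes "\<And>i j. i < n \<Longrightarrow> j < n \<Longrightarrow> (\<Sum>k<n. A i k * A j k) = (if i = j then 1 else 0)" "i < n"
  shows "mapply n A (mapply n (\<lambda>i j. A j i) x) i = x i"
proof -
  have "mapply n A (mapply n (\<lambda>i j. A j i) x) i = (\<Sum>k<n. \<Sum>l<n. A i k * A l k * x l)"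
    by (simp add: mapply_def sum_distrib_left mult.assoc)
  also have "\<dots> = (\<Sum>l<n. (\<Sum>k<n. A i k * A l k) * x l)"
    unfolding sum_distrib_right by (rule sum.swap)
  also have "\<dots> = (\<Sum>l<n. if l = i then x i else 0)"
    by (intro sum.cong refl) (simp add: assms)
  finally show ?thesis using assms(2) by simp
qed

lemma conj_mat_transpose_inverse:
  fixes A :: "nat \<Rightarrow> nat \<Rightarrow> 'k::comm_ring_1"
  assumes A: "\<And>i j. i < n \<Longrightarrow> j < n \<Longrightarrow> (\<Sum>k<n. A i k * A j k) = (if i = j then 1 else 0)"
    and ij: "i < n" "j < n"
  shows "conj_mat n A (conj_mat n (\<lambda>i j. A j i) M) i j = M i j"
proof -
  let ?B = "\<lambda>i j. A j i"
  have "mapply n A (conj_mat n ?B M k) j = mapply n ?B (\<lambda>a. M a j) k" for k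
  proof -
    have "mapply n A (conj_mat n ?B M k) j = mapply n A (\<lambda>l. mapply n ?B (\<lambda>a. mapply n ?B (M a) l) k) j"
      by (simp add: conj_mat_mapply[abs_def])
    also have "\<dots> = mapply n ?B (\<lambda>a. mapply n A (mapply n ?B (M a)) j) k"
      by (rule mapply_swap)
    also have "\<dots> = mapply n ?B (\<lambda>a. M a j) k"
      using mapply_transpose_inverse[of n A j, OF A ij(2)] by simp
    finally show ?thesis .
  qed
  then have "conj_mat n A (conj_mat n ?B M) i j = mapply n A (mapply n ?B (\<lambda>a. M a j)) i"
    by (simp add: conj_mat_mapply[of n A])
  then show ?thesis using mapply_transpose_inverse[of n A i, OF A ij(1)] by simp
qed

definition conj_hom :: "nat \<Rightarrow> (nat \<Rightarrow> nat \<Rightarrow> 'a::field) \<Rightarrow> 'a mpoly \<Rightarrow> 'a mpoly fract" where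
  "conj_hom n A p = Fract (msubst (conj_subst n A) p) 1"

lemma comm_ring_hom_Fract_msubst: "comm_ring_hom (\<lambda>p. Fract (msubst \<sigma> p) 1)"
proof -
  interpret comm_ring_hom "msubst \<sigma>" by (rule comm_ring_hom_msubst)
  show ?thesis
    by unfold_locales (auto simp: hom_distribs Zero_fract_def One_fract_def)
qed

lemma comm_ring_hom_conj_hom: "comm_ring_hom (conj_hom n A)"
  unfolding conj_hom_def[abs_def] by (rule comm_ring_hom_Fract_msubst)

lemma Fract_1_eq_0_iff: "Fract p 1 = 0 \<longleftrightarrow> p = 0"
  by (simp add: Zero_fract_def eq_fract)

text \<open>Conjugation by \<open>A^T\<close> undoes conjugation by \<open>A\<close>. Thus, unlike
  \<open>slice_hom\<close>, this substitution extends to all fractions.\<close>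

lemma conj_hom_eq_0:
  fixes p :: "'a::field mpoly"
  assumes A: "orthogonal_mat n A" and "conj_hom n A p = 0"
  shows "p = 0"
proof -
  let ?B = "\<lambda>i j. A j i"
  interpret c: comm_ring_hom "mconst :: 'a \<Rightarrow> 'a mpoly" by (rule comm_ring_hom_mconst)
  interpret S: comm_ring_hom "msubst (conj_subst n ?B)" by (rule comm_ring_hom_msubst)
  have orth: "(\<Sum>k<n. mconst (A i k) * mconst (A j k)) = (if i = j then 1 else 0)" if "i < n" "j < n" for i j
    using A that unfolding Defs.orthogonal_mat_def
    by (simp flip: c.hom_mult c.hom_sum)
  have sub: "conj_subst n ?B (coord n s i j) = conj_mat n (\<lambda>i k. mconst (?B i k)) (\<lambda>k l. mvar (coord n s k l)) i j"
    if "s < 2" "i < n" "j < n" for s i j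
    using heval_conj_subst[OF comm_ring_hom_mconst that, of mvar ?B]
    unfolding msubst_def[symmetric] msubst_mvar .
  have inverse: "msubst (conj_subst n ?B) (conj_subst n A v) = mvar v" for v
  proof (cases "v < 2 * n * n")
    case True
    then obtain s i j where v: "v = coord n s i j" and ij: "s < 2" "i < n" "j < n"
      by (rule coord_cases)
    have "msubst (conj_subst n ?B) (conj_subst n A v) =
        conj_mat n (\<lambda>i k. mconst (A i k)) (\<lambda>k l. conj_subst n ?B (coord n s k l)) i j"
      unfolding v msubst_def by (rule heval_conj_subst[OF comm_ring_hom_mconst ij])
    also have "\<dots> = conj_mat n (\<lambda>i k. mconst (A i k))
        (conj_mat n (\<lambda>i k. mconst (A k i)) (\<lambda>k l. mvar (coord n s k l))) i j"
      unfolding conj_mat_def[of n "\<lambda>i k. mconst (A i k)"]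
      by (intro sum.cong refl) (simp add: sub ij)
    also have "\<dots> = mvar v"
      unfolding v by (rule conj_mat_transpose_inverse[OF orth ij(2,3)])
    finally show ?thesis .
  qed (simp add: conj_subst_def)
  have "msubst (conj_subst n A) p = 0"
    using assms(2) by (simp add: conj_hom_def Fract_1_eq_0_iff)
  then have "msubst (conj_subst n ?B) (msubst (conj_subst n A) p) = 0"
    by (simp only: S.hom_zero)
  then show ?thesis by (simp add: msubst_msubst inverse)
qed

text \<open>The definition tests all representatives, \<open>specializes\<close> only one. They
  agree because an orthogonal substitution kills no denominator.\<close>

lemma inv_field_iff:
  "f \<in> inv_field n \<longleftrightarrow>
    f \<in> ratfun_field n \<and> (\<forall>A. orthogonal_mat n A \<longrightarrow> specializes (conj_hom n A) f f)"
proof -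
  have "(\<forall>p q. q \<noteq> 0 \<longrightarrow> f = Fract p q \<longrightarrow>
      Fract (msubst (conj_subst n A) p) (msubst (conj_subst n A) q) = f) \<longleftrightarrow> specializes (conj_hom n A) f f"
    (is "?L \<longleftrightarrow> ?R") if A: "orthogonal_mat n A" for A
  proof
    obtain p q where f: "f = Fract p q" "q \<noteq> 0" by (cases f) auto
    have "conj_hom n A q \<noteq> 0" using conj_hom_eq_0[OF A] f by blast
    moreover assume ?L
    then have "f = conj_hom n A p / conj_hom n A q" using f by (simp add: conj_hom_def)
    ultimately show ?R using f unfolding specializes_def by blast
  next
    interpret specialization "conj_hom n A"
      unfolding specialization_def by (rule comm_ring_hom_conj_hom)
    assume R: ?R
    show ?L
    proof (intro allI impI)
      fix p q assume q: "q \<noteq> 0" and f: "f = Fract p q"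
      have "conj_hom n A q \<noteq> 0" using conj_hom_eq_0[OF A] q by blast
      moreover have "conj_hom n A p = f * conj_hom n A q"
        using specializes_eq[of p q f] R q unfolding f by simp
      ultimately have "conj_hom n A p / conj_hom n A q = f" by simp
      then show "Fract (msubst (conj_subst n A) p) (msubst (conj_subst n A) q) = f"
        by (simp add: conj_hom_def)
    qed
  qed
  then show ?thesis unfolding inv_field_def by blast
qed

lemma is_subfield_fixed:
  fixes \<theta> :: "'r::idom \<Rightarrow> 'r fract"
  assumes "comm_ring_hom \<theta>"
  shows "is_subfield {f. specializes \<theta> f f}"
proof -
  interpret specialization \<theta> unfolding specialization_def by fact
  have "specializes \<theta> (inverse f) (inverse f)" if "specializes \<theta> f f" for f
    using specializes_divide[OF specializes_1 that] by (cases "f = 0") (auto simp: divide_inverse)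
  then show ?thesis
    by (auto simp: is_subfield_def intro: specializes_diff specializes_mult)
qed

lemma is_subfield_inv_field: "is_subfield (inv_field n)"
proof -
  have "inv_field n = ratfun_field n \<inter> (\<Inter>A\<in>{A. orthogonal_mat n A}. {f. specializes (conj_hom n A) f f})"
    by (auto simp: inv_field_iff)
  moreover have "is_subfield (S \<inter> T)" if "is_subfield S" "is_subfield T" for S T :: "'a mpoly fract set"
    using that by (auto simp: is_subfield_def)
  moreover have "is_subfield (ratfun_field n)"
    unfolding ratfun_field_eq by (rule is_subfield_ratfun_over)
  ultimately show ?thesis
    using is_subfield_Int is_subfield_fixed[OF comm_ring_hom_conj_hom] by (metis (no_types, lifting))
qed

lemma specializes_const_Fract_msubst:
  "specializes (\<lambda>p. Fract (msubst \<sigma> p) 1) (const_fract a) (const_fract a)"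
proof -
  interpret specialization "\<lambda>p. Fract (msubst \<sigma> p) 1"
    unfolding specialization_def by (rule comm_ring_hom_Fract_msubst)
  show ?thesis using specializes_Fract_1[of "mconst a"] by (simp add: const_fract_def)
qed

lemma const_in_inv_field: "const_fract a \<in> inv_field n"
  using specializes_const_Fract_msubst[of _ a] ratfun_over_const
  by (auto simp: inv_field_iff ratfun_field_eq conj_hom_def[abs_def])

subsection \<open>The generating invariants\<close>

text \<open>Indexed by the variables of \<open>V\<close>, so that for the free slice coordinates
  invariant \<open>v\<close> restricts to the variable \<open>v\<close>, or to its square at a
  subdiagonal position.\<close>

definition frame_inv :: "nat \<Rightarrow> nat \<Rightarrow> 'a::field mpoly fract" where
  "frame_inv n v = frame_entry n (gen_mat n 1) (kernel_vec n)
     (gen_mat n (v div (n * n))) (v mod (n * n) div n) (v mod n)"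

lemma frame_inv_coord:
  assumes "s < 2" "i < n" "j < n"
  shows "frame_inv n (coord n s i j) = frame_entry n (gen_mat n 1) (kernel_vec n) (gen_mat n s) i j"
  using coord_decode[OF assms] by (simp add: frame_inv_def)

abbreviation var_fract :: "nat \<Rightarrow> 'a::field mpoly fract" where
  "var_fract v \<equiv> Fract (mvar v) 1"

abbreviation gen_seq :: "nat \<Rightarrow> nat \<Rightarrow> nat \<Rightarrow> 'a::field mpoly fract" where
  "gen_seq n \<equiv> gram_schmidt_seq n (gen_mat n 1) (kernel_vec n)"

lemma zcoord_var_fract_nonzero: "zcoord n var_fract i \<noteq> (0 :: 'a::field mpoly fract)"
proof -
  have "mvar v \<noteq> (0 :: 'a mpoly)" for v
  proof
    assume "mvar v = (0 :: 'a mpoly)"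
    then have "vars (mvar v :: 'a mpoly) = {}" by (simp only: vars_zero)
    then show False by simp
  qed
  then show ?thesis by (simp add: zcoord_def Fract_1_eq_0_iff)
qed

lemma specializes_gen_mat:
  "specializes (slice_hom n) (gen_mat n s i j) (slice_pt n var_fract (coord n s i j))"
proof -
  interpret specialization "slice_hom n :: 'a mpoly \<Rightarrow> _"
    unfolding specialization_def by (rule comm_ring_hom_slice_hom)
  show ?thesis using specializes_Fract_1[of "mvar (coord n s i j)"] by (simp add: gen_mat_def slice_hom_var)
qed

context
  fixes n :: nat
  assumes odd_n: "odd n"
begin

context
  fixes Y :: "nat \<Rightarrow> nat \<Rightarrow> 'a::field mpoly fract"
    and w :: "nat \<Rightarrow> 'a mpoly fract"
  defines "Y \<equiv> \<lambda>i j. slice_pt n var_fract (coord n 1 i j)"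
    and "w \<equiv> \<lambda>i. if i = 0 then 1 else 0"
begin

text \<open>\<open>z_(j+1)^2\<close> divided by \<open>z_(j+1) z_j\<close> leaves
  \<open>z_(j+1) / z_j\<close>, which is the recursion of
  \<open>gram_schmidt_seq_Hessenberg\<close>.\<close>

lemma slice_Y: "i < n \<Longrightarrow> j < n \<Longrightarrow> j + 2 \<le> i \<Longrightarrow> Y i j = 0"
  "Suc j < n \<Longrightarrow> Y (Suc j) j * zcoord n var_fract j = zcoord n var_fract (Suc j)"
proof -
  have 1: "(1::nat) < 2" by simp
  show "Y i j = 0" if "i < n" "j < n" "j + 2 \<le> i"
    unfolding Y_def slice_pt_coord[OF 1 that(1,2)] using that by (simp add: slice_num_def)
  assume j: "Suc j < n"
  have "slice_num n var_fract 1 (Suc j) j = (zcoord n var_fract (Suc j) :: 'a mpoly fract)\<^sup>2"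
    by (simp add: slice_num_def zcoord_def)
  moreover have "Y (Suc j) j = slice_num n var_fract 1 (Suc j) j / (zcoord n var_fract (Suc j) * zcoord n var_fract j)"
    unfolding Y_def using j by (intro slice_pt_coord) auto
  ultimately show "Y (Suc j) j * zcoord n var_fract j = zcoord n var_fract (Suc j)"
    using zcoord_var_fract_nonzero[where 'a = 'a] by (simp add: power2_eq_square del: mult_fract divide_fract)
qed

lemma slice_w: "w i = (if i = 0 then 1 else 0)"
  by (simp add: w_def)

lemma zcoord_0: "zcoord n var_fract 0 = (1 :: 'a mpoly fract)"
  by (simp add: zcoord_def)

lemma slice_seq:
  assumes "k < n" "i < n"
  shows "gram_schmidt_seq n Y w k i = (if i = k then zcoord n var_fract k else 0)"
  by (rule gram_schmidt_seq_Hessenberg[where n = n and Y = Y and w = w and z = "zcoord n var_fract", OF zcoord_var_fract_nonzero zcoord_0 slice_Y slice_w assms])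

lemma slice_frame_entry:
  assumes "i < n" "j < n"
  shows "frame_entry n Y w M i j = zcoord n var_fract i * M i j * zcoord n var_fract j"
  by (rule frame_entry_Hessenberg[where n = n and Y = Y and w = w and z = "zcoord n var_fract", OF zcoord_var_fract_nonzero zcoord_0 slice_Y slice_w assms])

lemma slice_seq_norm:
  assumes "k < n"
  shows "dotp n (gram_schmidt_seq n Y w k) (gram_schmidt_seq n Y w k) \<noteq> 0"
proof -
  have "dotp n (gram_schmidt_seq n Y w k) (gram_schmidt_seq n Y w k) =
      (\<Sum>i<n. if i = k then (zcoord n var_fract k)\<^sup>2 else 0)"
    unfolding dotp_def by (intro sum.cong refl) (simp add: slice_seq assms power2_eq_square)
  then show ?thesis using assms zcoord_var_fract_nonzero by simp
qed

lemma slice_gen_mat: "specializes (slice_hom n) (gen_mat n 1 i j) (Y i j)"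
  unfolding Y_def by (rule specializes_gen_mat)

lemma slice_kernel_vec: "i < n \<Longrightarrow> specializes (slice_hom n) (kernel_vec n i) (w i)"
  unfolding w_def by (rule specializes_kernel_vec[OF odd_n])

text \<open>On the slice the norm is the square of \<open>z_k\<close>, which is not zero.\<close>

lemma gen_seq_norm:
  assumes "k < n"
  shows "dotp n (gen_seq n k) (gen_seq n k) \<noteq> (0 :: 'a mpoly fract)"
proof -
  interpret specialization "slice_hom n :: 'a mpoly \<Rightarrow> _"
    unfolding specialization_def by (rule comm_ring_hom_slice_hom)
  have "specializes (slice_hom n) (gen_seq n k i) (gram_schmidt_seq n Y w k i)" if "i < n" for i
    by (rule specializes_gram_schmidt_seq[where n = n])
      (use assms that slice_gen_mat slice_kernel_vec slice_seq_norm in auto)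
  then have "specializes (slice_hom n) (dotp n (gen_seq n k) (gen_seq n k))
      (dotp n (gram_schmidt_seq n Y w k) (gram_schmidt_seq n Y w k))"
    by (intro specializes_dotp) auto
  then show ?thesis using slice_seq_norm[OF assms] by (rule specializes_nonzero)
qed

lemma specializes_frame_inv:
  assumes ij: "s < 2" "i < n" "j < n"
  shows "specializes (slice_hom n) (frame_inv n (coord n s i j)) (slice_num n var_fract s i j :: 'a mpoly fract)"
proof -
  interpret specialization "slice_hom n :: 'a mpoly \<Rightarrow> _"
    unfolding specialization_def by (rule comm_ring_hom_slice_hom)
  have "specializes (slice_hom n) (frame_inv n (coord n s i j))
      (frame_entry n Y w (\<lambda>i j. slice_pt n var_fract (coord n s i j)) i j)"
    unfolding frame_inv_coord[OF ij]
    by (rule specializes_frame_entry)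
      (use ij specializes_gen_mat slice_gen_mat slice_kernel_vec slice_seq_norm in auto)
  also have "frame_entry n Y w (\<lambda>i j. slice_pt n var_fract (coord n s i j)) i j = slice_num n var_fract s i j"
    using ij zcoord_var_fract_nonzero[where 'a = 'a] by (simp add: slice_frame_entry slice_pt_coord)
  finally show ?thesis .
qed

end

text \<open>Conjugation moves the kernel vector to a multiple of \<open>C w\<close>, so the whole
  frame moves by \<open>C\<close> and one scalar, and \<open>frame_entry_conj\<close> removes
  both.\<close>

lemma frame_inv_invariant:
  fixes A :: "nat \<Rightarrow> nat \<Rightarrow> 'a::field"
  assumes two: "(2::'a) \<noteq> 0" and A: "orthogonal_mat n A" and ij: "s < 2" "i < n" "j < n"
  shows "specializes (conj_hom n A) (frame_inv n (coord n s i j)) (frame_inv n (coord n s i j))"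
proof -
  interpret c: comm_ring_hom "const_fract :: 'a \<Rightarrow> 'a mpoly fract" by (rule comm_ring_hom_const_fract)
  interpret specialization "conj_hom n A"
    unfolding specialization_def by (rule comm_ring_hom_conj_hom)
  define C where "C i k = const_fract (A i k)" for i k
  have orth: "(\<Sum>k<n. C i k * C j k) = (if i = j then 1 else 0)" if "i < n" "j < n" for i j
    using A that unfolding Defs.orthogonal_mat_def C_def
    by (simp flip: c.hom_mult c.hom_sum)
  have orth': "(\<Sum>k<n. C k i * C k j) = (if i = j then 1 else 0)" if "i < n" "j < n" for i j
    using orthogonal_mat_transpose[OF A] that unfolding Defs.orthogonal_mat_def C_def
    by (simp flip: c.hom_mult c.hom_sum)
  have gen: "specializes (conj_hom n A) (gen_mat n s i j) (conj_mat n C (gen_mat n s) i j)"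
    if "s < 2" "i < n" "j < n" for s i j
  proof -
    have "conj_hom n A (mvar (coord n s i j)) = heval const_fract var_fract (conj_subst n A (coord n s i j))"
      by (simp add: conj_hom_def heval_Fract)
    also have "\<dots> = conj_mat n C (gen_mat n s) i j"
      unfolding C_def[abs_def] gen_mat_def[abs_def]
      by (rule heval_conj_subst[OF comm_ring_hom_const_fract that])
    finally show ?thesis using specializes_Fract_1[of "mvar (coord n s i j)"] by (simp add: gen_mat_def)
  qed
  have "\<exists>h. specializes (conj_hom n A) (f :: 'a mpoly fract) h" for f
  proof -
    obtain p q where f: "f = Fract p q" "q \<noteq> 0" by (cases f) auto
    have "conj_hom n A q \<noteq> 0" using conj_hom_eq_0[OF A] f by blast
    then show ?thesis using f specializes_Fract by blast
  qed
  then have "\<forall>i. \<exists>h. specializes (conj_hom n A) (kernel_vec n i) h" by blast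
  from choice[OF this] obtain w' where w': "\<And>i. specializes (conj_hom n A) (kernel_vec n i) (w' i)"
    by blast
  let ?K = "gen_skew n :: nat \<Rightarrow> nat \<Rightarrow> 'a mpoly fract"
  \<comment> \<open>The image of the kernel vector, moved back by \<open>C^T\<close>. It lies in the
    kernel of the original skew matrix, hence is a multiple of \<open>kernel_vec\<close>.\<close>
  define x where "x = mapply n (\<lambda>i j. C j i) w'"
  have Cx: "mapply n C x i = w' i" if "i < n" for i
    unfolding x_def using mapply_transpose_inverse[of n C i w', OF orth that] by simp
  have skew: "specializes (conj_hom n A) (?K i j) (conj_mat n C ?K i j)" if "i < n" "j < n" for i j
  proof -
    have "conj_mat n C ?K i j = conj_mat n C (gen_mat n 0) i j - conj_mat n C (gen_mat n 0) j i"
    proof -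
      have "conj_mat n C (gen_mat n 0) j i = (\<Sum>k<n. \<Sum>l<n. C i k * C j l * gen_mat n 0 l k)"
        unfolding conj_mat_def by (subst sum.swap) (simp add: mult.commute)
      then show ?thesis
        by (simp add: conj_mat_def gen_skew_def right_diff_distrib sum_subtractf)
    qed
    then show ?thesis unfolding gen_skew_def using that gen by (auto intro: specializes_diff)
  qed
  have "mapply n C (mapply n ?K x) i = 0" if "i < n" for i
  proof -
    have "specializes (conj_hom n A) (mapply n ?K (kernel_vec n) i) (mapply n (conj_mat n C ?K) w' i)"
      using that by (intro specializes_mapply skew w') auto
    then have "mapply n (conj_mat n C ?K) w' i = 0"
      unfolding kernel_vec_mapply[OF odd_n two that] by (rule specializes_unique) (rule specializes_0)
    moreover have "mapply n (conj_mat n C ?K) w' = mapply n (conj_mat n C ?K) (mapply n C x)"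
      by (rule mapply_cong) (simp add: Cx)
    ultimately show ?thesis using mapply_conj_mat[OF orth', of ?K x i] by simp
  qed
  then have "mapply n ?K x i = 0" if "i < n" for i
  proof -
    have "mapply n (\<lambda>i j. C j i) (mapply n C (mapply n ?K x)) i = mapply n ?K x i"
      using mapply_transpose_inverse[of n "\<lambda>i j. C j i" i "mapply n ?K x", OF orth' that] by simp
    moreover have "mapply n (\<lambda>i j. C j i) (mapply n C (mapply n ?K x)) i = 0"
      using \<open>\<And>i. i < n \<Longrightarrow> mapply n C (mapply n ?K x) i = 0\<close> by (simp add: mapply_def[of n "\<lambda>i j. C j i"])
    ultimately show ?thesis by simp
  qed
  then have x: "x i = x 0 * kernel_vec n i" if "i < n" for i
    using kernel_vec_unique[OF odd_n two, of x i] that by blast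
  have w'_eq: "w' i = x 0 * mapply n C (kernel_vec n) i" if "i < n" for i
    unfolding Cx[OF that, symmetric] mapply_scale[symmetric]
    by (rule fun_cong[OF mapply_cong]) (rule x)
  have n0: "0 < n" using odd_n by (cases n) auto
  \<comment> \<open>Otherwise \<open>w' 0\<close> would be 0, whereas the first entry 1 of
    \<open>kernel_vec\<close> specialises to 1.\<close>
  have x0: "x 0 \<noteq> 0"
  proof
    assume "x 0 = 0"
    then have "specializes (conj_hom n A) (1 :: 'a mpoly fract) 0"
      using w'[of 0] w'_eq[OF n0] by (simp add: kernel_vec_def)
    then show False using specializes_unique[OF specializes_1] by (metis zero_neq_one)
  qed
  let ?Y' = "conj_mat n C (gen_mat n 1)" and ?g = "gen_seq n :: nat \<Rightarrow> nat \<Rightarrow> 'a mpoly fract"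
  have g': "gram_schmidt_seq n ?Y' w' j i = x 0 * mapply n C (?g j) i" if "i < n" for i j
    by (rule gram_schmidt_seq_conj[OF orth' x0 _ w'_eq that]) auto
  have norm: "dotp n (gram_schmidt_seq n ?Y' w' j) (gram_schmidt_seq n ?Y' w' j) \<noteq> 0" if "j < n" for j
  proof -
    have "dotp n (gram_schmidt_seq n ?Y' w' j) (gram_schmidt_seq n ?Y' w' j) =
        dotp n (\<lambda>i. x 0 * mapply n C (?g j) i) (\<lambda>i. x 0 * mapply n C (?g j) i)"
      by (rule dotp_cong) (rule g', assumption)+
    also have "\<dots> = (x 0)\<^sup>2 * dotp n (?g j) (?g j)"
      unfolding dotp_scale using dotp_orthogonal[of n C "?g j" "?g j", OF orth'] by simp
    finally show ?thesis using x0 gen_seq_norm[OF that, where 'a = 'a] by simp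
  qed
  have "specializes (conj_hom n A) (frame_inv n (coord n s i j))
      (frame_entry n ?Y' w' (conj_mat n C (gen_mat n s)) i j)"
    unfolding frame_inv_coord[OF ij]
    by (rule specializes_frame_entry) (use ij gen w' norm in auto)
  also have "frame_entry n ?Y' w' (conj_mat n C (gen_mat n s)) i j = frame_inv n (coord n s i j)"
    unfolding frame_inv_coord[OF ij]
    by (rule frame_entry_conj[OF orth' x0 _ w'_eq]) auto
  finally show ?thesis .
qed

end

subsection \<open>Rational functions invariant under sign changes\<close>

lemma vars_sum: "finite I \<Longrightarrow> vars (sum f I) \<subseteq> (\<Union>i\<in>I. vars (f i))"
proof (induction I rule: finite_induct)
  case (insert i I)
  then show ?case using vars_add[of "f i" "sum f I"] by auto
qed simp

lemma vars_power: "vars (p ^ k) \<subseteq> vars p"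
proof (induction k)
  case (Suc k)
  then show ?case using vars_mult[of p "p ^ k"] by auto
qed simp

lemma vars_prod: "finite I \<Longrightarrow> vars (prod f I) \<subseteq> (\<Union>i\<in>I. vars (f i))"
proof (induction I rule: finite_induct)
  case (insert i I)
  then show ?case using vars_mult[of "f i" "prod f I"] by auto
qed simp

lemma vars_msubst: "vars (msubst \<sigma> p) \<subseteq> (\<Union>v\<in>vars p. vars (\<sigma> v))"
proof -
  let ?M = "\<lambda>m. \<Prod>v\<in>Poly_Mapping.keys m. \<sigma> v ^ Poly_Mapping.lookup m v"
  have "vars (msubst \<sigma> p) \<subseteq> (\<Union>m\<in>Poly_Mapping.keys p. vars (mconst (Poly_Mapping.lookup p m) * ?M m))"
    unfolding msubst_def heval_def by (rule vars_sum) simp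
  also have "\<dots> \<subseteq> (\<Union>m\<in>Poly_Mapping.keys p. vars (?M m))"
  proof (rule UN_mono[OF order_refl])
    fix m
    show "vars (mconst (Poly_Mapping.lookup p m) * ?M m) \<subseteq> vars (?M m)"
      using vars_mult[of "mconst (Poly_Mapping.lookup p m)" "?M m"] by simp
  qed
  also have "\<dots> \<subseteq> (\<Union>m\<in>Poly_Mapping.keys p. \<Union>v\<in>Poly_Mapping.keys m. vars (\<sigma> v ^ Poly_Mapping.lookup m v))"
    by (intro UN_mono[OF order_refl] vars_prod) simp
  also have "\<dots> \<subseteq> (\<Union>m\<in>Poly_Mapping.keys p. \<Union>v\<in>Poly_Mapping.keys m. vars (\<sigma> v))"
    by (intro UN_mono[OF order_refl] vars_power)
  also have "\<dots> = (\<Union>v\<in>vars p. vars (\<sigma> v))" by (simp add: vars_def[of p])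
  finally show ?thesis .
qed

lemma msubst_cong: "(\<And>v. v \<in> vars p \<Longrightarrow> \<sigma> v = \<tau> v) \<Longrightarrow> msubst \<sigma> p = msubst \<tau> p"
  unfolding msubst_def by (rule heval_cong)

lemma monval_mvar: "monval mvar m = (Poly_Mapping.single m 1 :: 'a::comm_ring_1 mpoly)"
proof -
  have "msubst mvar (Poly_Mapping.single m (1::'a)) = monval mvar m"
    unfolding msubst_def comm_ring_hom.heval_single[OF comm_ring_hom_mconst]
    by (simp add: mconst_def)
  then show ?thesis by simp
qed

lemma mpoly_monomials:
  "p = (\<Sum>m\<in>Poly_Mapping.keys p. mconst (Poly_Mapping.lookup p m) * monval mvar m)"
  using heval_monval[of mconst mvar p] by (simp flip: msubst_def)

definition neg_subst :: "nat \<Rightarrow> nat \<Rightarrow> 'a::field mpoly" where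
  "neg_subst v u = (if u = v then - mvar u else mvar u)"

text \<open>In characteristic other than 2 its image consists of the polynomials invariant under the
  sign changes of the variables in \<open>Z\<close>.\<close>

definition square_subst :: "nat set \<Rightarrow> nat \<Rightarrow> 'a::field mpoly" where
  "square_subst Z u = (if u \<in> Z then (mvar u)\<^sup>2 else mvar u)"

lemma msubst_uminus: "msubst \<sigma> (- p) = - msubst \<sigma> p"
proof -
  interpret comm_ring_hom "msubst \<sigma>" by (rule comm_ring_hom_msubst)
  show ?thesis by (rule hom_uminus)
qed

lemma msubst_zero: "msubst \<sigma> 0 = 0"
  by (simp add: msubst_def heval_def)

lemma neg_subst_involution: "msubst (neg_subst v) (msubst (neg_subst v) p) = (p :: 'a::field mpoly)"
proof -
  have "msubst (neg_subst v) (neg_subst v u) = (mvar u :: 'a mpoly)" for u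
    by (simp add: neg_subst_def msubst_uminus)
  then show ?thesis by (simp add: msubst_msubst)
qed

lemma neg_subst_commute:
  "msubst (neg_subst u) (msubst (neg_subst v) p) =
    msubst (neg_subst v) (msubst (neg_subst u) (p :: 'a::field mpoly))"
proof -
  have "msubst (neg_subst u) (neg_subst v w) = (msubst (neg_subst v) (neg_subst u w) :: 'a mpoly)" for w
    by (simp add: neg_subst_def msubst_uminus)
  then show ?thesis by (simp add: msubst_msubst)
qed

lemma vars_neg_subst: "vars (msubst (neg_subst v) p) \<subseteq> vars p"
  using vars_msubst[of "neg_subst v" p] by (auto simp: neg_subst_def split: if_splits)

lemma neg_subst_eq_0: "msubst (neg_subst v) p = 0 \<Longrightarrow> p = 0"
  using neg_subst_involution[of v p] by (simp add: msubst_zero)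

lemma lookup_neg_subst:
  "Poly_Mapping.lookup (msubst (neg_subst v) (p :: 'a::field mpoly)) m = (- 1) ^ Poly_Mapping.lookup m v * Poly_Mapping.lookup p m"
proof -
  interpret c: comm_ring_hom "mconst :: 'a \<Rightarrow> 'a mpoly" by (rule comm_ring_hom_mconst)
  have mon: "monval (neg_subst v) m = mconst ((- 1) ^ Poly_Mapping.lookup m v) * (monval mvar m :: 'a mpoly)" for m
  proof -
    let ?S = "insert v (Poly_Mapping.keys m)"
    have "monval (neg_subst v) m = (\<Prod>u\<in>?S. neg_subst v u ^ Poly_Mapping.lookup m u :: 'a mpoly)"
      by (rule monval_superset) auto
    also have "\<dots> = (\<Prod>u\<in>?S. (if u = v then mconst ((- 1) ^ Poly_Mapping.lookup m v) else 1) *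
        mvar u ^ Poly_Mapping.lookup m u)"
    proof (intro prod.cong refl)
      fix u
      have neg: "(- mvar u :: 'a mpoly) = mconst (- 1) * mvar u"
        by (simp add: c.hom_uminus)
      have "(- mvar u :: 'a mpoly) ^ k = mconst ((- 1) ^ k) * mvar u ^ k" for k
        unfolding neg power_mult_distrib c.hom_power ..
      from this[of "Poly_Mapping.lookup m u"]
      show "neg_subst v u ^ Poly_Mapping.lookup m u = (if u = v then mconst ((- 1) ^ Poly_Mapping.lookup m v) else 1) *
        (mvar u :: 'a mpoly) ^ Poly_Mapping.lookup m u"
        unfolding neg_subst_def by (cases "u = v"; simp only: if_True if_False mult_1 simp_thms)
    qed
    also have "\<dots> = mconst ((- 1) ^ Poly_Mapping.lookup m v) * (\<Prod>u\<in>?S. mvar u ^ Poly_Mapping.lookup m u)"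
      by (simp add: prod.distrib prod.delta)
    also have "(\<Prod>u\<in>?S. mvar u ^ Poly_Mapping.lookup m u) = (monval mvar m :: 'a mpoly)"
      by (rule monval_superset[symmetric]) auto
    finally show ?thesis .
  qed
  have "msubst (neg_subst v) p = (\<Sum>k\<in>Poly_Mapping.keys p.
      Poly_Mapping.single k ((- 1) ^ Poly_Mapping.lookup k v * Poly_Mapping.lookup p k))"
    unfolding msubst_def heval_monval
    by (intro sum.cong refl) (simp add: mon monval_mvar mconst_def mult_single mult.commute)
  then have "Poly_Mapping.lookup (msubst (neg_subst v) p) m = (\<Sum>k\<in>Poly_Mapping.keys p.
      if k = m then (- 1) ^ Poly_Mapping.lookup m v * Poly_Mapping.lookup p m else 0)"
    by (simp add: lookup_sum lookup_single when_def)
  then show ?thesis by (simp add: in_keys_iff)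
qed

text \<open>The effect of \<open>square_subst\<close> on exponents; \<open>halve_on\<close> reverts
  it on even ones.\<close>

definition double_on :: "nat set \<Rightarrow> (nat \<Rightarrow>\<^sub>0 nat) \<Rightarrow> nat \<Rightarrow>\<^sub>0 nat" where
  "double_on Z m = Poly_Mapping.mapp (\<lambda>u k. if u \<in> Z then 2 * k else k) m"

definition halve_on :: "nat set \<Rightarrow> (nat \<Rightarrow>\<^sub>0 nat) \<Rightarrow> nat \<Rightarrow>\<^sub>0 nat" where
  "halve_on Z m = Poly_Mapping.mapp (\<lambda>u k. if u \<in> Z then k div 2 else k) m"

lemma lookup_double_on: "Poly_Mapping.lookup (double_on Z m) u =
    (if u \<in> Z then 2 * Poly_Mapping.lookup m u else Poly_Mapping.lookup m u)"
  by (auto simp: double_on_def lookup_mapp when_def in_keys_iff)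

lemma lookup_halve_on: "Poly_Mapping.lookup (halve_on Z m) u =
    (if u \<in> Z then Poly_Mapping.lookup m u div 2 else Poly_Mapping.lookup m u)"
  by (auto simp: halve_on_def lookup_mapp when_def in_keys_iff)

lemma double_on_inj: "double_on Z m = double_on Z m' \<Longrightarrow> m = m'"
proof (rule poly_mapping_eqI)
  fix u
  assume "double_on Z m = double_on Z m'"
  from arg_cong[OF this, of "\<lambda>k. Poly_Mapping.lookup k u"]
  show "Poly_Mapping.lookup m u = Poly_Mapping.lookup m' u"
    by (auto simp: lookup_double_on split: if_splits)
qed

lemma double_halve_on:
  assumes "\<And>v. v \<in> Z \<Longrightarrow> even (Poly_Mapping.lookup m v)"
  shows "double_on Z (halve_on Z m) = m"
  by (rule poly_mapping_eqI) (use assms in \<open>auto simp: lookup_double_on lookup_halve_on\<close>)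

lemma monval_square_subst:
  "monval (square_subst Z) m = (Poly_Mapping.single (double_on Z m) 1 :: 'a::field mpoly)"
proof -
  have "monval (square_subst Z) m = (\<Prod>u\<in>Poly_Mapping.keys m. mvar u ^ Poly_Mapping.lookup (double_on Z m) u :: 'a mpoly)"
    unfolding monval_def
    by (intro prod.cong refl) (simp add: square_subst_def lookup_double_on power_mult)
  also have "\<dots> = monval mvar (double_on Z m)"
    by (rule monval_superset[symmetric]) (auto simp: in_keys_iff lookup_double_on split: if_splits)
  finally show ?thesis by (simp add: monval_mvar)
qed

lemma msubst_square_subst:
  "msubst (square_subst Z) p =
    (\<Sum>k\<in>Poly_Mapping.keys p. Poly_Mapping.single (double_on Z k) (Poly_Mapping.lookup p k))"
  unfolding msubst_def heval_monval
  by (intro sum.cong refl) (simp add: monval_square_subst mconst_def mult_single)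

lemma square_subst_eq_0:
  assumes "msubst (square_subst Z) p = 0"
  shows "p = 0"
proof (rule poly_mapping_eqI)
  fix m
  have "0 = (\<Sum>k\<in>Poly_Mapping.keys p. Poly_Mapping.lookup
      (Poly_Mapping.single (double_on Z k) (Poly_Mapping.lookup p k)) (double_on Z m))"
    using arg_cong[OF assms, of "\<lambda>q. Poly_Mapping.lookup q (double_on Z m)"]
    unfolding msubst_square_subst lookup_sum by simp
  also have "\<dots> = (\<Sum>k\<in>Poly_Mapping.keys p. if k = m then Poly_Mapping.lookup p m else 0)"
    by (intro sum.cong refl) (auto simp: lookup_single when_def dest: double_on_inj)
  finally show "Poly_Mapping.lookup p m = Poly_Mapping.lookup 0 m"
    by (simp add: in_keys_iff split: if_splits)
qed

text \<open>A coefficient at an odd exponent of some \<open>v\<close> in \<open>Z\<close> equals its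
  own negative, hence vanishes; the remaining exponents can be halved.\<close>

lemma even_poly_square_subst:
  fixes p :: "'a::field mpoly"
  assumes two: "(2::'a) \<noteq> 0" and inv: "\<And>v. v \<in> Z \<Longrightarrow> msubst (neg_subst v) p = p" and W: "vars p \<subseteq> W"
  shows "\<exists>P. vars P \<subseteq> W \<and> msubst (square_subst Z) P = p"
proof -
  have even: "even (Poly_Mapping.lookup m v)" if "m \<in> Poly_Mapping.keys p" "v \<in> Z" for m v
  proof (rule ccontr)
    assume "odd (Poly_Mapping.lookup m v)"
    then have "Poly_Mapping.lookup p m = - Poly_Mapping.lookup p m"
      using lookup_neg_subst[of v p m] by (simp add: inv that)
    then have "2 * Poly_Mapping.lookup p m = 0" by (simp only: mult_2 eq_neg_iff_add_eq_0)
    then show False using two that by (simp add: in_keys_iff)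
  qed
  define P where "P = (\<Sum>m\<in>Poly_Mapping.keys p. Poly_Mapping.single (halve_on Z m) (Poly_Mapping.lookup p m))"
  interpret S: comm_ring_hom "msubst (square_subst Z) :: 'a mpoly \<Rightarrow> _" by (rule comm_ring_hom_msubst)
  have "msubst (square_subst Z) P = (\<Sum>m\<in>Poly_Mapping.keys p. mconst (Poly_Mapping.lookup p m) * monval (square_subst Z) (halve_on Z m))"
    unfolding P_def S.hom_sum
    by (simp only: msubst_def comm_ring_hom.heval_single[OF comm_ring_hom_mconst])
  also have "\<dots> = (\<Sum>m\<in>Poly_Mapping.keys p. mconst (Poly_Mapping.lookup p m) * monval mvar m)"
    by (intro sum.cong refl) (simp add: monval_square_subst monval_mvar double_halve_on even)
  also have "\<dots> = p" by (rule mpoly_monomials[symmetric])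
  finally have "msubst (square_subst Z) P = p" .
  moreover have "vars P \<subseteq> W"
  proof -
    have "vars (Poly_Mapping.single (halve_on Z m) (Poly_Mapping.lookup p m)) \<subseteq> vars p"
      if "m \<in> Poly_Mapping.keys p" for m
      using that by (auto simp: vars_def in_keys_iff lookup_halve_on split: if_splits)
    moreover have "vars P \<subseteq> (\<Union>m\<in>Poly_Mapping.keys p.
        vars (Poly_Mapping.single (halve_on Z m) (Poly_Mapping.lookup p m)))"
      unfolding P_def by (rule vars_sum) simp
    ultimately show ?thesis using W by blast
  qed
  ultimately show ?thesis by blast
qed

definition neg_hom :: "nat \<Rightarrow> 'a::field mpoly \<Rightarrow> 'a mpoly fract" where
  "neg_hom v p = Fract (msubst (neg_subst v) p) 1"

text \<open>Multiplying numerator and denominator by the conjugate of the denominator makes both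
  invariant, one sign change at a time.\<close>

lemma neg_invariant_fract:
  fixes h :: "'a::field mpoly fract"
  assumes "finite Z" "h \<in> ratfun_over W" "\<And>v. v \<in> Z \<Longrightarrow> specializes (neg_hom v) h h"
  shows "\<exists>p q. q \<noteq> 0 \<and> vars p \<subseteq> W \<and> vars q \<subseteq> W \<and> h = Fract p q \<and>
    (\<forall>v\<in>Z. msubst (neg_subst v) p = p \<and> msubst (neg_subst v) q = q)"
  using assms
proof (induction Z rule: finite_induct)
  case empty
  then show ?case by (auto simp: ratfun_over_def)
next
  case (insert v Z)
  have "\<exists>p q. q \<noteq> 0 \<and> vars p \<subseteq> W \<and> vars q \<subseteq> W \<and> h = Fract p q \<and>
    (\<forall>u\<in>Z. msubst (neg_subst u) p = p \<and> msubst (neg_subst u) q = q)"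
    by (rule insert.IH[OF insert.prems(1)]) (rule insert.prems(2)[OF insertI2])
  then obtain p q where "q \<noteq> 0 \<and> vars p \<subseteq> W \<and> vars q \<subseteq> W \<and> h = Fract p q \<and>
    (\<forall>u\<in>Z. msubst (neg_subst u) p = p \<and> msubst (neg_subst u) q = q)"
    by (elim exE)
  then have q: "q \<noteq> 0" and pq: "vars p \<subseteq> W" "vars q \<subseteq> W" and h: "h = Fract p q"
    and inv: "\<And>u. u \<in> Z \<Longrightarrow> msubst (neg_subst u) p = p \<and> msubst (neg_subst u) q = q"
    by blast+
  interpret specialization "neg_hom v :: 'a mpoly \<Rightarrow> _"
    unfolding specialization_def neg_hom_def[abs_def] by (rule comm_ring_hom_Fract_msubst)
  interpret N: comm_ring_hom "msubst (neg_subst u) :: 'a mpoly \<Rightarrow> _" for u by (rule comm_ring_hom_msubst)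
  let ?N = "msubst (neg_subst v) :: 'a mpoly \<Rightarrow> 'a mpoly"
  have "neg_hom v p = h * neg_hom v q"
    using specializes_eq[of p q h] insert.prems(2)[of v] q h by simp
  then have "Fract (?N p) 1 = Fract (p * ?N q) q" unfolding neg_hom_def h by simp
  \<comment> \<open>This says that \<open>p * ?N q\<close> is fixed by \<open>?N\<close>, which
    merely swaps its two descriptions.\<close>
  then have eq: "?N p * q = p * ?N q" using q by (simp add: eq_fract)
  have Nq: "?N q \<noteq> 0" using q neg_subst_eq_0 by blast
  show ?case
  proof (intro exI conjI ballI)
    show "q * ?N q \<noteq> 0" using q Nq by simp
    show "h = Fract (p * ?N q) (q * ?N q)" using q Nq h by (simp add: eq_fract)
    show "vars (p * ?N q) \<subseteq> W" "vars (q * ?N q) \<subseteq> W"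
      using pq vars_mult[of p "?N q"] vars_mult[of q "?N q"] vars_neg_subst[of v q] by blast+
    fix u assume "u \<in> insert v Z"
    then consider (v) "u = v" | (Z) "u \<in> Z" by auto
    note cases = this
    from cases show "msubst (neg_subst u) (p * ?N q) = p * ?N q"
    proof cases
      case v
      show ?thesis unfolding v N.hom_mult neg_subst_involution eq ..
    next
      case Z
      \<comment> \<open>Sign changes commute, so the invariance already achieved persists.\<close>
      show ?thesis unfolding N.hom_mult neg_subst_commute[of u v] using inv[OF Z] by simp
    qed
    from cases show "msubst (neg_subst u) (q * ?N q) = q * ?N q"
    proof cases
      case v
      show ?thesis unfolding v N.hom_mult neg_subst_involution by (rule mult.commute)
    next
      case Z
      show ?thesis unfolding N.hom_mult neg_subst_commute[of u v] using inv[OF Z] by simp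
    qed
  qed
qed

lemma neg_invariant_square:
  fixes h :: "'a::field mpoly fract"
  assumes two: "(2::'a) \<noteq> 0"
    and "finite Z" "h \<in> ratfun_over W" "\<And>v. v \<in> Z \<Longrightarrow> specializes (neg_hom v) h h"
  shows "\<exists>P Q. vars P \<subseteq> W \<and> vars Q \<subseteq> W \<and> msubst (square_subst Z) Q \<noteq> 0 \<and>
    h = Fract (msubst (square_subst Z) P) (msubst (square_subst Z) Q)"
proof -
  have "\<exists>p q. q \<noteq> 0 \<and> vars p \<subseteq> W \<and> vars q \<subseteq> W \<and> h = Fract p q \<and>
    (\<forall>v\<in>Z. msubst (neg_subst v) p = p \<and> msubst (neg_subst v) q = q)"
    by (rule neg_invariant_fract[OF assms(2,3)]) (rule assms(4))
  then obtain p q where "q \<noteq> 0 \<and> vars p \<subseteq> W \<and> vars q \<subseteq> W \<and> h = Fract p q \<and>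
    (\<forall>v\<in>Z. msubst (neg_subst v) p = p \<and> msubst (neg_subst v) q = q)"
    by (elim exE)
  then have "q \<noteq> 0" and pq: "vars p \<subseteq> W" "vars q \<subseteq> W" and h: "h = Fract p q"
    and inv: "\<And>u. u \<in> Z \<Longrightarrow> msubst (neg_subst u) p = p" "\<And>u. u \<in> Z \<Longrightarrow> msubst (neg_subst u) q = q"
    by blast+
  moreover have "\<exists>P. vars P \<subseteq> W \<and> msubst (square_subst Z) P = p"
    by (rule even_poly_square_subst[OF two _ pq(1)]) (rule inv(1))
  moreover have "\<exists>Q. vars Q \<subseteq> W \<and> msubst (square_subst Z) Q = q"
    by (rule even_poly_square_subst[OF two _ pq(2)]) (rule inv(2))
  ultimately show ?thesis by blast
qed

subsection \<open>The invariant field\<close>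

definition sub_vars :: "nat \<Rightarrow> nat set" where
  "sub_vars n = {coord n 1 (Suc j) j | j. Suc j < n}"

text \<open>The free coordinates of the slice. The kernel condition removes \<open>n - 1\<close>
  entries and the Hessenberg form \<open>(n - 1) (n - 2) / 2\<close>, together the dimension of
  \<open>O_n\<close>.\<close>

definition slice_vars :: "nat \<Rightarrow> nat set" where
  "slice_vars n = {coord n s i j | s i j. s < 2 \<and> i < n \<and> j < n \<and>
     \<not> (s = 0 \<and> i = 0 \<and> 0 < j) \<and> \<not> (s = 1 \<and> Suc j < i)}"

lemma coord_in_sub_vars_iff:
  assumes "s < 2" "i < n" "j < n"
  shows "coord n s i j \<in> sub_vars n \<longleftrightarrow> s = 1 \<and> i = Suc j"
  using assms by (auto simp: sub_vars_def coord_eq_iff)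

lemma coord_in_slice_vars:
  assumes "s < 2" "i < n" "j < n" "\<not> (s = 0 \<and> i = 0 \<and> 0 < j)" "\<not> (s = 1 \<and> Suc j < i)"
  shows "coord n s i j \<in> slice_vars n"
  using assms by (auto simp: slice_vars_def)

lemma slice_vars_subset: "slice_vars n \<subseteq> {..<2 * n * n}"
  by (auto simp: slice_vars_def coord_decode)

lemma finite_slice_vars: "finite (slice_vars n)"
  using slice_vars_subset by (rule finite_subset) simp

lemma finite_sub_vars: "finite (sub_vars n)"
  by (rule finite_subset[of _ "{..<2 * n * n}"]) (auto simp: sub_vars_def intro!: coord_decode)

lemma specializes_frame_inv_var:
  assumes "odd n" "v \<in> slice_vars n"
  shows "specializes (slice_hom n) (frame_inv n v) (Fract (square_subst (sub_vars n) v) 1 :: 'a::field mpoly fract)"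
proof -
  obtain s i j where v: "v = coord n s i j" and ij: "s < 2" "i < n" "j < n"
    and c: "\<not> (s = 0 \<and> i = 0 \<and> 0 < j)" "\<not> (s = 1 \<and> Suc j < i)"
    using assms(2) by (auto simp: slice_vars_def)
  have "slice_num n var_fract s i j = (Fract (square_subst (sub_vars n) v) 1 :: 'a mpoly fract)"
    unfolding v square_subst_def coord_in_sub_vars_iff[OF ij]
    using c by (auto simp: slice_num_def power2_eq_square)
  then show ?thesis using specializes_frame_inv[OF assms(1) ij, where 'a = 'a] v by simp
qed

lemma det_in_subfield:
  fixes M :: "'r::idom mat"
  assumes S: "is_subfield S" and M: "M \<in> carrier_mat m m"
    and entries: "\<And>i j. i < m \<Longrightarrow> j < m \<Longrightarrow> Fract (M $$ (i, j)) 1 \<in> S"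
  shows "Fract (det M) 1 \<in> S"
proof -
  interpret F: comm_ring_hom "\<lambda>p :: 'r. Fract p 1"
    by unfold_locales (auto simp: Zero_fract_def One_fract_def)
  have sign: "Fract (signof p) 1 \<in> S" for p :: "nat \<Rightarrow> nat"
  proof -
    have "Fract (signof p :: 'r) 1 = 1 \<or> Fract (signof p :: 'r) 1 = - 1"
      by (auto simp: sign_def F.hom_uminus)
    then show ?thesis using is_subfield_1[OF S] is_subfield_uminus[OF S] by auto
  qed
  have "Fract (det M) 1 = (\<Sum>p\<in>{p. p permutes {0..<m}}. Fract (signof p) 1 * (\<Prod>i=0..<m. Fract (M $$ (i, p i)) 1))"
    unfolding det_def'[OF M] F.hom_sum F.hom_mult F.hom_prod ..
  also have "\<dots> \<in> S"
    by (intro is_subfield_sum[OF S] is_subfield_mult[OF S] is_subfield_prod[OF S] sign entries)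
      (auto dest: permutes_in_image)
  finally show ?thesis .
qed

lemma kernel_vec_in_ratfun_field:
  assumes "i < n"
  shows "kernel_vec n i \<in> ratfun_field n"
proof -
  let ?S = "ratfun_field n :: 'a mpoly fract set"
  have S: "is_subfield ?S" unfolding ratfun_field_eq by (rule is_subfield_ratfun_over)
  interpret F: comm_ring_hom "\<lambda>p :: 'a mpoly. Fract p 1"
    by unfold_locales (auto simp: Zero_fract_def One_fract_def)
  let ?M = "minor_mat n :: 'a mpoly mat"
  have skew: "Fract (skew_poly n i j) 1 \<in> ?S" if "i < n" "j < n" for i j
    unfolding Fract_skew_poly gen_skew_def gen_mat_def ratfun_field_eq
    using that by (intro is_subfield_diff[OF is_subfield_ratfun_over] ratfun_over_var) (auto intro: coord_decode)
  have car: "?M \<in> carrier_mat (n - 1) (n - 1)" by (simp add: minor_mat_def)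
  have M: "Fract (?M $$ (i, j)) 1 \<in> ?S" if "i < n - 1" "j < n - 1" for i j
    using that skew by (simp add: minor_mat_def)
  have det: "Fract (det ?M) 1 \<in> ?S"
    by (rule det_in_subfield[OF S car M])
  have adj: "Fract (adj_mat ?M $$ (i, j)) 1 \<in> ?S" if ij: "i < n - 1" "j < n - 1" for i j
  proof -
    have d: "mat_delete ?M j i \<in> carrier_mat (n - 1 - 1) (n - 1 - 1)" by (rule mat_delete_carrier[OF car])
    have "Fract (mat_delete ?M j i $$ (a, b)) 1 \<in> ?S" if "a < n - 1 - 1" "b < n - 1 - 1" for a b
      using that ij car by (auto simp: mat_delete_def intro!: M)
    then have "Fract (det (mat_delete ?M j i)) 1 \<in> ?S" by (rule det_in_subfield[OF S d])
    moreover have "Fract ((- 1) ^ (j + i) :: 'a mpoly) 1 \<in> ?S"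
      unfolding F.hom_power F.hom_uminus F.hom_one
      by (intro is_subfield_power[OF S] is_subfield_uminus[OF S] is_subfield_1[OF S])
    moreover have "adj_mat ?M $$ (i, j) = (- 1) ^ (j + i) * det (mat_delete ?M j i)"
      using ij car by (simp add: adj_mat_def cofactor_def)
    ultimately show ?thesis using is_subfield_mult[OF S] by (simp del: mult_fract add: F.hom_mult)
  qed
  show ?thesis
  proof (cases "i = 0")
    case True
    then show ?thesis using is_subfield_1[OF S] by (simp add: kernel_vec_def)
  next
    case False
    have "Fract (- (\<Sum>k<n - 1. adj_mat ?M $$ (i - 1, k) * skew_poly n (Suc k) 0)) 1 \<in> ?S"
      unfolding F.hom_uminus F.hom_sum F.hom_mult
      using False assms
      by (intro is_subfield_uminus[OF S] is_subfield_sum[OF S] is_subfield_mult[OF S] adj skew) auto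
    from is_subfield_divide[OF S this det] show ?thesis using False by (simp add: kernel_vec_def)
  qed
qed

lemma gram_schmidt_seq_in_subfield:
  assumes S: "is_subfield S"
    and Y: "\<And>i j. i < n \<Longrightarrow> j < n \<Longrightarrow> Y i j \<in> S" and w: "\<And>i. i < n \<Longrightarrow> w i \<in> S"
  shows "i < n \<Longrightarrow> gram_schmidt_seq n Y w k i \<in> S"
proof (induction k arbitrary: i rule: less_induct)
  case (less k)
  show ?case
  proof (cases k)
    case 0
    then show ?thesis using less.prems w by simp
  next
    case (Suc k')
    have IH: "gram_schmidt_seq n Y w j i \<in> S" if "j \<le> k'" "i < n" for j i
      using less.IH[of j i] that Suc by simp
    show ?thesis unfolding Suc gram_schmidt_seq.simps dotp_def mapply_def
      by (intro is_subfield_diff[OF S] is_subfield_sum[OF S] is_subfield_mult[OF S]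
          is_subfield_divide[OF S] IH Y) (auto simp: less.prems)
  qed
qed

lemma frame_inv_in_inv_field:
  assumes "(2::'a::field) \<noteq> 0" "odd n" "v < 2 * n * n"
  shows "frame_inv n v \<in> (inv_field n :: 'a mpoly fract set)"
proof -
  let ?S = "ratfun_field n :: 'a mpoly fract set"
  have S: "is_subfield ?S" unfolding ratfun_field_eq by (rule is_subfield_ratfun_over)
  obtain s i j where v: "v = coord n s i j" and ij: "s < 2" "i < n" "j < n"
    using assms(3) by (rule coord_cases)
  have gen: "gen_mat n s i j \<in> ?S" if "s < 2" "i < n" "j < n" for s i j
    unfolding gen_mat_def ratfun_field_eq using that by (intro ratfun_over_var) (simp add: coord_decode)
  have "gen_seq n k i \<in> ?S" if "i < n" for k i
    by (rule gram_schmidt_seq_in_subfield[OF S _ _ that]) (auto intro: gen kernel_vec_in_ratfun_field)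
  then have "frame_inv n v \<in> ?S"
    unfolding v frame_inv_coord[OF ij] frame_entry_def dotp_def mapply_def
    by (intro is_subfield_divide[OF S] is_subfield_sum[OF S] is_subfield_mult[OF S] gen
        kernel_vec_in_ratfun_field) (use ij in auto)
  then show ?thesis
    using frame_inv_invariant[OF assms(2,1) _ ij] v by (simp add: inv_field_iff)
qed

definition sign_mat :: "nat \<Rightarrow> nat \<Rightarrow> nat \<Rightarrow> 'a::field" where
  "sign_mat a i j = (if i = j then if i = a then - 1 else 1 else 0)"

lemma orthogonal_sign_mat: "orthogonal_mat n (sign_mat a)"
proof -
  have "(\<Sum>k<n. sign_mat a i k * sign_mat a j k) = (if i = j then 1 else 0 :: 'a::field)" if "i < n" "j < n" for i j
  proof -
    have "(\<Sum>k<n. sign_mat a i k * sign_mat a j k) = (\<Sum>k<n. if k = i then if i = j then 1 else 0 else 0 :: 'a)"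
      by (intro sum.cong refl) (auto simp: sign_mat_def)
    then show ?thesis using that by simp
  qed
  then show ?thesis by (simp add: Defs.orthogonal_mat_def)
qed

lemma conj_sign_mat:
  assumes "i < n" "j < n"
  shows "conj_mat n (sign_mat a) M i j = sign_mat a i i * sign_mat a j j * M i j"
proof -
  have "conj_mat n (sign_mat a) M i j = (\<Sum>l<n. sign_mat a i i * sign_mat a j l * M i l)"
    unfolding conj_mat_def by (rule sum_eq_single) (use assms in \<open>auto simp: sign_mat_def\<close>)
  also have "\<dots> = sign_mat a i i * sign_mat a j j * M i j"
    by (rule sum_eq_single) (use assms in \<open>auto simp: sign_mat_def\<close>)
  finally show ?thesis .
qed

lemma slice_hom_conj:
  "slice_hom n (msubst (conj_subst n A) p) =
    heval const_fract (\<lambda>v. heval const_fract (slice_pt n var_fract) (conj_subst n A v)) p"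
  unfolding slice_hom_def by (rule heval_msubst[OF comm_ring_hom_const_fract])

text \<open>\<open>slice_num\<close> contains \<open>z_a\<close> only as a square, so negating
  \<open>z_a\<close> changes just the denominators \<open>z_i z_j\<close>, by exactly the signs of
  conjugation by \<open>sign_mat a\<close>. Index 0 is excluded because \<open>z_0\<close> is fixed
  at 1.\<close>

lemma specializes_neg_slice_hom:
  assumes a: "0 < a" "a < n"
  shows "specializes (neg_hom (coord n 1 a (a - 1))) (slice_hom n p)
    (slice_hom n (msubst (conj_subst n (sign_mat a)) p) :: 'a::field mpoly fract)"
proof -
  let ?c = "coord n 1 a (a - 1)"
  interpret c: comm_ring_hom "const_fract :: 'a \<Rightarrow> 'a mpoly fract" by (rule comm_ring_hom_const_fract)
  interpret specialization "neg_hom ?c :: 'a mpoly \<Rightarrow> _"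
    unfolding specialization_def neg_hom_def[abs_def] by (rule comm_ring_hom_Fract_msubst)
  define g :: "nat \<Rightarrow> 'a mpoly fract" where "g v = (if v = ?c then - var_fract v else var_fract v)" for v
  have const: "specializes (neg_hom ?c) (const_fract b) (const_fract b)" for b :: 'a
    unfolding neg_hom_def[abs_def] by (rule specializes_const_Fract_msubst)
  have var: "specializes (neg_hom ?c) (var_fract v) (g v)" for v
    using specializes_Fract_1[of "mvar v"] by (cases "v = ?c") (simp_all add: g_def neg_hom_def neg_subst_def)
  have c: "coord n s i j = ?c \<longleftrightarrow> s = 1 \<and> i = a \<and> j = a - 1" if "s < 2" "i < n" "j < n" for s i j
    using a that by (intro coord_eq_iff) auto
  have g: "g (coord n s i j) = var_fract (coord n s i j)"
    if "s < 2" "i < n" "j < n" "\<not> (s = 1 \<and> i = Suc j)" for s i j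
    unfolding g_def c[OF that(1-3)] using that(4) a by auto
  have square: "(g v)\<^sup>2 = (var_fract v)\<^sup>2" for v
    by (simp add: g_def power2_eq_square)
  have z: "zcoord n g i = sign_mat a i i * zcoord n var_fract i" if "i < n" for i
    using that a c[of 1 i "i - 1"] by (auto simp: zcoord_def g_def sign_mat_def)
  have z0: "zcoord n g i \<noteq> 0" if "i < n" for i
    using z[OF that] zcoord_var_fract_nonzero[where 'a = 'a] by (auto simp: sign_mat_def)
  have "heval const_fract (slice_pt n var_fract) (conj_subst n (sign_mat a) v) = slice_pt n g v" for v
  proof (cases "v < 2 * n * n")
    case True
    then obtain s i j where v: "v = coord n s i j" and ij: "s < 2" "i < n" "j < n"
      by (rule coord_cases)
    have sg: "const_fract (sign_mat a i k) = (sign_mat a i k :: 'a mpoly fract)" for i k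
      by (simp add: sign_mat_def c.hom_uminus)
    have "slice_num n g s i j = slice_num n var_fract s i j"
    proof (cases "s = 1 \<and> i = Suc j")
      case False
      have "g (coord n s i j) = var_fract (coord n s i j)"
        by (rule g) (use ij False in auto)
      moreover have "g (coord n 0 j 0) = var_fract (coord n 0 j 0)"
        by (rule g) (use ij in auto)
      ultimately show ?thesis using False by (simp only: slice_num_def if_False)
    qed (simp add: slice_num_def square)
    then have "slice_pt n g v = sign_mat a i i * sign_mat a j j * slice_pt n var_fract v"
      unfolding v slice_pt_coord[OF ij] using ij
      by (simp add: z sign_mat_def del: mult_fract divide_fract)
    then show ?thesis
      unfolding v heval_conj_subst[OF comm_ring_hom_const_fract ij] sg
      by (simp add: conj_sign_mat ij)
  next
    case False
    then have "v \<noteq> ?c" using coord_decode(1)[of 1 a n "a - 1"] a by auto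
    with False show ?thesis
      by (simp add: heval_conj_subst_outside[OF comm_ring_hom_const_fract] slice_pt_def g_def)
  qed
  then show ?thesis
    unfolding slice_hom_conj
    by (simp only:) (unfold slice_hom_def, intro specializes_heval const specializes_slice_pt var z0)
qed

lemma slice_hom_conj_in_ratfun_over:
  assumes "vars p \<subseteq> {..<2 * n * n}"
  shows "slice_hom n (msubst (conj_subst n A) p) \<in> ratfun_over (slice_vars n)"
proof -
  let ?S = "ratfun_over (slice_vars n) :: 'a mpoly fract set"
  have S: "is_subfield ?S" by (rule is_subfield_ratfun_over)
  have z: "zcoord n var_fract i \<in> ?S" if "i < n" for i
    using that by (simp add: zcoord_def is_subfield_1[OF S] ratfun_over_var coord_in_slice_vars)
  have num: "slice_num n var_fract s i j \<in> ?S" if "s < 2" "i < n" "j < n" for s i j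
    unfolding slice_num_def using that
    by (simp add: ratfun_over_var coord_in_slice_vars is_subfield_power[OF S] is_subfield_0[OF S])
  have pt: "slice_pt n var_fract (coord n s i j) \<in> ?S" if "s < 2" "i < n" "j < n" for s i j
    unfolding slice_pt_coord[OF that]
    by (intro is_subfield_divide[OF S] is_subfield_mult[OF S] z num that)
  show ?thesis unfolding slice_hom_conj
  proof (rule is_subfield_heval[OF S ratfun_over_const])
    fix v assume "v \<in> vars p"
    then have "v < 2 * n * n" using assms by auto
    then obtain s i j where v: "v = coord n s i j" and ij: "s < 2" "i < n" "j < n"
      by (rule coord_cases)
    show "heval const_fract (slice_pt n var_fract) (conj_subst n A v) \<in> ?S"
      unfolding v heval_conj_subst[OF comm_ring_hom_const_fract ij] conj_mat_def
      by (intro is_subfield_sum[OF S] is_subfield_mult[OF S] ratfun_over_const pt) (use ij in auto)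
  qed
qed

lemma heval_square_subst:
  "heval const_fract (\<lambda>v. Fract (square_subst Z v) 1) P = Fract (msubst (square_subst Z) P) 1"
  using heval_msubst[OF comm_ring_hom_const_fract, of var_fract "square_subst Z" P]
  by (simp add: heval_Fract)

lemma specializes_heval_frame_inv:
  fixes P :: "'a::field mpoly"
  assumes n: "odd n" and "vars P \<subseteq> slice_vars n"
  shows "specializes (slice_hom n) (heval const_fract (frame_inv n) P)
    (Fract (msubst (square_subst (sub_vars n)) P) 1)"
proof -
  interpret specialization "slice_hom n :: 'a mpoly \<Rightarrow> _"
    unfolding specialization_def by (rule comm_ring_hom_slice_hom)
  have const: "specializes (slice_hom n) (const_fract b) (const_fract b)" for b :: 'a
    using specializes_Fract_1[of "mconst b"]
    by (simp add: const_fract_def[of b] slice_hom_def comm_ring_hom.heval_const[OF comm_ring_hom_const_fract])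
  show ?thesis unfolding heval_square_subst[symmetric]
    by (intro specializes_heval const specializes_frame_inv_var[OF n]) (use assms in auto)
qed

text \<open>A relation restricts on the slice to one between distinct variables and squares of
  variables, and \<open>square_subst\<close> is injective.\<close>

lemma frame_inv_independent:
  fixes P :: "'a::field mpoly"
  assumes n: "odd n" and P: "vars P \<subseteq> slice_vars n" and "heval const_fract (frame_inv n) P = 0"
  shows "P = 0"
proof -
  interpret specialization "slice_hom n :: 'a mpoly \<Rightarrow> _"
    unfolding specialization_def by (rule comm_ring_hom_slice_hom)
  have "Fract (msubst (square_subst (sub_vars n)) P) 1 = 0"
    using specializes_unique[OF specializes_heval_frame_inv[OF n P]] assms(3) specializes_0 by simp
  then show ?thesis using square_subst_eq_0 by (simp add: Fract_1_eq_0_iff)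
qed

context
  fixes n :: nat
  assumes inf: "infinite (UNIV :: 'a::field set)" and two: "(2::'a) \<noteq> 0" and n: "odd n"
begin

text \<open>An invariant vanishing on the slice vanishes on all conjugates of the slice.\<close>

lemma inv_field_slice_zero:
  fixes f :: "'a mpoly fract"
  assumes f: "f \<in> inv_field n" and zero: "specializes (slice_hom n) f 0"
  shows "f = 0"
proof -
  interpret s: comm_ring_hom "slice_hom n :: 'a mpoly \<Rightarrow> _" by (rule comm_ring_hom_slice_hom)
  obtain p q where q: "slice_hom n q \<noteq> 0" and f_eq: "f = Fract p q" and p: "slice_hom n p = 0"
    using zero unfolding specializes_def by auto
  have "q \<noteq> 0" using q by auto
  have "slice_hom n (msubst (conj_subst n A) p) = 0" if A: "orthogonal_mat n A" for A
  proof -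
    interpret specialization "conj_hom n A"
      unfolding specialization_def by (rule comm_ring_hom_conj_hom)
    have "conj_hom n A p = f * conj_hom n A q"
      using specializes_eq[of p q f] f A \<open>q \<noteq> 0\<close> by (simp add: inv_field_iff f_eq)
    \<comment> \<open>Invariance without division. On the slice the right-hand side vanishes and
      \<open>q\<close> does not, so the conjugate of \<open>p\<close> vanishes.\<close>
    then have "q * msubst (conj_subst n A) p = p * msubst (conj_subst n A) q"
      using \<open>q \<noteq> 0\<close> by (simp add: conj_hom_def f_eq eq_fract mult.commute)
    from arg_cong[OF this, of "slice_hom n"] show ?thesis
      using p q by (simp add: s.hom_mult)
  qed
  then have "p = 0" by (rule slice_dense[OF inf two n])
  then show ?thesis by (simp add: f_eq Zero_fract_def eq_fract)
qed

text \<open>The restriction of \<open>f\<close> is invariant under sign changes, so it is a quotient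
  \<open>P / Q\<close> in the slice variables with the \<open>z_i\<close> squared. The same quotient
  in the frame invariants restricts to it too, and \<open>inv_field_slice_zero\<close> makes the
  difference vanish.\<close>

lemma inv_field_generated:
  fixes f :: "'a mpoly fract"
  assumes f: "f \<in> inv_field n"
  shows "\<exists>P Q. vars P \<subseteq> slice_vars n \<and> vars Q \<subseteq> slice_vars n \<and>
    heval const_fract (frame_inv n) Q \<noteq> 0 \<and>
    f = heval const_fract (frame_inv n) P / heval const_fract (frame_inv n) Q"
proof -
  let ?W = "slice_vars n" and ?Z = "sub_vars n"
  interpret s: specialization "slice_hom n :: 'a mpoly \<Rightarrow> _"
    unfolding specialization_def by (rule comm_ring_hom_slice_hom)
  obtain p q where f_eq: "f = Fract p q" and vars: "vars p \<subseteq> {..<2 * n * n}" "vars q \<subseteq> {..<2 * n * n}"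
    and q: "q \<noteq> 0"
    using f by (auto simp: inv_field_def ratfun_field_def)
  \<comment> \<open>The given denominator may vanish on the slice. By density some conjugate of it
    does not, and by invariance the conjugated fraction is still \<open>f\<close>.\<close>
  have "\<exists>A. orthogonal_mat n A \<and> slice_hom n (msubst (conj_subst n A) q) \<noteq> 0"
    using slice_dense[OF inf two n, of q] q by blast
  then obtain A where A: "orthogonal_mat n A" "slice_hom n (msubst (conj_subst n A) q) \<noteq> 0" by blast
  define p' where "p' = msubst (conj_subst n A) p"
  define q' where "q' = msubst (conj_subst n A) q"
  have q': "slice_hom n q' \<noteq> 0" using A by (simp add: q'_def)
  then have "q' \<noteq> 0" by auto
  have f_eq': "f = Fract p' q'"
    using f A(1) q f_eq unfolding inv_field_def p'_def q'_def by auto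
  define h where "h = slice_hom n p' / slice_hom n q'"
  have fh: "specializes (slice_hom n) f h"
    unfolding f_eq' h_def by (rule s.specializes_Fract[OF q'])
  have "h \<in> ratfun_over ?W"
    unfolding h_def p'_def q'_def
    by (intro is_subfield_divide[OF is_subfield_ratfun_over] slice_hom_conj_in_ratfun_over vars)
  moreover have "specializes (neg_hom v) h h" if in_Z: "v \<in> ?Z" for v
  proof -
    obtain j where j: "Suc j < n" and v: "v = coord n 1 (Suc j) (Suc j - 1)"
      using in_Z by (auto simp: sub_vars_def)
    interpret N: specialization "neg_hom v :: 'a mpoly \<Rightarrow> _"
      unfolding specialization_def neg_hom_def[abs_def] by (rule comm_ring_hom_Fract_msubst)
    let ?E = "sign_mat (Suc j) :: nat \<Rightarrow> nat \<Rightarrow> 'a"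
    interpret E: specialization "conj_hom n ?E"
      unfolding specialization_def by (rule comm_ring_hom_conj_hom)
    have sp: "specializes (neg_hom v) (slice_hom n r) (slice_hom n (msubst (conj_subst n ?E) r))" for r
      unfolding v using j by (intro specializes_neg_slice_hom) auto
    have inj: "neg_hom v r = 0 \<Longrightarrow> r = 0" for r :: "'a mpoly"
      unfolding neg_hom_def Fract_1_eq_0_iff by (rule neg_subst_eq_0)
    \<comment> \<open>The sign change is injective, so it cannot annihilate the nonzero restriction
      of \<open>q'\<close>.\<close>
    have Eq': "slice_hom n (msubst (conj_subst n ?E) q') \<noteq> 0"
      using N.specializes_inj_zero[of "slice_hom n q'", OF inj] sp[of q'] q' by auto
    have "conj_hom n ?E p' = f * conj_hom n ?E q'"
      using E.specializes_eq[of p' q' f] f orthogonal_sign_mat \<open>q' \<noteq> 0\<close> by (auto simp: inv_field_iff f_eq')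
    then have "q' * msubst (conj_subst n ?E) p' = p' * msubst (conj_subst n ?E) q'"
      using \<open>q' \<noteq> 0\<close> by (simp add: conj_hom_def f_eq' eq_fract mult.commute)
    from arg_cong[OF this, of "slice_hom n"]
    have "slice_hom n (msubst (conj_subst n ?E) p') / slice_hom n (msubst (conj_subst n ?E) q') = h"
      using q' Eq' unfolding s.hom_mult h_def by (simp add: frac_eq_eq mult.commute)
    then show ?thesis
      using N.specializes_divide[OF sp[of p'] sp[of q'] Eq'] by (simp add: h_def)
  qed
  ultimately have "\<exists>P Q. vars P \<subseteq> ?W \<and> vars Q \<subseteq> ?W \<and> msubst (square_subst ?Z) Q \<noteq> 0 \<and>
      h = Fract (msubst (square_subst ?Z) P) (msubst (square_subst ?Z) Q)"
    by (rule neg_invariant_square[OF two finite_sub_vars])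
  then obtain P Q where P: "vars P \<subseteq> ?W" and Q: "vars Q \<subseteq> ?W" "msubst (square_subst ?Z) Q \<noteq> 0"
    and h: "h = Fract (msubst (square_subst ?Z) P) (msubst (square_subst ?Z) Q)"
    by blast
  let ?P = "heval const_fract (frame_inv n) P" and ?Q = "heval const_fract (frame_inv n) Q"
  have Q0: "Fract (msubst (square_subst ?Z) Q) 1 \<noteq> 0" using Q(2) by (simp add: Fract_1_eq_0_iff)
  have "specializes (slice_hom n) (?P / ?Q) h"
    using s.specializes_divide[OF specializes_heval_frame_inv[OF n P] specializes_heval_frame_inv[OF n Q(1)] Q0]
    by (simp add: h)
  then have zero: "specializes (slice_hom n) (f - ?P / ?Q) 0"
    using s.specializes_diff[OF fh] by fastforce
  have in_inv: "heval const_fract (frame_inv n) R \<in> inv_field n" if "vars R \<subseteq> ?W" for R :: "'a mpoly"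
    using that slice_vars_subset
    by (intro is_subfield_heval[OF is_subfield_inv_field const_in_inv_field] frame_inv_in_inv_field[OF two n]) auto
  have "f - ?P / ?Q \<in> inv_field n"
    by (intro is_subfield_diff[OF is_subfield_inv_field] is_subfield_divide[OF is_subfield_inv_field] f in_inv P Q)
  then have "f - ?P / ?Q = 0" using zero by (rule inv_field_slice_zero)
  moreover have "?Q \<noteq> 0" by (rule s.specializes_nonzero[OF specializes_heval_frame_inv[OF n Q(1)] Q0])
  ultimately show ?thesis using P Q(1) by (intro exI[of _ P] exI[of _ Q]) simp
qed

end

text \<open>\<open>purely_transcendental\<close> numbers its generators consecutively from 0, while
  the invariants are indexed by scattered variables; a bijection renames the variables in both
  directions.\<close>

lemma purely_transcendentalI:
  fixes c :: "'a::field \<Rightarrow> 'k::field" and t :: "nat \<Rightarrow> 'k"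
  assumes c: "comm_ring_hom c" and W: "finite W"
    and indep: "\<And>P. vars P \<subseteq> W \<Longrightarrow> heval c t P = 0 \<Longrightarrow> P = 0"
    and L: "L = {heval c t P / heval c t Q | P Q. vars P \<subseteq> W \<and> vars Q \<subseteq> W \<and> heval c t Q \<noteq> 0}"
    and t: "\<And>v. v \<in> W \<Longrightarrow> t v \<in> L"
  shows "purely_transcendental c L"
proof -
  obtain e where e: "bij_betw e {..<card W} W"
    using ex_bij_betw_nat_finite[OF W] by (auto simp: atLeast0LessThan)
  define d where "d = inv_into {..<card W} e"
  have de: "d (e i) = i" if "i < card W" for i
    unfolding d_def using e that by (simp add: bij_betw_inv_into_left)
  have ed: "e (d v) = v" "d v < card W" if "v \<in> W" for v
    using e that bij_betw_inv_into_right[OF e that] bij_betw_apply[OF bij_betw_inv_into[OF e] that]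
    by (auto simp: d_def)
  have eW: "e i \<in> W" if "i < card W" for i
    using bij_betw_apply[OF e, of i] that by simp
  define up :: "'a mpoly \<Rightarrow> 'a mpoly" where "up = msubst (\<lambda>i. mvar (e i))"
  define dn :: "'a mpoly \<Rightarrow> 'a mpoly" where "dn = msubst (\<lambda>v. mvar (d v))"
  have up: "heval c (\<lambda>i. t (e i)) P = heval c t (up P)" for P
    unfolding up_def heval_msubst[OF c] comm_ring_hom.heval_var[OF c] ..
  have vars_up: "vars (up P) \<subseteq> W" if "vars P \<subseteq> {..<card W}" for P
  proof -
    have "vars (up P) \<subseteq> (\<Union>i\<in>vars P. {e i})"
      using vars_msubst[of "\<lambda>i. mvar (e i)" P] by (simp add: up_def)
    also have "\<dots> \<subseteq> W" using that eW by auto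
    finally show ?thesis .
  qed
  have vars_dn: "vars (dn P) \<subseteq> {..<card W}" if "vars P \<subseteq> W" for P
  proof -
    have "vars (dn P) \<subseteq> (\<Union>v\<in>vars P. {d v})"
      using vars_msubst[of "\<lambda>v. mvar (d v)" P] by (simp add: dn_def)
    also have "\<dots> \<subseteq> {..<card W}" using that ed by auto
    finally show ?thesis .
  qed
  have dn_up: "dn (up P) = P" if "vars P \<subseteq> {..<card W}" for P
  proof -
    have "dn (up P) = msubst mvar P"
      unfolding dn_def up_def msubst_msubst msubst_var by (rule msubst_cong) (use that de in auto)
    then show ?thesis by simp
  qed
  have up_dn: "up (dn P) = P" if "vars P \<subseteq> W" for P
  proof -
    have "up (dn P) = msubst mvar P"
      unfolding dn_def up_def msubst_msubst msubst_var by (rule msubst_cong) (use that ed in auto)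
    then show ?thesis by simp
  qed
  have "\<forall>P. vars P \<subseteq> {..<card W} \<longrightarrow> heval c (\<lambda>i. t (e i)) P = 0 \<longrightarrow> P = 0"
  proof (intro allI impI)
    fix P assume P: "vars P \<subseteq> {..<card W}" "heval c (\<lambda>i. t (e i)) P = 0"
    have "up P = 0" by (intro indep vars_up P(1)) (use P(2) in \<open>simp only: up\<close>)
    then show "P = 0" using dn_up[OF P(1)] by (simp add: dn_def msubst_zero)
  qed
  moreover have "\<forall>i<card W. t (e i) \<in> L"
    by (intro allI impI t eW)
  moreover have "L = {heval c (\<lambda>i. t (e i)) P / heval c (\<lambda>i. t (e i)) Q | P Q.
      vars P \<subseteq> {..<card W} \<and> vars Q \<subseteq> {..<card W} \<and> heval c (\<lambda>i. t (e i)) Q \<noteq> 0}" (is "_ = ?R")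
  proof
    show "L \<subseteq> ?R"
    proof
      fix x assume "x \<in> L"
      then obtain P Q where x: "x = heval c t P / heval c t Q" "vars P \<subseteq> W" "vars Q \<subseteq> W" "heval c t Q \<noteq> 0"
        unfolding L by blast
      then have "x = heval c (\<lambda>i. t (e i)) (dn P) / heval c (\<lambda>i. t (e i)) (dn Q)"
        "heval c (\<lambda>i. t (e i)) (dn Q) \<noteq> 0"
        unfolding up up_dn[OF x(2)] up_dn[OF x(3)] by auto
      then show "x \<in> ?R" using vars_dn[OF x(2)] vars_dn[OF x(3)] by blast
    qed
    show "?R \<subseteq> L"
    proof
      fix x assume "x \<in> ?R"
      then obtain P Q where x: "x = heval c t (up P) / heval c t (up Q)"
        "vars P \<subseteq> {..<card W}" "vars Q \<subseteq> {..<card W}" "heval c t (up Q) \<noteq> 0"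
        unfolding up by blast
      then show "x \<in> L" unfolding L using vars_up[OF x(2)] vars_up[OF x(3)] by blast
    qed
  qed
  ultimately show ?thesis
    unfolding purely_transcendental_def
    by (intro exI[of _ "card W"] exI[of _ "\<lambda>i. t (e i)"] conjI)
qed

theorem theorem1p2:
  fixes n :: nat
  assumes "infinite (UNIV :: 'a::field set)"
    and "(2::'a) \<noteq> 0"
    and "odd n"
  shows "purely_transcendental (const_fract :: 'a \<Rightarrow> 'a mpoly fract) (inv_field n)"
proof (rule purely_transcendentalI[where W = "slice_vars n" and t = "frame_inv n"])
  let ?t = "frame_inv n :: nat \<Rightarrow> 'a mpoly fract"
  have t: "?t v \<in> inv_field n" if "v \<in> slice_vars n" for v
    using that slice_vars_subset by (intro frame_inv_in_inv_field assms(2,3)) auto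
  show "?t v \<in> inv_field n" if "v \<in> slice_vars n" for v by (rule t[OF that])
  have in_inv: "heval const_fract ?t P \<in> inv_field n" if "vars P \<subseteq> slice_vars n" for P
    using that t by (intro is_subfield_heval[OF is_subfield_inv_field const_in_inv_field]) auto
  show "inv_field n = {heval const_fract ?t P / heval const_fract ?t Q | P Q.
      vars P \<subseteq> slice_vars n \<and> vars Q \<subseteq> slice_vars n \<and> heval const_fract ?t Q \<noteq> 0}" (is "_ = ?R")
  proof
    show "inv_field n \<subseteq> ?R" using inv_field_generated[OF assms] by blast
    show "?R \<subseteq> inv_field n" using in_inv is_subfield_divide[OF is_subfield_inv_field] by blast
  qed
qed (use frame_inv_independent[OF assms(3)] finite_slice_vars comm_ring_hom_const_fract in auto)

end
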